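(* Let $X$ be a Banach space and let $\mathcal{K}$ be a compact set contained in the unit ball of $X$. Let $0\le\mu\le\frac12$ and $s>\mu$, and assume that there are constants $C_1,C_2>0$ such that $\gamma_n(X)\le C_1n^{\mu}$ and $d_n(\mathcal{K})_X\le C_2n^{-s}$ for all $n\ge1$. Then there exists a constant $C>0$ such that $$\sigma_n(\mathcal{K})_X\le C\,n^{-s+\mu}\big(\log(n+2)\big)^{\min(s,1/2)}\qquad\text{for all } n\ge1 .$$ In particular, when $X=L_p$ with $1\le p\le\infty$, $\mathcal{K}$ is a compact set contained in the unit ball of $L_p$, and $d_n(\mathcal{K})_{L_p}\le C_2n^{-s}$ for all $n\ge 1$ with some $s>\big|\frac12-\frac1p\big|$, there exists a constant $C>0$ such that $$\sigma_n(\mathcal{K})_{L_p}\le C\,n^{-s+|\frac12-\frac1p|}\big(\log(n+2)\big)^{\min(s,1/2)}\qquad\text{for all } n\ge1 .$$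
   Context: Greedy algorithm: for a (nonempty) compact set $\mathcal{K}$ in a Banach space $X$, choose $f_0\in\mathcal{K}$ with $\|f_0\|_X=\max_{f\in\mathcal{K}}\|f\|_X$; having chosen $f_0,\dots,f_{n-1}$, put $V_n=\operatorname{span}\{f_0,\dots,f_{n-1}\}$ and choose $f_n\in\mathcal{K}$ with $\operatorname{dist}(f_n,V_n)_X=\max_{f\in\mathcal{K}}\operatorname{dist}(f,V_n)_X$, where $\operatorname{dist}(f,V)_X=\inf_{g\in V}\|f-g\|_X$. Set $\sigma_0(\mathcal{K})_X=\|f_0\|_X$ and $\sigma_n(\mathcal{K})_X=\operatorname{dist}(f_n,V_n)_X$ for $n\ge1$. The sequences $(f_n)$ and $(\sigma_n(\mathcal{K})_X)$ need not be unique; the statement concerns any sequence produced by this algorithm. Kolmogorov widths: for $n\ge 1$, $d_n(\mathcal{K})_X=\inf_L\sup_{f\in\mathcal{K}}\operatorname{dist}(f,L)_X$, the infimum over all $n$-dimensional subspaces $L$ of $X$ (if $\dim X<n$, over subspaces of dimension at most $n$). Banach–Mazur distance: for isomorphic Banach spaces $Y,Z$, $d(Y,Z)=\inf\{\|T\|\,\|T^{-1}\| : T:Y\to Z \text{ an isomorphism}\}$. For $n\ge1$, $\gamma_n(X)=\sup\{d(V,\ell_2^n): V \text{ an } n\text{-dimensional subspace of } X\}$ (the supremum of the empty set being $0$). $L_p$ denotes the usual Lebesgue space over a measure space; $1/p=0$ for $p=\infty$. *)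

theory Defs
  imports "HOL-Analysis.Analysis" "HOL-Probability.Essential_Supremum"
begin

section \<open>Greedy algorithm and Kolmogorov widths\<close>

definition greedy_sequence :: "'a::real_normed_vector set \<Rightarrow> (nat \<Rightarrow> 'a) \<Rightarrow> bool" where
  "greedy_sequence K f \<longleftrightarrow>
     f 0 \<in> K \<and> (\<forall>h\<in>K. norm h \<le> norm (f 0)) \<and>
     (\<forall>n\<ge>1. f n \<in> K \<and>
       (\<forall>h\<in>K. infdist h (span (f ` {..<n})) \<le> infdist (f n) (span (f ` {..<n}))))"

definition greedy_error :: "(nat \<Rightarrow> 'a::real_normed_vector) \<Rightarrow> nat \<Rightarrow> real" where
  "greedy_error f n = (if n = 0 then norm (f 0) else infdist (f n) (span (f ` {..<n})))"

text \<open>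
  As \<^const>\<open>dim\<close> is 0 on infinite-dimensional subspaces, \<open>dim L = n\<close> means ``\<open>L\<close> has dimension
  \<open>n\<close>'' only for \<open>n \<ge> 1\<close>; all notions below are meant for \<open>n \<ge> 1\<close>.  The second alternative in
  \<open>width_subspaces\<close> applies only if the whole space has dimension less than \<open>n\<close>.
\<close>

definition subspaces_of_dim :: "nat \<Rightarrow> 'a::real_vector set set" where
  "subspaces_of_dim n = {L. subspace L \<and> dim L = n}"

definition width_subspaces :: "nat \<Rightarrow> 'a::real_vector set set" where
  "width_subspaces n =
     (if subspaces_of_dim n \<noteq> ({} :: 'a set set) then subspaces_of_dim n
      else {L. subspace L \<and> dim L \<le> n})"

definition kolmogorov_width :: "'a::real_normed_vector set \<Rightarrow> nat \<Rightarrow> real" where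
  "kolmogorov_width K n = (INF L\<in>width_subspaces n. SUP f\<in>K. infdist f L)"


section \<open>The Hilbert space of square-summable sequences\<close>

lemma summable_mult_square:
  fixes x y :: "nat \<Rightarrow> real"
  assumes "summable (\<lambda>i. (x i)\<^sup>2)" "summable (\<lambda>i. (y i)\<^sup>2)"
  shows "summable (\<lambda>i. x i * y i)"
proof (rule summable_comparison_test')
  show "summable (\<lambda>i. (x i)\<^sup>2 + (y i)\<^sup>2)"
    using assms by (rule summable_add)
  show "norm (x i * y i) \<le> (x i)\<^sup>2 + (y i)\<^sup>2" for i
  proof -
    have "2 * (\<bar>x i\<bar> * \<bar>y i\<bar>) \<le> (x i)\<^sup>2 + (y i)\<^sup>2"
      using sum_squares_bound[of "\<bar>x i\<bar>" "\<bar>y i\<bar>"] by (simp add: mult.assoc)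
    moreover have "0 \<le> \<bar>x i\<bar> * \<bar>y i\<bar>"
      by simp
    ultimately show ?thesis
      by (simp only: real_norm_def abs_mult)
  qed
qed

typedef ell2 = "{x :: nat \<Rightarrow> real. summable (\<lambda>i. (x i)\<^sup>2)}"
  morphisms ell2_nth Abs_ell2
  by (rule exI[of _ "\<lambda>_. 0"]) simp

setup_lifting type_definition_ell2

instantiation ell2 :: real_inner
begin

lift_definition zero_ell2 :: ell2 is "\<lambda>_. 0"
  by simp

lift_definition plus_ell2 :: "ell2 \<Rightarrow> ell2 \<Rightarrow> ell2" is "\<lambda>x y i. x i + y i"
  by (simp add: power2_sum mult.assoc summable_add summable_mult summable_mult_square)

lift_definition minus_ell2 :: "ell2 \<Rightarrow> ell2 \<Rightarrow> ell2" is "\<lambda>x y i. x i - y i"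
  by (simp add: power2_diff mult.assoc summable_add summable_diff summable_mult
      summable_mult_square)

lift_definition uminus_ell2 :: "ell2 \<Rightarrow> ell2" is "\<lambda>x i. - x i"
  by simp

lift_definition scaleR_ell2 :: "real \<Rightarrow> ell2 \<Rightarrow> ell2" is "\<lambda>c x i. c * x i"
  by (simp add: power_mult_distrib summable_mult)

lift_definition inner_ell2 :: "ell2 \<Rightarrow> ell2 \<Rightarrow> real" is "\<lambda>x y. \<Sum>i. x i * y i" .

definition norm_ell2 :: "ell2 \<Rightarrow> real" where
  "norm_ell2 x = sqrt (inner x x)"

definition sgn_ell2 :: "ell2 \<Rightarrow> ell2" where
  "sgn_ell2 x = inverse (norm x) *\<^sub>R x"

definition dist_ell2 :: "ell2 \<Rightarrow> ell2 \<Rightarrow> real" where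
  "dist_ell2 x y = norm (x - y)"

definition uniformity_ell2 :: "(ell2 \<times> ell2) filter" where
  [code del]: "uniformity_ell2 = (INF e\<in>{0 <..}. principal {(x, y). dist x y < e})"

definition open_ell2 :: "ell2 set \<Rightarrow> bool" where
  [code del]: "open_ell2 S \<longleftrightarrow> (\<forall>x\<in>S. \<forall>\<^sub>F (x', y) in uniformity. x' = x \<longrightarrow> y \<in> S)"

instance
proof
  fix x y z :: ell2 and a b r :: real
  show "x + y + z = x + (y + z)" "x + y = y + x" "0 + x = x" "- x + x = 0" "x - y = x + - y"
    by (transfer; simp add: fun_eq_iff)+
  show "a *\<^sub>R (x + y) = a *\<^sub>R x + a *\<^sub>R y" "(a + b) *\<^sub>R x = a *\<^sub>R x + b *\<^sub>R x"
    "a *\<^sub>R b *\<^sub>R x = (a * b) *\<^sub>R x" "1 *\<^sub>R x = x"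
    by (transfer; simp add: fun_eq_iff algebra_simps)+
  show "inner x y = inner y x"
    by transfer (simp add: mult.commute)
  show "inner (x + y) z = inner x z + inner y z"
    by transfer (simp add: distrib_right suminf_add summable_mult_square)
  show "inner (r *\<^sub>R x) y = r * inner x y"
    by transfer (simp add: mult.assoc suminf_mult summable_mult_square)
  show "0 \<le> inner x x"
    by transfer (auto intro!: suminf_nonneg simp: power2_eq_square)
  show "inner x x = 0 \<longleftrightarrow> x = 0"
    by transfer (subst suminf_eq_zero_iff; simp add: power2_eq_square fun_eq_iff)
qed (fact norm_ell2_def sgn_ell2_def dist_ell2_def uniformity_ell2_def open_ell2_def)+

end

definition ell2n :: "nat \<Rightarrow> ell2 set" where
  "ell2n n = {x. \<forall>i\<ge>n. ell2_nth x i = 0}"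


section \<open>Banach--Mazur distance\<close>

definition onorm_on :: "'a::real_normed_vector set \<Rightarrow> ('a \<Rightarrow> 'b::real_normed_vector) \<Rightarrow> real" where
  "onorm_on Y T = (SUP y\<in>Y. norm (T y) / norm y)"

definition bounded_linear_on ::
    "'a::real_normed_vector set \<Rightarrow> ('a \<Rightarrow> 'b::real_normed_vector) \<Rightarrow> bool" where
  "bounded_linear_on Y T \<longleftrightarrow>
     (\<forall>x\<in>Y. \<forall>y\<in>Y. T (x + y) = T x + T y) \<and>
     (\<forall>c. \<forall>x\<in>Y. T (c *\<^sub>R x) = c *\<^sub>R T x) \<and>
     (\<exists>B. \<forall>x\<in>Y. norm (T x) \<le> norm x * B)"

definition isomorphism_on ::
    "'a::real_normed_vector set \<Rightarrow> 'b::real_normed_vector set \<Rightarrow> ('a \<Rightarrow> 'b) \<Rightarrow> bool" where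
  "isomorphism_on Y Z T \<longleftrightarrow>
     bij_betw T Y Z \<and> bounded_linear_on Y T \<and> bounded_linear_on Z (the_inv_into Y T)"

text \<open>Extended values: the infimum is \<open>\<infinity>\<close> if \<open>Y\<close> and \<open>Z\<close> are not isomorphic, and the supremum of
  the empty set is 0.\<close>

definition banach_mazur :: "'a::real_normed_vector set \<Rightarrow> 'b::real_normed_vector set \<Rightarrow> ennreal"
  where "banach_mazur Y Z =
     (INF T\<in>{T. isomorphism_on Y Z T}. ennreal (onorm_on Y T * onorm_on Z (the_inv_into Y T)))"

definition euclidean_constant :: "'a::real_normed_vector itself \<Rightarrow> nat \<Rightarrow> ennreal" where
  "euclidean_constant _ n = (SUP V\<in>(subspaces_of_dim n :: 'a set set). banach_mazur V (ell2n n))"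


section \<open>Lebesgue spaces\<close>

definition Lp_functions :: "ennreal \<Rightarrow> 'b measure \<Rightarrow> ('b \<Rightarrow> real) set" where
  "Lp_functions p M =
     (if p = \<infinity> then {f \<in> borel_measurable M. esssup M (\<lambda>t. ennreal \<bar>f t\<bar>) < \<infinity>}
      else {f \<in> borel_measurable M. integrable M (\<lambda>t. \<bar>f t\<bar> powr enn2real p)})"

definition Lp_norm :: "ennreal \<Rightarrow> 'b measure \<Rightarrow> ('b \<Rightarrow> real) \<Rightarrow> real" where
  "Lp_norm p M f =
     (if p = \<infinity> then enn2real (esssup M (\<lambda>t. ennreal \<bar>f t\<bar>))
      else (\<integral>t. \<bar>f t\<bar> powr enn2real p \<partial>M) powr (1 / enn2real p))"

text \<open>
  \<open>Lp\<close> consists of almost-everywhere classes and depends on the term \<open>M\<close>, so it is not a HOL type.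
  ``\<open>X = Lp(M)\<close>'' is expressed for a Banach space type \<open>'a\<close> by a map \<open>\<Phi>\<close> choosing for every vector
  a representing function, such that \<open>x \<mapsto> [\<Phi> x]\<close> is a linear isometry of \<open>'a\<close> onto \<open>Lp(M)\<close>.
\<close>

definition is_Lp_space ::
    "ennreal \<Rightarrow> 'b measure \<Rightarrow> ('a::real_normed_vector \<Rightarrow> 'b \<Rightarrow> real) \<Rightarrow> bool" where
  "is_Lp_space p M \<Phi> \<longleftrightarrow>
     (\<forall>x. \<Phi> x \<in> Lp_functions p M) \<and>
     (\<forall>x y. AE t in M. \<Phi> (x + y) t = \<Phi> x t + \<Phi> y t) \<and>
     (\<forall>c x. AE t in M. \<Phi> (c *\<^sub>R x) t = c * \<Phi> x t) \<and>
     (\<forall>x. norm x = Lp_norm p M (\<Phi> x)) \<and>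
     (\<forall>g\<in>Lp_functions p M. \<exists>x. AE t in M. \<Phi> x t = g t)"

end

(*
  For vectors g_0, ..., g_{n-1} of a Euclidean space, the product of the distances of g_i to
  the span of its predecessors is the square root of a Gram determinant, hence scales by the
  determinant under a linear map. If the g_i are approximable at rate k^(-s) by k-dimensional
  spaces, an orthonormal basis adapted to the approximating spaces of dyadic dimensions
  together with the weights j^(2s+1) bounds this determinant by (C n^(-2s))^n, without a
  logarithm. For the greedy algorithm all these distances are at least sigma_n up to the
  distortion of a Euclidean structure on a subspace of dimension at most 3n that contains f_0,
  ..., f_{n-1} and the approximating spaces; this costs the factor n^mu. Only two properties of
  the Euclidean structure matter: its norm is dominated by that of X, and it keeps f_i at
  distance sigma_n n^(-mu) from the span of its predecessors.

  For L_p such structures are constructed directly.  For p = infinity, Hahn-Banach functionals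
  vanishing on f_0, ..., f_{i-1} serve as coordinates, which works in every Banach space.  For
  2 <= p < infinity one takes L_2 with weight G^(p-2), G^p being the average of |x_i|^p for the
  normalized residuals x_i of best approximation.  For 1 <= p < 2 the weight is a Lewis change of
  density, obtained by iterating G -> (Christoffel function of L_2(G^(p-2))), a contraction of
  ratio 1 - p/2 for the logarithmic sup distance.
*)
theory Submission
  imports Defs "Jordan_Normal_Form.Determinant"
begin

no_notation Matrix.scalar_prod (infix "\<bullet>" 70)
hide_const (open) Matrix.orthogonal

section \<open>Gram determinants of approximable vectors\<close>

text \<open>Passing to a product of distances loses nothing: its \<open>n\<close> factors have a
  common lower bound, which an \<open>n\<close>-th root recovers with a constant independent of
  \<open>n\<close>. The weights multiply the squared product by \<open>(n!)^(2s+1)\<close>, while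
  each weighted vector has squared norm of order \<open>n\<close>. Since
  \<open>n! >= (n/e)^n\<close>, the root leaves \<open>n^(1 - (2s+1)) = n^(-2s)\<close> and the
  factor \<open>exp (2 * s + 1)\<close>. The logarithmic factor of the statement is at least 1 for
  \<open>n >= 1\<close>, so it is inserted at the very end.

  In \<open>L_p\<close> a Euclidean norm equivalent to the given one on the whole span is more than
  the determinant asks for. For \<open>p >= 2\<close> only domination on the span and separation of
  the greedy vectors are arranged, so Hahn-Banach functionals or best approximations take the place
  of extremal-position theorems such as those of John and Lewis. For \<open>p < 2\<close> both sides
  of the comparison are proved, but they tolerate constant factors: a weight within a factor 2 of
  its image is reached after finitely many iterations, and no limit of weights is taken.\<close>

lemma mult_mat_index:
  fixes X Y :: "real mat"
  assumes "X \<in> carrier_mat n n" "Y \<in> carrier_mat n n" "i < n" "j < n"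
  shows "(X * Y) $$ (i,j) = (\<Sum>l<n. X $$ (i,l) * Y $$ (l,j))"
  using assms by (auto simp: scalar_prod_def atLeast0LessThan)

lemma det_diagonal:
  fixes d :: "nat \<Rightarrow> real"
  shows "Determinant.det (mat n n (\<lambda>(i,j). if i = j then d i else 0)) = (\<Prod>i<n. d i)"
    (is "Determinant.det ?D = _")
proof -
  have "Determinant.det ?D = prod_list (diag_mat ?D)"
    by (rule det_lower_triangular[of n]) auto
  also have "diag_mat ?D = map d [0..<n]"
    unfolding diag_mat_def by (rule map_cong) auto
  also have "prod_list \<dots> = (\<Prod>i<n. d i)"
    using prod.distinct_set_conv_list[of "[0..<n]" d] by (simp add: atLeast0LessThan)
  finally show ?thesis .
qed

section \<open>Gram-Schmidt and the factorization of Gram matrices\<close>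

text \<open>Nothing is normalized, so the coefficients form a unitriangular matrix. A vector
  depending on its predecessors gives \<open>h i = 0\<close>; division by 0 yields 0, and the later
  coefficients at \<open>h i\<close> vanish.\<close>

lemma gram_schmidt_sequence:
  fixes g :: "nat \<Rightarrow> 'h::real_inner"
  obtains h :: "nat \<Rightarrow> 'h" and c :: "nat \<Rightarrow> nat \<Rightarrow> real"
  where "\<And>i. g i = h i + (\<Sum>j<i. c i j *\<^sub>R h j)"
    and "\<And>i j. i \<noteq> j \<Longrightarrow> h i \<bullet> h j = 0"
    and "\<And>i. h i \<in> span (g ` {..i})"
proof -
  \<comment> \<open>Course-of-values recursion: stage \<open>n\<close> carries a whole function and
    overwrites its entry \<open>n\<close>, so the final value \<open>k n\<close> is entry
    \<open>n\<close> of stage \<open>Suc n\<close>.\<close>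
  define h where "h = rec_nat (\<lambda>_. 0) (\<lambda>n r. r(n := g n - (\<Sum>j<n. ((g n \<bullet> r j) / (r j \<bullet> r j)) *\<^sub>R r j)))"
  define k where "k n = h (Suc n) n" for n
  have hS: "h (Suc n) = (h n)(n := g n - (\<Sum>j<n. ((g n \<bullet> h n j) / (h n j \<bullet> h n j)) *\<^sub>R h n j))" for n
    by (simp add: h_def)
  have hk: "j < n \<Longrightarrow> h n j = k j" for n j
  proof (induction n)
    case (Suc n)
    then show ?case
      by (cases "j = n") (simp_all add: k_def, simp add: hS k_def)
  qed simp
  have k: "k n = g n - (\<Sum>j<n. ((g n \<bullet> k j) / (k j \<bullet> k j)) *\<^sub>R k j)" for n
  proof -
    have "k n = g n - (\<Sum>j<n. ((g n \<bullet> h n j) / (h n j \<bullet> h n j)) *\<^sub>R h n j)"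
      unfolding k_def hS by simp
    also have "(\<Sum>j<n. ((g n \<bullet> h n j) / (h n j \<bullet> h n j)) *\<^sub>R h n j) = (\<Sum>j<n. ((g n \<bullet> k j) / (k j \<bullet> k j)) *\<^sub>R k j)"
      by (rule sum.cong) (auto simp: hk)
    finally show ?thesis .
  qed
  have orth: "i < n \<Longrightarrow> k n \<bullet> k i = 0" for n i
  proof (induction n arbitrary: i rule: less_induct)
    case (less n)
    have *: "k j \<bullet> k i = 0" if "j < n" "j \<noteq> i" for j
      using less.IH[of j i] less.IH[of i j] that less.prems by (cases "i < j") (auto simp: inner_commute)
    have "k n \<bullet> k i = g n \<bullet> k i - (\<Sum>j<n. (g n \<bullet> k j) / (k j \<bullet> k j) * (k j \<bullet> k i))"
      by (subst k) (simp add: inner_diff_left inner_sum_left)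
    also have "(\<Sum>j<n. (g n \<bullet> k j) / (k j \<bullet> k j) * (k j \<bullet> k i)) = (\<Sum>j<n. if j = i then g n \<bullet> k i else 0)"
      by (rule sum.cong) (auto simp: *)
    also have "\<dots> = g n \<bullet> k i"
      using less.prems by simp
    finally show ?case by simp
  qed
  have span: "k i \<in> span (g ` {..i})" for i
  proof (induction i rule: less_induct)
    case (less i)
    have "k j \<in> span (g ` {..i})" if "j < i" for j
      using less.IH[OF that] span_mono[of "g ` {..j}" "g ` {..i}"] that by force
    moreover have "g i \<in> span (g ` {..i})"
      by (intro span_base) auto
    ultimately show ?case
      by (subst k) (intro span_diff span_sum span_scale, auto)
  qed
  show thesis
  proof (rule that[of k "\<lambda>n j. (g n \<bullet> k j) / (k j \<bullet> k j)"])
    show "k i \<bullet> k j = 0" if "i \<noteq> j" for i j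
      using orth[of i j] orth[of j i] that by (cases "i < j") (auto simp: inner_commute)
  qed (subst k, simp, rule span)
qed

text \<open>The Gram matrix is \<open>L D L^T\<close> with \<open>L\<close> unitriangular and
  \<open>D\<close> diagonal. The two side conditions serve opposite purposes: the norm bound
  estimates the determinant from above, and membership in the span of the predecessors estimates it
  from below through separation.\<close>

lemma gram_det:
  fixes g :: "nat \<Rightarrow> 'h::real_inner"
  obtains h where "\<And>i. norm (h i) \<le> norm (g i)" and "\<And>i. g i - h i \<in> span (g ` {..<i})"
    and "\<And>n. Determinant.det (mat n n (\<lambda>(i,j). g i \<bullet> g j)) = (\<Prod>i<n. (norm (h i))\<^sup>2)"
proof -
  obtain h c where h: "\<And>i. g i = h i + (\<Sum>j<i. c i j *\<^sub>R h j)"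
    and orth: "\<And>i j. i \<noteq> j \<Longrightarrow> h i \<bullet> h j = 0" and span: "\<And>i. h i \<in> span (g ` {..i})"
    using gram_schmidt_sequence[of g] by blast
  show thesis
  proof (rule that[of h])
    fix i
    have "h i \<bullet> (\<Sum>j<i. c i j *\<^sub>R h j) = 0"
      by (simp add: inner_sum_right orth)
    then have "(norm (g i))\<^sup>2 = (norm (h i))\<^sup>2 + (norm (\<Sum>j<i. c i j *\<^sub>R h j))\<^sup>2"
      by (subst h, subst norm_add_Pythagorean) (simp_all add: real_inner_class.orthogonal_def)
    then show "norm (h i) \<le> norm (g i)"
      by (simp add: power2_le_imp_le)
    have "h j \<in> span (g ` {..<i})" if "j < i" for j
      using span[of j] span_mono[of "g ` {..j}" "g ` {..<i}"] that by force
    moreover have "g i - h i = (\<Sum>j<i. c i j *\<^sub>R h j)"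
      using h[of i] by simp
    ultimately show "g i - h i \<in> span (g ` {..<i})"
      by (auto intro!: span_sum span_scale)
  next
    fix n
    define L where "L = mat n n (\<lambda>(i,j). if j < i then c i j else if i = j then 1 else 0)"
    define D where "D = mat n n (\<lambda>(i,j). if i = j then (norm (h i))\<^sup>2 else 0)"
    have L: "L \<in> carrier_mat n n" and D: "D \<in> carrier_mat n n"
      by (auto simp: L_def D_def)
    have gi: "g i = (\<Sum>j<n. L $$ (i,j) *\<^sub>R h j)" if "i < n" for i
    proof -
      have "(\<Sum>j<n. L $$ (i,j) *\<^sub>R h j) = (\<Sum>j\<in>{..<i} \<union> {i}. L $$ (i,j) *\<^sub>R h j)"
        using that by (intro sum.mono_neutral_right) (auto simp: L_def)
      also have "\<dots> = (\<Sum>j<i. c i j *\<^sub>R h j) + h i"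
        using that by (subst sum.union_disjoint) (auto simp: L_def)
      finally show ?thesis
        using h[of i] by simp
    qed
    have "mat n n (\<lambda>(i,j). g i \<bullet> g j) = L * D * transpose_mat L"
    proof (rule eq_matI)
      fix i j assume "i < dim_row (L * D * transpose_mat L)" "j < dim_col (L * D * transpose_mat L)"
      then have ij: "i < n" "j < n"
        by (auto simp: L_def)
      have LD: "(L * D) $$ (i,l) = L $$ (i,l) * (norm (h l))\<^sup>2" if "l < n" for l
      proof -
        have "(L * D) $$ (i,l) = (\<Sum>k<n. L $$ (i,k) * D $$ (k,l))"
          using ij that L D by (simp add: scalar_prod_def atLeast0LessThan)
        also have "\<dots> = (\<Sum>k<n. if k = l then L $$ (i,k) * (norm (h l))\<^sup>2 else 0)"
          using that by (intro sum.cong) (auto simp: D_def)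
        finally show ?thesis using that by simp
      qed
      have "(L * D * transpose_mat L) $$ (i,j) = (\<Sum>l<n. (L * D) $$ (i,l) * L $$ (j,l))"
        using mult_mat_index[of "L * D" n "transpose_mat L", OF _ _ ij] L D ij by simp
      also have "\<dots> = (\<Sum>l<n. L $$ (i,l) * (norm (h l))\<^sup>2 * L $$ (j,l))"
        by (intro sum.cong) (auto simp: LD)
      also have "\<dots> = g i \<bullet> g j"
      proof -
        have "g i \<bullet> g j = (\<Sum>l<n. \<Sum>m<n. L $$ (i,l) * (L $$ (j,m) * (h l \<bullet> h m)))"
          unfolding gi[OF ij(1)] gi[OF ij(2)]
          by (simp only: inner_sum_left) (simp add: inner_sum_right sum_distrib_left mult.left_commute)
        also have "\<dots> = (\<Sum>l<n. \<Sum>m<n. if m = l then L $$ (i,l) * (L $$ (j,l) * (h l \<bullet> h l)) else 0)"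
          by (intro sum.cong) (auto simp: orth)
        also have "\<dots> = (\<Sum>l<n. L $$ (i,l) * (norm (h l))\<^sup>2 * L $$ (j,l))"
          by (intro sum.cong) (auto simp: power2_norm_eq_inner mult_ac)
        finally show ?thesis by simp
      qed
      finally show "mat n n (\<lambda>(i,j). g i \<bullet> g j) $$ (i,j) = (L * D * transpose_mat L) $$ (i,j)"
        using ij by simp
    qed (auto simp: L_def)
    then have "Determinant.det (mat n n (\<lambda>(i,j). g i \<bullet> g j))
        = Determinant.det L * Determinant.det D * Determinant.det L"
      using L D by (simp add: Determinant.det_mult[of _ n] Determinant.det_transpose[of _ n])
    moreover have "Determinant.det L = 1"
    proof -
      have "Determinant.det L = prod_list (diag_mat L)"
        by (rule det_lower_triangular[OF _ L]) (auto simp: L_def)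
      also have "diag_mat L = map (\<lambda>_. 1) [0..<n]"
        unfolding diag_mat_def by (rule map_cong) (auto simp: L_def)
      also have "prod_list \<dots> = (1::real)"
        by (simp add: map_replicate_const)
      finally show ?thesis .
    qed
    moreover have "Determinant.det D = (\<Prod>i<n. (norm (h i))\<^sup>2)"
      unfolding D_def by (rule det_diagonal)
    ultimately show "Determinant.det (mat n n (\<lambda>(i,j). g i \<bullet> g j)) = (\<Prod>i<n. (norm (h i))\<^sup>2)"
      by simp
  qed
qed

section \<open>Orthonormal bases adapted to the approximating spaces\<close>

text \<open>If no such vector existed, \<open>x \<mapsto> (\<Sum>q\<in>Q. (x \<bullet> q) q)\<close> would be injective on
  \<open>span B\<close>, because \<open>(\<Sum>q\<in>Q. (x \<bullet> q) q) \<bullet> x = (\<Sum>q\<in>Q. (x \<bullet> q)\<^sup>2)\<close>.\<close>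

lemma exists_orthogonal_unit_vector:
  fixes B Q :: "'h::real_inner set"
  assumes "independent B" "finite B" "finite Q" "card Q < card B"
  obtains x where "x \<in> span B" "norm x = 1" "\<And>q. q \<in> Q \<Longrightarrow> x \<bullet> q = 0"
proof -
  define P where "P x = (\<Sum>q\<in>Q. (x \<bullet> q) *\<^sub>R q)" for x
  have lin: "linear P"
    unfolding P_def
    by (intro linearI)
      (simp_all add: inner_add_left scaleR_add_left sum.distrib scaleR_sum_right)
  have "\<exists>x\<in>span B. x \<noteq> 0 \<and> P x = 0"
  proof (rule ccontr)
    assume "\<not> ?thesis"
    then have inj: "inj_on P (span B)"
      using lin by (subst linear_injective_on_subspace_0) auto
    then have "independent (P ` B)"
      by (rule linear_independent_injective_image[OF lin assms(1)])
    moreover have "P ` B \<subseteq> span Q"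
      unfolding P_def by (auto intro!: span_sum span_scale intro: span_base)
    ultimately have "card (P ` B) \<le> card Q"
      using independent_span_bound[OF assms(3)] by blast
    moreover have "card (P ` B) = card B"
      using inj span_superset by (intro card_image) (auto intro: inj_on_subset)
    ultimately show False using assms(4) by simp
  qed
  then obtain x where x: "x \<in> span B" "x \<noteq> 0" "P x = 0" by blast
  have "0 = P x \<bullet> x" using x by simp
  also have "\<dots> = (\<Sum>q\<in>Q. (x \<bullet> q)\<^sup>2)"
    by (simp add: P_def inner_sum_left power2_eq_square) (simp add: inner_commute)
  finally have "\<forall>q\<in>Q. x \<bullet> q = 0"
    using assms(3) by (simp add: sum_nonneg_eq_0_iff)
  then show thesis
    using x by (intro that[of "x /\<^sub>R norm x"]) (auto intro: span_scale)
qed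

text \<open>The vectors are chosen downwards from \<open>j = n - 1\<close>. At index
  \<open>i\<close> there are at most \<open>i\<close> constraints from \<open>Q i\<close> and
  \<open>n - 1 - i\<close> from the vectors already chosen, together fewer than \<open>n\<close>.
  Going upwards, the constraints could number \<open>2 * i\<close>.\<close>

lemma exists_adapted_orthonormal:
  fixes B :: "'h::real_inner set" and Q :: "nat \<Rightarrow> 'h set"
  assumes "independent B" "finite B" "card B = n"
    and "\<And>j. j < n \<Longrightarrow> finite (Q j) \<and> card (Q j) \<le> j"
  obtains e where "\<And>j. j < n \<Longrightarrow> e j \<in> span B" "\<And>j. j < n \<Longrightarrow> norm (e j) = 1"
    "\<And>i j. i < n \<Longrightarrow> j < n \<Longrightarrow> i \<noteq> j \<Longrightarrow> e i \<bullet> e j = 0"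
    "\<And>j q. j < n \<Longrightarrow> q \<in> Q j \<Longrightarrow> e j \<bullet> q = 0"
proof -
  have "\<exists>e. \<forall>j<n. n - m \<le> j \<longrightarrow> e j \<in> span B \<and> norm (e j) = 1 \<and>
      (\<forall>l<n. j < l \<longrightarrow> e j \<bullet> e l = 0) \<and> (\<forall>q\<in>Q j. e j \<bullet> q = 0)" if "m \<le> n" for m
    using that
  proof (induction m)
    case (Suc m)
    then obtain e where e: "\<And>j. j < n \<Longrightarrow> n - m \<le> j \<Longrightarrow> e j \<in> span B \<and> norm (e j) = 1 \<and>
      (\<forall>l<n. j < l \<longrightarrow> e j \<bullet> e l = 0) \<and> (\<forall>q\<in>Q j. e j \<bullet> q = 0)"
      by (metis Suc_leD)
    define i where "i = n - Suc m"
    have i: "i < n" "Suc i = n - m" using Suc.prems by (auto simp: i_def)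
    have "card (Q i \<union> e ` {i<..<n}) \<le> card (Q i) + card (e ` {i<..<n})"
      by (rule card_Un_le)
    also have "\<dots> \<le> i + (n - Suc i)"
      using assms(4)[OF i(1)] card_image_le[of "{i<..<n}" e] by (intro add_mono) auto
    also have "\<dots> < card B" using i assms(3) by simp
    finally obtain x where x: "x \<in> span B" "norm x = 1" "\<And>q. q \<in> Q i \<union> e ` {i<..<n} \<Longrightarrow> x \<bullet> q = 0"
      using exists_orthogonal_unit_vector[OF assms(1,2), of "Q i \<union> e ` {i<..<n}"] assms(4)[OF i(1)]
      by auto
    show ?case
    proof (intro exI[of _ "e(i := x)"] allI impI)
      fix j assume j: "j < n" "n - Suc m \<le> j"
      show "(e(i := x)) j \<in> span B \<and> norm ((e(i := x)) j) = 1 \<and>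
        (\<forall>l<n. j < l \<longrightarrow> (e(i := x)) j \<bullet> (e(i := x)) l = 0) \<and> (\<forall>q\<in>Q j. (e(i := x)) j \<bullet> q = 0)"
      proof (cases "j = i")
        case True then show ?thesis using x by auto
      next
        case False
        then have "n - m \<le> j" "i < j" using j i by (auto simp: i_def)
        then show ?thesis using e[OF j(1)] by auto
      qed
    qed
  qed simp
  from this[of n] obtain e where e: "\<And>j. j < n \<Longrightarrow> e j \<in> span B \<and> norm (e j) = 1 \<and>
      (\<forall>l<n. j < l \<longrightarrow> e j \<bullet> e l = 0) \<and> (\<forall>q\<in>Q j. e j \<bullet> q = 0)"
    by auto
  show thesis
  proof (rule that[of e])
    show "e i \<bullet> e j = 0" if "i < n" "j < n" "i \<noteq> j" for i j
      using e[OF that(1)] e[OF that(2)] that by (cases "i < j") (auto simp: inner_commute)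
  qed (use e in auto)
qed

text \<open>Otherwise the residual and the \<open>e j\<close> would be \<open>n + 1\<close>
  independent vectors in a span of dimension at most \<open>n\<close>.\<close>

lemma orthonormal_expansion:
  fixes B :: "'h::real_inner set"
  assumes "finite B" "card B \<le> n"
    and e: "\<And>j. j < n \<Longrightarrow> e j \<in> span B" "\<And>j. j < n \<Longrightarrow> norm (e j) = 1"
    "\<And>i j. i < n \<Longrightarrow> j < n \<Longrightarrow> i \<noteq> j \<Longrightarrow> e i \<bullet> e j = 0"
    and x: "x \<in> span B"
  shows "x = (\<Sum>j<n. (x \<bullet> e j) *\<^sub>R e j)"
proof (rule ccontr)
  define y where "y = x - (\<Sum>j<n. (x \<bullet> e j) *\<^sub>R e j)"
  assume "x \<noteq> (\<Sum>j<n. (x \<bullet> e j) *\<^sub>R e j)"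
  then have y0: "y \<noteq> 0" by (simp add: y_def)
  have ee: "e i \<bullet> e j = (if i = j then 1 else 0)" if "i < n" "j < n" for i j
    using e(2)[OF that(1)] e(3)[OF that] by (cases "i = j") (auto simp: norm_eq_1)
  have yorth: "y \<bullet> e i = 0" if "i < n" for i
  proof -
    have "y \<bullet> e i = x \<bullet> e i - (\<Sum>j<n. (x \<bullet> e j) * (e j \<bullet> e i))"
      by (simp add: y_def inner_diff_left inner_sum_left)
    also have "(\<Sum>j<n. (x \<bullet> e j) * (e j \<bullet> e i)) = (\<Sum>j<n. if j = i then x \<bullet> e i else 0)"
      using that by (intro sum.cong) (auto simp: ee)
    finally show ?thesis using that by simp
  qed
  let ?S = "insert y (e ` {..<n})"
  have inj: "inj_on e {..<n}"
    by (rule inj_onI) (metis ee lessThan_iff zero_neq_one)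
  have ynot: "y \<notin> e ` {..<n}"
    using yorth y0 by (metis imageE inner_eq_zero_iff lessThan_iff)
  have "independent ?S"
  proof (rule pairwise_orthogonal_independent)
    show "pairwise orthogonal ?S"
      unfolding pairwise_def real_inner_class.orthogonal_def using yorth e(3) by (auto simp: inner_commute)
    show "0 \<notin> ?S" using y0 e(2) by force
  qed
  moreover have "?S \<subseteq> span B"
    using x e(1) by (auto simp: y_def intro!: span_diff span_sum span_scale)
  ultimately have "card ?S \<le> card B"
    using independent_span_bound[OF assms(1)] by blast
  moreover have "card ?S = Suc n"
    using ynot inj by (simp add: card_image)
  ultimately show False using assms(2) by simp
qed

text \<open>\<open>n^n / n!\<close> is a single term of the exponential series at
  \<open>n\<close>.\<close>

lemma fact_ge_power_div_exp: "(real n / exp 1) ^ n \<le> fact n"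
proof -
  have "real n ^ n / fact n \<le> exp (real n)"
    using exp_ge_add_one_self[of "real n"]
      sums_unique[OF exp_converges[of "real n"]]
      sum_le_suminf[OF summable_exp_generic[of "real n"], of "{n}"]
    by (simp add: exp_def field_simps)
  then show ?thesis
    by (simp add: power_divide field_simps exp_of_nat_mult[symmetric])
qed

text \<open>Used twice: it sums the contributions of the dyadic blocks, and it counts the vectors
  spanning all approximating spaces of dyadic dimension below \<open>n\<close>.\<close>

lemma sum_powers_of_two_less:
  fixes n :: nat
  assumes "n \<ge> 1"
  shows "(\<Sum>k | 2 ^ k < n. 2 ^ k) < 2 * n" and "finite {k. 2 ^ k < n}"
proof -
  have fin: "{k. 2 ^ k < n} \<subseteq> {..<n}"
    using less_trans[OF less_exp] by auto
  then show f: "finite {k. 2 ^ k < n}"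
    using finite_subset by blast
  show "(\<Sum>k | 2 ^ k < n. 2 ^ k) < 2 * n"
  proof (cases "{k. 2 ^ k < n} = {}")
    case False
    define m where "m = Max {k. 2 ^ k < n}"
    have m: "2 ^ m < n" using Max_in[OF f False] by (simp add: m_def)
    have "(\<Sum>k | 2 ^ k < n. 2 ^ k) \<le> (\<Sum>k<Suc m. (2::nat) ^ k)"
      by (rule sum_mono2) (use Max_ge[OF f] in \<open>auto simp: m_def less_Suc_eq_le\<close>)
    also have "\<dots> < 2 ^ Suc m"
      by (induction m) (simp_all add: algebra_simps)
    also have "\<dots> \<le> 2 * n" using m by simp
    finally show ?thesis .
  qed (use assms in \<open>simp only: sum.empty\<close>)
qed

text \<open>The vectors \<open>e 0, \<dots>, e (n - 1)\<close> are orthonormal in the span of the \<open>g i\<close> and \<open>e j\<close> is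
  orthogonal to \<open>Q k\<close> for \<open>2\<^sup>k \<le> j < 2\<^sup>k\<^sup>+\<^sup>1\<close>.  Weighting the \<open>j\<close>-th coordinate by
  \<open>(j + 1)\<^sup>s\<^sup>+\<^sup>1\<^sup>/\<^sup>2\<close> leaves vectors of norm \<open>O(a \<surd>n)\<close> and multiplies the Gram determinant by
  \<open>(n!)\<^sup>2\<^sup>s\<^sup>+\<^sup>1\<close>; the weight is stronger than \<open>(j + 1)\<^sup>s\<close> in order that the sum over the dyadic
  blocks is geometric, which avoids a logarithm.\<close>

lemma gram_det_approximable_le:
  fixes g :: "nat \<Rightarrow> 'h::real_inner" and s a \<rho> :: real
  assumes n: "n \<ge> 1" and s: "s \<ge> 0" and a: "a \<ge> 0" and \<rho>: "\<rho> > 0"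
    and bound: "\<And>i. i < n \<Longrightarrow> norm (g i) \<le> a"
    and Q: "\<And>k. 2 ^ k < n \<Longrightarrow> finite (Q k) \<and> card (Q k) \<le> 2 ^ k"
    and approx: "\<And>k i. 2 ^ k < n \<Longrightarrow> i < n \<Longrightarrow>
      \<exists>u\<in>span (Q k). norm (g i - u) \<le> a * (2 ^ k) powr (- s)"
    and sep: "\<And>i v. i < n \<Longrightarrow> v \<in> span (g ` {..<i}) \<Longrightarrow> \<rho> \<le> norm (g i - v)"
  shows "\<rho>\<^sup>2 \<le> a\<^sup>2 * ((1 + 4 * 4 powr s) * exp (2 * s + 1)) * real n powr (- (2 * s))"
proof -
  have inj: "inj_on g {..<n} \<and> independent (g ` {..<n})"
  proof -
    have "inj_on g {..<m} \<and> independent (g ` {..<m})" if "m \<le> n" for m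
      using that
    proof (induction m)
      case (Suc m)
      have "g m \<notin> span (g ` {..<m})"
        using sep[of m "g m"] Suc.prems \<rho> by auto
      then show ?case
        using Suc span_base[of "g m" "g ` {..<m}"]
        by (auto simp: lessThan_Suc independent_insert)
    qed (simp add: independent_empty)
    then show ?thesis by simp
  qed
  define B where "B = g ` {..<n}"
  have B: "independent B" "finite B" "card B = n"
    using inj by (auto simp: B_def card_image)
  \<comment> \<open>For \<open>j >= 1\<close> this is the integer part of the binary logarithm, the
    index of the dyadic block containing \<open>j\<close>.\<close>
  define L where "L j = (GREATEST k. 2 ^ k \<le> j)" for j :: nat
  have L: "2 ^ L j \<le> j" "j < 2 ^ Suc (L j)" if "j \<ge> 1" for j
  proof -
    have ex: "2 ^ 0 \<le> j" using that by simp
    have bd: "k \<le> j" if "2 ^ k \<le> j" for k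
      using that less_exp[of k] by linarith
    show "2 ^ L j \<le> j"
      unfolding L_def using ex bd by (rule GreatestI_nat)
    show "j < 2 ^ Suc (L j)"
    proof (rule ccontr)
      assume "\<not> ?thesis"
      then have "Suc (L j) \<le> (GREATEST k. 2 ^ k \<le> j)"
        by (intro Greatest_le_nat[of "\<lambda>k. 2 ^ k \<le> j" "Suc (L j)" j]) (use bd in auto)
      then show False by (simp add: L_def)
    qed
  qed
  \<comment> \<open>Index 0 lies in no dyadic block, and at index \<open>j\<close> at most
    \<open>j\<close> constraints are admissible, hence none at 0.\<close>
  define Q' where "Q' j = (if j = 0 then {} else Q (L j))" for j
  have Q': "finite (Q' j) \<and> card (Q' j) \<le> j" if "j < n" for j
    using Q[of "L j"] L[of j] that by (cases "j = 0") (auto simp: Q'_def)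
  obtain e where e: "\<And>j. j < n \<Longrightarrow> e j \<in> span B" "\<And>j. j < n \<Longrightarrow> norm (e j) = 1"
    "\<And>i j. i < n \<Longrightarrow> j < n \<Longrightarrow> i \<noteq> j \<Longrightarrow> e i \<bullet> e j = 0"
    "\<And>j q. j < n \<Longrightarrow> q \<in> Q' j \<Longrightarrow> e j \<bullet> q = 0"
    by (rule exists_adapted_orthonormal[OF B, of Q']) (use Q' in auto)
  have ee: "e i \<bullet> e j = (if i = j then 1 else 0)" if "i < n" "j < n" for i j
    using e(2)[OF that(1)] e(3)[OF that] by (cases "i = j") (auto simp: norm_eq_1)
  have inner_sums: "(\<Sum>j<n. x j *\<^sub>R e j) \<bullet> (\<Sum>j<n. y j *\<^sub>R e j) = (\<Sum>j<n. x j * y j)" for x y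
  proof -
    have "(\<Sum>j<n. x j *\<^sub>R e j) \<bullet> (\<Sum>j<n. y j *\<^sub>R e j) = (\<Sum>i<n. \<Sum>j<n. x i * (y j * (e i \<bullet> e j)))"
      by (simp only: inner_sum_left) (simp add: inner_sum_right sum_distrib_left mult.left_commute)
    also have "\<dots> = (\<Sum>i<n. \<Sum>j<n. if j = i then x i * y i else 0)"
      by (intro sum.cong) (auto simp: ee)
    finally show ?thesis by simp
  qed
  have bessel: "(\<Sum>j\<in>J. (x \<bullet> e j)\<^sup>2) \<le> (norm x)\<^sup>2" if J: "J \<subseteq> {..<n}" for x J
  proof -
    define y where "y = (\<Sum>j<n. (if j \<in> J then x \<bullet> e j else 0) *\<^sub>R e j)"
    have s1: "(\<Sum>j<n. if j \<in> J then (x \<bullet> e j)\<^sup>2 else 0) = (\<Sum>j\<in>J. (x \<bullet> e j)\<^sup>2)"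
      using J by (simp add: sum.If_cases Int_absorb1)
    have yy: "y \<bullet> y = (\<Sum>j\<in>J. (x \<bullet> e j)\<^sup>2)"
      unfolding y_def inner_sums s1[symmetric] by (intro sum.cong) (auto simp: power2_eq_square)
    have xy: "x \<bullet> y = (\<Sum>j\<in>J. (x \<bullet> e j)\<^sup>2)"
      unfolding y_def inner_sum_right s1[symmetric] by (intro sum.cong) (auto simp: power2_eq_square)
    have "0 \<le> (x - y) \<bullet> (x - y)" by simp
    also have "\<dots> = (norm x)\<^sup>2 - (\<Sum>j\<in>J. (x \<bullet> e j)\<^sup>2)"
      using yy xy by (simp add: inner_diff_left inner_diff_right inner_commute power2_norm_eq_inner)
    finally show ?thesis by simp
  qed
  have expand: "g i = (\<Sum>j<n. (g i \<bullet> e j) *\<^sub>R e j)" if "i < n" for i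
    by (rule orthonormal_expansion[OF B(2) _ e(1-3)]) (use B(3) that in \<open>auto simp: B_def intro: span_base\<close>)
  define w where "w j = real (Suc j) powr (2 * s + 1)" for j
  have w: "w j > 0" for j by (simp add: w_def)
  define g' where "g' i = (\<Sum>j<n. (sqrt (w j) * (g i \<bullet> e j)) *\<^sub>R e j)" for i

  \<comment> \<open>\<open>M\<close> holds the coordinates of the \<open>g i\<close> in the basis
    \<open>e\<close>. Passing to \<open>g'\<close> multiplies \<open>M\<close> by \<open>D\<close>
    from the right, hence the Gram determinant by \<open>det D\<close> squared.\<close>
  define M where "M = mat n n (\<lambda>(i,j). g i \<bullet> e j)"
  define D where "D = mat n n (\<lambda>(i,j). if i = j then sqrt (w i) else 0)"
  have M: "M \<in> carrier_mat n n" and D: "D \<in> carrier_mat n n" by (auto simp: M_def D_def)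
  have MD: "(M * D) $$ (i,j) = sqrt (w j) * (g i \<bullet> e j)" if "i < n" "j < n" for i j
  proof -
    have "(M * D) $$ (i,j) = (\<Sum>k<n. M $$ (i,k) * D $$ (k,j))"
      using that M D by (simp add: scalar_prod_def atLeast0LessThan)
    also have "\<dots> = (\<Sum>k<n. if k = j then sqrt (w j) * (g i \<bullet> e j) else 0)"
      using that by (intro sum.cong) (auto simp: D_def M_def)
    finally show ?thesis using that by simp
  qed
  have G: "mat n n (\<lambda>(i,j). g i \<bullet> g j) = M * transpose_mat M"
  proof (rule eq_matI)
    fix i j assume "i < dim_row (M * transpose_mat M)" "j < dim_col (M * transpose_mat M)"
    then have ij: "i < n" "j < n" by (auto simp: M_def)
    have "g i \<bullet> g j = (\<Sum>l<n. (g i \<bullet> e l) * (g j \<bullet> e l))"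
      using inner_sums[of "\<lambda>l. g i \<bullet> e l" "\<lambda>l. g j \<bullet> e l"] expand[OF ij(1)] expand[OF ij(2)] by simp
    then show "mat n n (\<lambda>(i,j). g i \<bullet> g j) $$ (i,j) = (M * transpose_mat M) $$ (i,j)"
      using ij mult_mat_index[OF M transpose_carrier_mat[THEN iffD2, OF M] ij] by (simp add: M_def)
  qed (auto simp: M_def)
  have G': "mat n n (\<lambda>(i,j). g' i \<bullet> g' j) = (M * D) * transpose_mat (M * D)"
  proof (rule eq_matI)
    fix i j assume "i < dim_row ((M * D) * transpose_mat (M * D))" "j < dim_col ((M * D) * transpose_mat (M * D))"
    then have ij: "i < n" "j < n" by (auto simp: M_def D_def)
    have "((M * D) * transpose_mat (M * D)) $$ (i,j) = (\<Sum>l<n. (M * D) $$ (i,l) * (M * D) $$ (j,l))"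
      using mult_mat_index[of "M * D" n "transpose_mat (M * D)", OF _ _ ij] M D ij by simp
    also have "\<dots> = g' i \<bullet> g' j"
      unfolding g'_def inner_sums using ij by (intro sum.cong) (auto simp: MD)
    finally show "mat n n (\<lambda>(i,j). g' i \<bullet> g' j) $$ (i,j) = ((M * D) * transpose_mat (M * D)) $$ (i,j)"
      using ij by simp
  qed (auto simp: M_def D_def)
  have detD: "Determinant.det D = (\<Prod>i<n. sqrt (w i))"
    unfolding D_def by (rule det_diagonal)
  have dets: "Determinant.det (mat n n (\<lambda>(i,j). g' i \<bullet> g' j))
      = (\<Prod>i<n. w i) * Determinant.det (mat n n (\<lambda>(i,j). g i \<bullet> g j))"
  proof -
    have "Determinant.det (mat n n (\<lambda>(i,j). g' i \<bullet> g' j)) = (Determinant.det D * Determinant.det D) * (Determinant.det M * Determinant.det M)"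
      unfolding G' using M D by (simp add: Determinant.det_mult[of _ n] Determinant.det_transpose[of _ n])
    moreover have "Determinant.det D * Determinant.det D = (\<Prod>i<n. w i)"
      unfolding detD prod.distrib[symmetric] using w by (intro prod.cong) (auto simp: less_imp_le)
    moreover have "Determinant.det M * Determinant.det M = Determinant.det (mat n n (\<lambda>(i,j). g i \<bullet> g j))"
      unfolding G using M by (simp add: Determinant.det_mult[of _ n] Determinant.det_transpose[of _ n])
    ultimately show ?thesis by simp
  qed
  obtain h where h: "\<And>i. norm (h i) \<le> norm (g i)" "\<And>i. g i - h i \<in> span (g ` {..<i})"
    "\<And>n. Determinant.det (mat n n (\<lambda>(i,j). g i \<bullet> g j)) = (\<Prod>i<n. (norm (h i))\<^sup>2)"
    using gram_det[of g] by blast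
  obtain h' where h': "\<And>i. norm (h' i) \<le> norm (g' i)" "\<And>i. g' i - h' i \<in> span (g' ` {..<i})"
    "\<And>n. Determinant.det (mat n n (\<lambda>(i,j). g' i \<bullet> g' j)) = (\<Prod>i<n. (norm (h' i))\<^sup>2)"
    using gram_det[of g'] by blast

  have norm_g': "(norm (g' i))\<^sup>2 \<le> a\<^sup>2 * real n * (1 + 4 * 4 powr s)" if i: "i < n" for i
  proof -
    define b where "b j = w j * (g i \<bullet> e j)\<^sup>2" for j
    have b0: "b j \<ge> 0" for j using w[of j] by (simp add: b_def)
    define J where "J k = {j. 2 ^ k \<le> j \<and> j < 2 ^ Suc k \<and> j < n}" for k :: nat
    have Jfin: "finite (J k)" for k unfolding J_def by (rule finite_subset[of _ "{..<n}"]) auto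
    have LJ: "L j = k" if "j \<in> J k" for j k
    proof -
      have j: "2 ^ k \<le> j" "j < 2 ^ Suc k"
        using that by (simp_all only: J_def mem_Collect_eq)
      have j1: "j \<ge> 1" using le_trans[OF one_le_power[of "2::nat" k] j(1)] by simp
      have "(2::nat) ^ k < 2 ^ Suc (L j)" "(2::nat) ^ L j < 2 ^ Suc k"
        using le_less_trans[OF j(1) L(2)[OF j1]] le_less_trans[OF L(1)[OF j1] j(2)] .
      then have "k < Suc (L j)" "L j < Suc k"
        using power_less_imp_less_exp[of "2::nat" k "Suc (L j)"] power_less_imp_less_exp[of "2::nat" "L j" "Suc k"]
        by (simp_all del: power_Suc)
      then show ?thesis by simp
    qed
    \<comment> \<open>On block \<open>k\<close> the \<open>e j\<close> are orthogonal to
      \<open>Q k\<close>, so the coordinates of \<open>g i\<close> are those of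
      \<open>g i - u\<close> and Bessel's inequality gives \<open>a^2 * 2^(-2ks)\<close>. The
      weights are at most \<open>(2 * 2^k)^(2s+1)\<close>; what remains grows like
      \<open>2^k\<close>, so the last block dominates the sum.\<close>
    have Jbound: "(\<Sum>j\<in>J k. b j) \<le> a\<^sup>2 * (2 * 4 powr s) * 2 ^ k" if k: "2 ^ k < n" for k
    proof -
      obtain u where u: "u \<in> span (Q k)" "norm (g i - u) \<le> a * (2 ^ k) powr (- s)"
        using approx[OF k i] by blast
      have ue: "u \<bullet> e j = 0" if j: "j \<in> J k" for j
      proof -
        have j1: "j \<noteq> 0" "j < n" using j one_le_power[of "2::nat" k] unfolding J_def by auto
        have "\<forall>q\<in>Q k. q \<bullet> e j = 0"
          using e(4)[OF j1(2)] LJ[OF j] j1 by (auto simp: Q'_def inner_commute)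
        with u(1) show ?thesis
          by (induction rule: span_induct_alt) (auto simp: inner_add_left)
      qed
      have "(\<Sum>j\<in>J k. b j) \<le> (\<Sum>j\<in>J k. (2 * 2 ^ k) powr (2 * s + 1) * (g i \<bullet> e j)\<^sup>2)"
      proof (rule sum_mono)
        fix j assume "j \<in> J k"
        then have "Suc j \<le> 2 * 2 ^ k" by (auto simp: J_def)
        then have "real (Suc j) \<le> 2 * 2 ^ k"
          using of_nat_mono[of "Suc j" "2 * 2 ^ k", where 'a=real] by simp
        then have "w j \<le> (2 * 2 ^ k) powr (2 * s + 1)"
          unfolding w_def using s by (intro powr_mono2) auto
        then show "b j \<le> (2 * 2 ^ k) powr (2 * s + 1) * (g i \<bullet> e j)\<^sup>2"
          unfolding b_def by (rule mult_right_mono) simp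
      qed
      also have "\<dots> = (2 * 2 ^ k) powr (2 * s + 1) * (\<Sum>j\<in>J k. ((g i - u) \<bullet> e j)\<^sup>2)"
        by (simp add: sum_distrib_left inner_diff_left ue)
      also have "\<dots> \<le> (2 * 2 ^ k) powr (2 * s + 1) * (a * (2 ^ k) powr (- s))\<^sup>2"
      proof (rule mult_left_mono)
        have "(\<Sum>j\<in>J k. ((g i - u) \<bullet> e j)\<^sup>2) \<le> (norm (g i - u))\<^sup>2"
          by (rule bessel) (auto simp: J_def)
        also have "\<dots> \<le> (a * (2 ^ k) powr (- s))\<^sup>2"
          using u(2) by (rule power_mono) simp
        finally show "(\<Sum>j\<in>J k. ((g i - u) \<bullet> e j)\<^sup>2) \<le> (a * (2 ^ k) powr (- s))\<^sup>2" .
      qed simp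
      also have "\<dots> = a\<^sup>2 * (2 powr (2 * s + 1) * (2 ^ k) powr (2 * s + 1 - 2 * s))"
      proof -
        have "((2 ^ k) powr (- s))\<^sup>2 = (2 ^ k) powr (- 2 * s)"
          by (simp add: power2_eq_square flip: powr_add)
        moreover have "(2 ^ k) powr (2 * s + 1) * (2 ^ k) powr (- 2 * s) = (2 ^ k :: real) powr (2 * s + 1 - 2 * s)"
          by (simp flip: powr_add)
        ultimately show ?thesis
          by (simp only: powr_mult power_mult_distrib mult_ac)
      qed
      also have "2 powr (2 * s + 1) = 2 * 4 powr s"
        by (simp add: powr_add powr_powr[symmetric])
      finally show ?thesis by (simp add: mult_ac)
    qed
    have sub: "{..<n} \<subseteq> {0} \<union> (\<Union>k\<in>{k. 2 ^ k < n}. J k)"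
    proof
      fix j assume "j \<in> {..<n}"
      then show "j \<in> {0} \<union> (\<Union>k\<in>{k. 2 ^ k < n}. J k)"
        using L[of j] by (cases "j = 0") (auto simp: J_def intro!: exI[of _ "L j"])
    qed
    have fin: "finite {k. 2 ^ k < n}" by (rule sum_powers_of_two_less(2)[OF n])
    have "(norm (g' i))\<^sup>2 = (\<Sum>j<n. b j)"
      unfolding power2_norm_eq_inner g'_def inner_sums b_def
      using w by (intro sum.cong) (auto simp: power2_eq_square less_imp_le)
    also have "\<dots> \<le> (\<Sum>j\<in>{0} \<union> (\<Union>k\<in>{k. 2 ^ k < n}. J k). b j)"
      by (rule sum_mono2) (use sub b0 fin Jfin in auto)
    also have "\<dots> \<le> b 0 + (\<Sum>j\<in>(\<Union>k\<in>{k. 2 ^ k < n}. J k). b j)"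
    proof -
      have "0 \<notin> (\<Union>k\<in>{k. 2 ^ k < n}. J k)" by (auto simp: J_def)
      then show ?thesis using fin Jfin by simp
    qed
    also have "(\<Sum>j\<in>(\<Union>k\<in>{k. 2 ^ k < n}. J k). b j) = (\<Sum>k | 2 ^ k < n. \<Sum>j\<in>J k. b j)"
    proof (intro sum.UNION_disjoint ballI impI)
      show "J k \<inter> J l = {}" if "k \<noteq> l" for k l
        using LJ that by (metis disjoint_iff)
    qed (use fin Jfin in auto)
    also have "b 0 \<le> a\<^sup>2"
    proof -
      have "b 0 = (\<Sum>j\<in>{0}. (g i \<bullet> e j)\<^sup>2)" by (simp add: b_def w_def)
      also have "\<dots> \<le> (norm (g i))\<^sup>2" using n by (intro bessel) auto
      also have "\<dots> \<le> a\<^sup>2" using bound[OF i] by (rule power_mono) simp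
      finally show ?thesis .
    qed
    also have "(\<Sum>k | 2 ^ k < n. \<Sum>j\<in>J k. b j) \<le> (\<Sum>k | 2 ^ k < n. a\<^sup>2 * (2 * 4 powr s) * 2 ^ k)"
      by (rule sum_mono) (use Jbound in auto)
    also have "\<dots> = a\<^sup>2 * (2 * 4 powr s) * real (\<Sum>k | 2 ^ k < n. 2 ^ k)"
      by (simp add: sum_distrib_left)
    also have "\<dots> \<le> a\<^sup>2 * (2 * 4 powr s) * real (2 * n)"
      using sum_powers_of_two_less(1)[OF n] by (intro mult_left_mono) (simp_all only: of_nat_le_iff, auto)
    \<comment> \<open>The 1 in the constant comes from index 0, the term \<open>4 * 4 powr s\<close>
      from all blocks together.\<close>
    also have "a\<^sup>2 + a\<^sup>2 * (2 * 4 powr s) * real (2 * n) \<le> a\<^sup>2 * real n * (1 + 4 * 4 powr s)"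
    proof -
      have "a\<^sup>2 * 1 \<le> a\<^sup>2 * real n" using n by (intro mult_left_mono) auto
      then show ?thesis by (simp add: algebra_simps)
    qed
    finally show ?thesis by simp
  qed

  \<comment> \<open>\<open>A\<close> bounds every squared norm of the weighted vectors, so
    \<open>(n!)^(2s+1) * \<rho>^(2n) <= A^n\<close>. After the bound on the factorial an
    \<open>n\<close>-th root can be taken, and the single factor \<open>n\<close> in
    \<open>A\<close> lowers the exponent from \<open>2s + 1\<close> to \<open>2s\<close>.\<close>
  define A where "A = a\<^sup>2 * real n * (1 + 4 * 4 powr s)"
  have A0: "A \<ge> 0" by (simp add: A_def)
  have "(fact n) powr (2 * s + 1) = (\<Prod>i<n. w i)"
  proof -
    have "(\<Prod>i<n. w i) = (\<Prod>i<n. real (Suc i)) powr (2 * s + 1)"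
      unfolding w_def by (subst prod_powr_distrib) auto
    also have "(\<Prod>i<n. real (Suc i)) = fact n"
      by (induction n) (auto simp: algebra_simps)
    finally show ?thesis by simp
  qed
  moreover have "\<rho>\<^sup>2 ^ n \<le> (\<Prod>i<n. (norm (h i))\<^sup>2)"
  proof -
    have "\<rho>\<^sup>2 \<le> (norm (h i))\<^sup>2" if "i < n" for i
      using sep[OF that h(2)] \<rho> by (intro power_mono) auto
    then have "(\<Prod>i<n. \<rho>\<^sup>2) \<le> (\<Prod>i<n. (norm (h i))\<^sup>2)"
      by (intro prod_mono) auto
    then show ?thesis by simp
  qed
  moreover have "(\<Prod>i<n. (norm (h' i))\<^sup>2) \<le> A ^ n"
  proof -
    have "(norm (h' i))\<^sup>2 \<le> A" if "i < n" for i
      unfolding A_def using order_trans[OF power_mono[OF h'(1)[of i], of 2] norm_g'[OF that]] by simp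
    then have "(\<Prod>i<n. (norm (h' i))\<^sup>2) \<le> (\<Prod>i<n. A)"
      by (intro prod_mono) auto
    then show ?thesis by simp
  qed
  moreover have "(\<Prod>i<n. (norm (h' i))\<^sup>2) = (\<Prod>i<n. w i) * (\<Prod>i<n. (norm (h i))\<^sup>2)"
    using dets unfolding h(3) h'(3) .
  moreover have "((real n / exp 1) powr (2 * s + 1)) ^ n \<le> (fact n) powr (2 * s + 1)"
  proof -
    have "((real n / exp 1) powr (2 * s + 1)) ^ n = ((real n / exp 1) ^ n) powr (2 * s + 1)"
      using n by (simp add: powr_power flip: powr_realpow) (simp add: powr_powr mult.commute)
    also have "\<dots> \<le> (fact n) powr (2 * s + 1)"
      using s fact_ge_power_div_exp[of n] by (intro powr_mono2) auto
    finally show ?thesis .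
  qed
  moreover have "((real n / exp 1) powr (2 * s + 1)) ^ n * \<rho>\<^sup>2 ^ n
      \<le> (fact n) powr (2 * s + 1) * (\<Prod>i<n. (norm (h i))\<^sup>2)"
    by (rule mult_mono[OF calculation(5,2)]) simp_all
  ultimately have "((real n / exp 1) powr (2 * s + 1)) ^ n * \<rho>\<^sup>2 ^ n \<le> A ^ n"
    by simp
  then have "((real n / exp 1) powr (2 * s + 1) * \<rho>\<^sup>2) ^ n \<le> A ^ n"
    by (simp only: power_mult_distrib)
  then have "(real n / exp 1) powr (2 * s + 1) * \<rho>\<^sup>2 \<le> A"
    using n A0 by (simp add: power_mono_iff)
  then have "\<rho>\<^sup>2 \<le> A / (real n / exp 1) powr (2 * s + 1)"
    using n by (subst pos_le_divide_eq) (auto simp: mult.commute)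
  also have "\<dots> = a\<^sup>2 * ((1 + 4 * 4 powr s) * exp (2 * s + 1)) * (real n / real n powr (2 * s + 1))"
    using n by (simp add: A_def powr_divide exp_powr_real field_simps)
  also have "real n / real n powr (2 * s + 1) = real n powr (- (2 * s))"
    using n by (simp add: powr_add powr_minus field_simps)
  finally show ?thesis .
qed

section \<open>Euclidean structures and the greedy algorithm\<close>

lift_definition ell2_of :: "nat \<Rightarrow> (nat \<Rightarrow> real) \<Rightarrow> ell2" is "\<lambda>n x i. if i < n then x i else 0"
  by (rule summable_finite[of "{..<n}" for n]) auto

lemma norm_ell2_of: "(norm (ell2_of n x))\<^sup>2 = (\<Sum>i<n. (x i)\<^sup>2)"
proof -
  have "(norm (ell2_of n x))\<^sup>2 = (\<Sum>i. (if i < n then x i else 0) * (if i < n then x i else 0))"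
    unfolding power2_norm_eq_inner by transfer simp
  also have "\<dots> = (\<Sum>i<n. (if i < n then x i else 0) * (if i < n then x i else 0))"
    by (rule suminf_finite) auto
  finally show ?thesis
    by (simp add: power2_eq_square)
qed

lemma ell2_of_add: "ell2_of n (\<lambda>i. x i + y i) = ell2_of n x + ell2_of n y"
  by transfer auto

lemma ell2_of_scaleR: "ell2_of n (\<lambda>i. c * x i) = c *\<^sub>R ell2_of n x"
  by transfer auto

text \<open>Maps built from a form or from an isomorphism are additive only on a subspace; a total
  extension makes the theory of \<open>linear\<close> maps applicable.\<close>

lemma linear_extension_from_subspace:
  fixes T :: "'a::real_vector \<Rightarrow> 'b::real_vector"
  assumes V: "subspace V"
    and add: "\<And>x y. x \<in> V \<Longrightarrow> y \<in> V \<Longrightarrow> T (x + y) = T x + T y"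
    and scale: "\<And>c x. x \<in> V \<Longrightarrow> T (c *\<^sub>R x) = c *\<^sub>R T x"
  obtains T' where "linear T'" "\<And>x. x \<in> V \<Longrightarrow> T' x = T x"
proof -
  obtain B where B: "B \<subseteq> V" "independent B" "V \<subseteq> span B"
    using basis_exists[of V] by metis
  obtain g where g: "linear g" "\<forall>x\<in>B. g x = T x"
    using linear_independent_extend[OF B(2), of T] by blast
  show thesis
  proof (rule that[OF g(1)])
    fix x assume "x \<in> V"
    then have "x \<in> span B" using B by blast
    then have "x \<in> V \<and> g x = T x"
    proof (induction rule: span_induct_alt)
      case base
      show ?case
        using V scale[of 0 0] g(1) by (simp add: subspace_0 linear_0)
    next
      case (step c x y)
      then show ?case
        using V B(1) g
        by (auto simp: linear_add linear_scale add scale subspace_scale intro!: subspace_add)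
    qed
    then show "g x = T x" ..
  qed
qed

text \<open>Gram--Schmidt for a positive semidefinite form: null vectors are replaced by \<open>0\<close>.\<close>

lemma exists_parseval_system:
  fixes B :: "'a::real_vector \<Rightarrow> 'a \<Rightarrow> real" and b :: "nat \<Rightarrow> 'a" and N :: nat
  defines "V \<equiv> span (b ` {..<N})"
  assumes sym: "\<And>x y. x \<in> V \<Longrightarrow> y \<in> V \<Longrightarrow> B x y = B y x"
    and add: "\<And>x y z. x \<in> V \<Longrightarrow> y \<in> V \<Longrightarrow> z \<in> V \<Longrightarrow> B (x + y) z = B x z + B y z"
    and scale: "\<And>c x z. x \<in> V \<Longrightarrow> z \<in> V \<Longrightarrow> B (c *\<^sub>R x) z = c * B x z"
    and nonneg: "\<And>x. x \<in> V \<Longrightarrow> B x x \<ge> 0"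
  obtains e where "\<And>j. j < N \<Longrightarrow> e j \<in> V"
    and "\<And>x y. x \<in> V \<Longrightarrow> y \<in> V \<Longrightarrow> B x y = (\<Sum>j<N. B x (e j) * B (e j) y)"
proof -
  have V: "subspace V" by (simp add: V_def)
  have B0: "B 0 z = 0" if "z \<in> V" for z
    using scale[OF that that, of 0] scale[of 0 z 0] that V by (auto simp: subspace_0)
  \<comment> \<open>The degenerate case of Cauchy-Schwarz: if \<open>B x x = 0\<close>, then
    \<open>B (t *\<^sub>R x + y) (t *\<^sub>R x + y)\<close> is affine in \<open>t\<close>, and
    being nonnegative it has slope 0.\<close>
  have null: "B x y = 0" if xy: "x \<in> V" "y \<in> V" and "B x x = 0" for x y
  proof (rule ccontr)
    assume ne: "B x y \<noteq> 0"
    have "B (t *\<^sub>R x + y) (t *\<^sub>R x + y) = 2 * t * B x y + B y y" for t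
    proof -
      have m: "t *\<^sub>R x \<in> V" "t *\<^sub>R x + y \<in> V"
        using xy V by (auto intro: subspace_add subspace_scale)
      have "B (t *\<^sub>R x + y) (t *\<^sub>R x + y) = t * B x (t *\<^sub>R x + y) + B y (t *\<^sub>R x + y)"
        using m xy by (simp add: add scale)
      also have "B x (t *\<^sub>R x + y) = t * B x x + B y x"
        using m xy by (subst sym) (auto simp: add scale)
      also have "B y (t *\<^sub>R x + y) = t * B x y + B y y"
        using m xy by (subst sym) (auto simp: add scale)
      finally show ?thesis
        using that(3) sym[OF xy] by (simp add: algebra_simps)
    qed
    moreover have "B (t *\<^sub>R x + y) (t *\<^sub>R x + y) \<ge> 0" for t
      using xy V by (intro nonneg subspace_add subspace_scale)
    ultimately have "0 \<le> 2 * t * B x y + B y y" for t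
      by simp
    then have "0 \<le> 2 * (- (B y y + 1) / (2 * B x y)) * B x y + B y y" .
    also have "\<dots> = -1"
      using ne by (simp add: field_simps)
    finally show False by simp
  qed
  have sumV: "(\<Sum>j\<in>J. c j *\<^sub>R e j) \<in> V \<and> B (\<Sum>j\<in>J. c j *\<^sub>R e j) z = (\<Sum>j\<in>J. c j * B (e j) z)"
    if "finite J" "\<And>j. j \<in> J \<Longrightarrow> e j \<in> V" "z \<in> V" for J :: "nat set" and c e z
    using that(1,2)
  proof (induction J rule: finite_induct)
    case empty
    then show ?case using B0[OF that(3)] V by (simp add: subspace_0)
  next
    case (insert j J)
    then have "c j *\<^sub>R e j \<in> V" "(\<Sum>j\<in>J. c j *\<^sub>R e j) \<in> V"
      using V by (auto intro: subspace_scale)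
    then show ?case
      using insert that(3) V by (simp add: add scale subspace_add)
  qed
  \<comment> \<open>Only \<open>x\<close> is confined to the span of the first \<open>m\<close>
    vectors. Letting \<open>y\<close> range over all of \<open>V\<close> allows
    \<open>y = b m\<close> in the induction step, which shows that the residual \<open>d\<close> is
    orthogonal to that span.\<close>
  have "\<exists>e. (\<forall>j<m. e j \<in> span (b ` {..<m})) \<and>
      (\<forall>x\<in>span (b ` {..<m}). \<forall>y\<in>V. B x y = (\<Sum>j<m. B x (e j) * B (e j) y))" if "m \<le> N" for m
    using that
  proof (induction m)
    case 0
    then show ?case using B0 by auto
  next
    case (Suc m)
    define U where "U = span (b ` {..<m})"
    have U: "subspace U" by (simp add: U_def)
    from Suc obtain e where e: "\<And>j. j < m \<Longrightarrow> e j \<in> U"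
      "\<And>x y. x \<in> U \<Longrightarrow> y \<in> V \<Longrightarrow> B x y = (\<Sum>j<m. B x (e j) * B (e j) y)"
      unfolding U_def by auto
    have UV: "x \<in> V" if "x \<in> U" for x
    proof -
      have "b ` {..<m} \<subseteq> b ` {..<N}" using Suc.prems by auto
      then show ?thesis using that span_mono unfolding U_def V_def by blast
    qed
    have U': "x \<in> span (b ` {..<Suc m})" if "x \<in> U" for x
    proof -
      have "b ` {..<m} \<subseteq> b ` {..<Suc m}" by auto
      then show ?thesis using that span_mono unfolding U_def by blast
    qed
    have bV: "b m \<in> V" using Suc.prems by (auto simp: V_def intro: span_base)
    define p where "p = (\<Sum>j<m. B (b m) (e j) *\<^sub>R e j)"
    define d where "d = b m - p"
    have pU: "p \<in> U" unfolding p_def using U e(1) by (auto intro!: subspace_sum subspace_scale)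
    have dV: "d \<in> V" unfolding d_def using bV UV[OF pU] V by (rule_tac subspace_diff)
    have Bp: "B p y = (\<Sum>j<m. B (b m) (e j) * B (e j) y)" if "y \<in> V" for y
      unfolding p_def using sumV[of "{..<m}" e y] that e(1) UV by simp
    have Bb: "B (b m) y = B d y + B p y" if "y \<in> V" for y
      using add[OF dV UV[OF pU] that] by (simp add: d_def)
    have dU: "B d y = 0" if y: "y \<in> U" for y
    proof -
      have "B (b m) y = B y (b m)" using sym bV UV[OF y] by blast
      also have "\<dots> = (\<Sum>j<m. B y (e j) * B (e j) (b m))" using e(2)[OF y bV] .
      also have "\<dots> = (\<Sum>j<m. B (b m) (e j) * B (e j) y)"
        using sym bV UV[OF y] UV[OF e(1)] by (intro sum.cong) (auto simp: mult.commute)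
      also have "\<dots> = B p y" using Bp[OF UV[OF y]] by simp
      finally show ?thesis using Bb[OF UV[OF y]] by simp
    qed
    define q where "q = (if B d d > 0 then (1 / sqrt (B d d)) *\<^sub>R d else 0)"
    have qV: "q \<in> V" unfolding q_def using dV V by (auto intro: subspace_scale subspace_0)
    have q: "B d q * B q y = B d y" "z \<in> U \<Longrightarrow> B z q = 0" if y: "y \<in> V" for y z
    proof -
      have qy: "B q y = (if B d d > 0 then B d y / sqrt (B d d) else 0)" if "y \<in> V" for y
        unfolding q_def using scale[OF dV that] B0[OF that] by simp
      show "B d q * B q y = B d y"
      proof (cases "B d d > 0")
        case True
        have "B d q = B d d / sqrt (B d d)"
          using sym[OF dV qV] qy[OF dV] True by simp
        then show ?thesis using qy[OF y] True by simp
      next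
        case False
        then have "B d d = 0" using nonneg[OF dV] by simp
        then show ?thesis using null[OF dV y] qy[OF y] False by simp
      qed
      show "B z q = 0" if "z \<in> U"
        using sym[OF UV[OF that] qV] qy[OF UV[OF that]] dU[OF that] by simp
    qed
    show ?case
    proof (intro exI[of _ "e(m := q)"] conjI allI impI ballI)
      fix j assume "j < Suc m"
      moreover have "q \<in> span (b ` {..<Suc m})"
      proof -
        have "b m \<in> span (b ` {..<Suc m})" by (intro span_base) simp
        then show ?thesis
          unfolding q_def d_def using U'[OF pU] by (auto intro!: span_scale span_diff span_zero)
      qed
      ultimately show "(e(m := q)) j \<in> span (b ` {..<Suc m})"
        using U'[OF e(1)] by (auto simp: less_Suc_eq)
    next
      fix x y assume x: "x \<in> span (b ` {..<Suc m})" and y: "y \<in> V"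
      obtain k where "x - k *\<^sub>R b m \<in> U"
        using x by (auto simp: lessThan_Suc span_insert U_def)
      define z where "z = x - k *\<^sub>R b m + k *\<^sub>R p"
      have zU: "z \<in> U" unfolding z_def
        using \<open>x - k *\<^sub>R b m \<in> U\<close> pU U by (auto intro: subspace_add subspace_scale)
      have xz: "x = z + k *\<^sub>R d" by (simp add: z_def d_def algebra_simps)
      have kd: "k *\<^sub>R d \<in> V" using dV V by (rule_tac subspace_scale)
      have Bx: "B x w = B z w + k * B d w" if "w \<in> V" for w
        unfolding xz using add[OF UV[OF zU] kd that] scale[OF dV that] by simp
      have "(\<Sum>j<Suc m. B x ((e(m := q)) j) * B ((e(m := q)) j) y) = (\<Sum>j<m. B x (e j) * B (e j) y) + B x q * B q y"
        by simp
      also have "(\<Sum>j<m. B x (e j) * B (e j) y) = (\<Sum>j<m. B z (e j) * B (e j) y)"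
        using Bx[OF UV[OF e(1)]] dU[OF e(1)] by (intro sum.cong) auto
      also have "\<dots> = B z y" using e(2)[OF zU y] by simp
      also have "B x q * B q y = k * B d y"
        using Bx[OF qV] q(1)[OF y] q(2)[OF y zU] by simp
      also have "B z y + k * B d y = B x y" using Bx[OF y] by simp
      finally show "B x y = (\<Sum>j<Suc m. B x ((e(m := q)) j) * B ((e(m := q)) j) y)" by simp
    qed
  qed
  from this[of N] obtain e where e: "\<forall>j<N. e j \<in> V" "\<forall>x\<in>V. \<forall>y\<in>V. B x y = (\<Sum>j<N. B x (e j) * B (e j) y)"
    unfolding V_def by blast
  show thesis by (rule that[of e]) (use e in blast)+
qed

text \<open>With a Parseval system \<open>e\<close>, the coordinates \<open>B x (e j)\<close> have
  sum of squares \<open>B x x\<close>, also for a degenerate form.\<close>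

lemma exists_linear_map_of_form:
  fixes B :: "'a::real_vector \<Rightarrow> 'a \<Rightarrow> real" and S :: "'a set"
  assumes "finite S"
    and sym: "\<And>x y. x \<in> span S \<Longrightarrow> y \<in> span S \<Longrightarrow> B x y = B y x"
    and add: "\<And>x y z. x \<in> span S \<Longrightarrow> y \<in> span S \<Longrightarrow> z \<in> span S \<Longrightarrow> B (x + y) z = B x z + B y z"
    and scale: "\<And>c x z. x \<in> span S \<Longrightarrow> z \<in> span S \<Longrightarrow> B (c *\<^sub>R x) z = c * B x z"
    and nonneg: "\<And>x. x \<in> span S \<Longrightarrow> B x x \<ge> 0"
  obtains T :: "'a \<Rightarrow> ell2" where "linear T" "\<And>x. x \<in> span S \<Longrightarrow> (norm (T x))\<^sup>2 = B x x"
proof -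
  obtain b :: "nat \<Rightarrow> 'a" and N where b: "S = b ` {..<N}"
    using finite_imp_nat_seg_image_inj_on[OF \<open>finite S\<close>] by (auto simp: lessThan_def)
  obtain e where e: "\<And>j. j < N \<Longrightarrow> e j \<in> span S"
    "\<And>x y. x \<in> span S \<Longrightarrow> y \<in> span S \<Longrightarrow> B x y = (\<Sum>j<N. B x (e j) * B (e j) y)"
    by (rule exists_parseval_system[of b N B, folded b]) (use sym add scale nonneg in blast)+
  define T0 where "T0 x = ell2_of N (\<lambda>j. if j < N then B x (e j) else 0)" for x
  have "T0 (x + y) = T0 x + T0 y" if "x \<in> span S" "y \<in> span S" for x y
    unfolding T0_def ell2_of_add[symmetric] using add[OF that e(1)]
    by (intro arg_cong[of _ _ "ell2_of N"] ext) simp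
  moreover have "T0 (c *\<^sub>R x) = c *\<^sub>R T0 x" if "x \<in> span S" for c x
    unfolding T0_def ell2_of_scaleR[symmetric] using scale[OF that e(1)]
    by (intro arg_cong[of _ _ "ell2_of N"] ext) simp
  ultimately obtain T where T: "linear T" "\<And>x. x \<in> span S \<Longrightarrow> T x = T0 x"
    by (rule linear_extension_from_subspace[OF subspace_span]) blast+
  show thesis
  proof (rule that[OF T(1)])
    fix x assume x: "x \<in> span S"
    have "(norm (T x))\<^sup>2 = (\<Sum>j<N. (B x (e j))\<^sup>2)"
      by (simp add: T(2)[OF x] T0_def norm_ell2_of)
    also have "\<dots> = (\<Sum>j<N. B x (e j) * B (e j) x)"
      using sym[OF x e(1)] by (intro sum.cong) (auto simp: power2_eq_square)
    also have "\<dots> = B x x" using e(2)[OF x x] by simp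
    finally show "(norm (T x))\<^sup>2 = B x x" .
  qed
qed

section \<open>From the greedy algorithm and Kolmogorov widths to the determinant bound\<close>

text \<open>The distance of \<open>f n\<close> grows when the span shrinks to that of the first
  \<open>i\<close> vectors, and there \<open>f i\<close> is the farthest point of \<open>K\<close>.
  This is how maximality in the greedy rule enters; for \<open>i = 0\<close> the span is
  \<open>{0}\<close> and the distance is the norm.\<close>

lemma greedy_error_le_norm:
  assumes "greedy_sequence K f" "n \<ge> 1" "i \<le> n" "v \<in> span (f ` {..<i})"
  shows "greedy_error f n \<le> norm (f i - v)"
proof -
  have fK: "f n \<in> K" using assms by (auto simp: greedy_sequence_def)
  have "greedy_error f n = infdist (f n) (span (f ` {..<n}))"
    using assms by (simp add: greedy_error_def)
  also have "\<dots> \<le> infdist (f n) (span (f ` {..<i}))"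
    using assms(3) by (intro infdist_mono span_mono) (auto intro!: exI[of _ 0] span_zero)
  also have "\<dots> \<le> infdist (f i) (span (f ` {..<i}))"
  proof (cases "i = 0")
    case True
    then show ?thesis
      using assms(1) fK by (simp add: greedy_sequence_def dist_norm)
  next
    case False
    then show ?thesis
      using assms(1) fK by (auto simp: greedy_sequence_def)
  qed
  also have "\<dots> \<le> dist (f i) v" by (rule infdist_le[OF assms(4)])
  finally show ?thesis by (simp add: dist_norm)
qed

text \<open>Infinite-dimensional subspaces, where \<open>dim\<close> is 0, have to be excluded. If
  some \<open>n\<close>-dimensional subspace exists, then \<open>dim L = n >= 1\<close>; otherwise
  \<open>n\<close> independent vectors in \<open>L\<close> would span one.\<close>

lemma width_subspace_has_finite_basis:
  assumes "L \<in> width_subspaces n" "n \<ge> 1"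
  obtains W where "finite W" "card W \<le> n" "span W = L"
proof -
  have L: "subspace L"
    using assms by (auto simp: width_subspaces_def subspaces_of_dim_def split: if_splits)
  obtain B where B: "B \<subseteq> L" "independent B" "L \<subseteq> span B" "card B = dim L"
    by (rule basis_exists)
  have "finite B \<and> card B \<le> n"
  proof (cases "subspaces_of_dim n = ({} :: 'a set set)")
    case False
    then have "dim L = n" using assms by (auto simp: width_subspaces_def subspaces_of_dim_def)
    then show ?thesis using B assms by (simp add: card_ge_0_finite)
  next
    case True
    show ?thesis
    proof (rule ccontr)
      assume "\<not> ?thesis"
      then obtain C where C: "C \<subseteq> B" "finite C" "card C = n"
        by (metis infinite_arbitrarily_large nat_le_linear obtain_subset_with_card_n)
      then have "independent C" using B(2) independent_mono by blast
      then have "dim (span C) = n"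
        using dim_eq_card_independent C by (simp add: dim_eq_card_independent)
      then have "span C \<in> subspaces_of_dim n" by (simp add: subspaces_of_dim_def)
      then show False using True by blast
    qed
  qed
  then show thesis
    using that[of B] B L by (metis span_minimal subset_antisym)
qed

text \<open>The strict inequality makes up for infima that need not be attained. The unit ball
  bounds the suprema, so that the real-valued \<open>SUP\<close> and \<open>INF\<close> have their
  usual meaning.\<close>

lemma kolmogorov_width_less_imp_approximable:
  fixes K :: "'a::real_normed_vector set"
  assumes K: "K \<noteq> {}" "K \<subseteq> cball 0 1" and n: "n \<ge> 1" and less: "kolmogorov_width K n < \<delta>"
  obtains W where "finite W" "card W \<le> n" "\<And>x. x \<in> K \<Longrightarrow> \<exists>u\<in>span W. norm (x - u) \<le> \<delta>"
proof -
  have bdd: "bdd_above ((\<lambda>x. infdist x L) ` K)" if "subspace L" for L :: "'a set"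
  proof (rule bdd_aboveI2)
    fix x assume "x \<in> K"
    then have "infdist x L \<le> dist x 0"
      by (intro infdist_le subspace_0 that)
    then show "infdist x L \<le> 1" using K(2) \<open>x \<in> K\<close> by (auto simp: dist_norm)
  qed
  have sub: "subspace L" if "L \<in> width_subspaces n" for L :: "'a set"
    using that by (auto simp: width_subspaces_def subspaces_of_dim_def split: if_splits)
  have ne: "width_subspaces n \<noteq> ({} :: 'a set set)"
  proof (cases "subspaces_of_dim n = ({} :: 'a set set)")
    case True
    have "{0} \<in> {L :: 'a set. subspace L \<and> dim L \<le> n}"
      using dim_span[of "{} :: 'a set"] dim_eq_card_independent[of "{} :: 'a set"]
      by (simp add: subspace_def independent_empty)
    then show ?thesis using True by (auto simp: width_subspaces_def)
  qed (simp add: width_subspaces_def)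
  have "bdd_below ((\<lambda>L. SUP x\<in>K. infdist x L) ` width_subspaces n)"
  proof (rule bdd_belowI2)
    fix L :: "'a set" assume "L \<in> width_subspaces n"
    obtain x where "x \<in> K" using K by blast
    have "0 \<le> infdist x L" by (rule infdist_nonneg)
    also have "\<dots> \<le> (SUP x\<in>K. infdist x L)"
      by (rule cSUP_upper[OF \<open>x \<in> K\<close> bdd[OF sub[OF \<open>L \<in> _\<close>]]])
    finally show "0 \<le> (SUP x\<in>K. infdist x L)" .
  qed
  then obtain L where L: "L \<in> width_subspaces n" "(SUP x\<in>K. infdist x L) < \<delta>"
    using less ne unfolding kolmogorov_width_def by (subst (asm) cINF_less_iff) auto
  obtain W where W: "finite W" "card W \<le> n" "span W = L"
    using width_subspace_has_finite_basis[OF L(1) n] .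
  show thesis
  proof (rule that[OF W(1,2)])
    fix x assume x: "x \<in> K"
    have "infdist x L < \<delta>"
      using cSUP_upper[OF x bdd[OF sub[OF L(1)]]] L(2) by simp
    moreover have "L \<noteq> {}" using sub[OF L(1)] subspace_0 by blast
    ultimately have "\<exists>u\<in>L. dist x u < \<delta>"
      by (simp add: infdist_notempty cINF_less_iff)
    then show "\<exists>u\<in>span W. norm (x - u) \<le> \<delta>"
      using W by (auto simp: dist_norm intro: less_imp_le)
  qed
qed

text \<open>A contraction \<open>T\<close> carries the norm bounds and the approximation rates over
  to \<open>ell2\<close>, and the last condition separates the images of the greedy vectors.
  \<open>T\<close> may depend on \<open>f\<close>, \<open>n\<close> and \<open>S\<close>, but
  \<open>A\<close> may not, so the final constant is uniform over all greedy sequences.\<close>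

lemma greedy_rate_of_euclidean_structure:
  fixes K :: "'a::real_normed_vector set" and \<mu> s C\<^sub>2 A :: real
  assumes K: "K \<noteq> {}" "K \<subseteq> cball 0 1" and s: "s \<ge> 0" and C\<^sub>2: "C\<^sub>2 > 0" and A: "A > 0"
    and width: "\<And>n. n \<ge> 1 \<Longrightarrow> kolmogorov_width K n \<le> C\<^sub>2 * real n powr (- s)"
    and euclid: "\<And>f n S. greedy_sequence K f \<Longrightarrow> n \<ge> 1 \<Longrightarrow> greedy_error f n > 0 \<Longrightarrow>
      finite S \<Longrightarrow> f ` {..<n} \<subseteq> S \<Longrightarrow> card S \<le> 3 * n \<Longrightarrow>
      \<exists>T :: 'a \<Rightarrow> ell2. linear T \<and> (\<forall>x\<in>span S. norm (T x) \<le> norm x) \<and>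
        (\<forall>i<n. \<forall>v\<in>span (f ` {..<i}). greedy_error f n \<le> A * real n powr \<mu> * norm (T (f i - v)))"
  shows "\<exists>C>0. \<forall>f. greedy_sequence K f \<longrightarrow> (\<forall>n\<ge>1. greedy_error f n
      \<le> C * real n powr (- s + \<mu>) * ln (real n + 2) powr min s (1 / 2))"
proof -
  \<comment> \<open>The 1 dominates the norms of the \<open>f i\<close>;
    \<open>2 * C\<^sub>2\<close> leaves a strict gap above the widths.\<close>
  define D where "D = max 1 (2 * C\<^sub>2)"
  define E where "E = (1 + 4 * 4 powr s) * exp (2 * s + 1)"
  have D: "D > 0" "D \<ge> 1" "D \<ge> 2 * C\<^sub>2" by (auto simp: D_def)
  have E: "E > 0" by (auto simp: E_def intro!: mult_pos_pos add_pos_nonneg)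
  have "\<exists>W. finite W \<and> card W \<le> 2 ^ k \<and> (\<forall>x\<in>K. \<exists>u\<in>span W. norm (x - u) \<le> D * (2 ^ k) powr (- s))" for k
  proof -
    have "kolmogorov_width K (2 ^ k) \<le> C\<^sub>2 * real (2 ^ k) powr (- s)" by (rule width) simp
    also have "\<dots> < D * (2 ^ k) powr (- s)" using D C\<^sub>2 by (simp add: mult_strict_right_mono)
    finally obtain W where "finite W" "card W \<le> 2 ^ k"
      "\<And>x. x \<in> K \<Longrightarrow> \<exists>u\<in>span W. norm (x - u) \<le> D * (2 ^ k) powr (- s)"
      using kolmogorov_width_less_imp_approximable[OF K, of "2 ^ k"] one_le_power[of "2::nat" k] by auto
    then show ?thesis by blast
  qed
  then obtain W where W: "\<And>k. finite (W k)" "\<And>k. card (W k) \<le> 2 ^ k"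
    "\<And>k x. x \<in> K \<Longrightarrow> \<exists>u\<in>span (W k). norm (x - u) \<le> D * (2 ^ k) powr (- s)"
    by metis
  show ?thesis
  proof (intro exI[of _ "A * D * sqrt E"] conjI allI impI)
    fix f n assume f: "greedy_sequence K f" and n: "(n::nat) \<ge> 1"
    have fK: "f i \<in> K" for i using f by (cases "i = 0") (auto simp: greedy_sequence_def)
    \<comment> \<open>\<open>ln (n + 2) >= ln 3 >= 1\<close>, so the logarithmic factor may be
      inserted for free.\<close>
    have rhs: "1 \<le> ln (real n + 2) powr min s (1 / 2)"
    proof (rule ge_one_powr_ge_zero)
      have "exp 1 \<le> (3::real)" by (rule exp_le)
      then show "1 \<le> ln (real n + 2)" using n by (subst ln_ge_iff) auto
    qed (use s in auto)
    define \<sigma> where "\<sigma> = greedy_error f n"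
    have "\<sigma> \<le> A * D * sqrt E * real n powr (- s + \<mu>)"
    proof (cases "\<sigma> > 0")
      case False
      then have "\<sigma> \<le> 0" by simp
      also have "0 \<le> A * D * sqrt E * real n powr (- s + \<mu>)" using A D E by simp
      finally show ?thesis .
    next
      case True
      \<comment> \<open>At most \<open>n\<close> greedy vectors and fewer than \<open>2 * n\<close>
        vectors spanning the approximating spaces, hence the bound \<open>3 * n\<close>.\<close>
      define S where "S = f ` {..<n} \<union> (\<Union>k\<in>{k. 2 ^ k < n}. W k)"
      have fin: "finite {k. 2 ^ k < n}" by (rule sum_powers_of_two_less(2)[OF n])
      have "card S \<le> card (f ` {..<n}) + card (\<Union>k\<in>{k. 2 ^ k < n}. W k)"
        unfolding S_def by (rule card_Un_le)
      also have "card (f ` {..<n}) \<le> n" using card_image_le[of "{..<n}" f] by simp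
      also have "card (\<Union>k\<in>{k. 2 ^ k < n}. W k) \<le> (\<Sum>k | 2 ^ k < n. card (W k))"
        by (rule card_UN_le[OF fin])
      also have "\<dots> \<le> (\<Sum>k | 2 ^ k < n. 2 ^ k)" by (rule sum_mono) (rule W)
      also have "\<dots> \<le> 2 * n" using sum_powers_of_two_less(1)[OF n] by simp
      finally have "card S \<le> 3 * n" by simp
      moreover have "finite S" "f ` {..<n} \<subseteq> S" using fin W by (auto simp: S_def)
      ultimately obtain T :: "'a \<Rightarrow> ell2" where T: "linear T" "\<And>x. x \<in> span S \<Longrightarrow> norm (T x) \<le> norm x"
        "\<And>i v. i < n \<Longrightarrow> v \<in> span (f ` {..<i}) \<Longrightarrow> \<sigma> \<le> A * real n powr \<mu> * norm (T (f i - v))"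
        using euclid[OF f n, of S] True unfolding \<sigma>_def by blast
      have fS: "f i \<in> span S" if "i < n" for i
        using that by (auto simp: S_def intro: span_base)
      have An: "A * real n powr \<mu> > 0" using A n by simp
      have "(\<sigma> / (A * real n powr \<mu>))\<^sup>2 \<le> D\<^sup>2 * E * real n powr (- (2 * s))"
        unfolding E_def
      proof (rule gram_det_approximable_le[where g = "\<lambda>i. T (f i)" and Q = "\<lambda>k. T ` W k"])
        show "norm (T (f i)) \<le> D" if "i < n" for i
        proof -
          have "norm (f i) \<le> 1" using fK[of i] K(2) by auto
          then show ?thesis using T(2)[OF fS[OF that]] D by simp
        qed
        show "finite (T ` W k) \<and> card (T ` W k) \<le> 2 ^ k" for k
          using W(1,2)[of k] card_image_le[OF W(1), of T k] by simp
        show "\<exists>u\<in>span (T ` W k). norm (T (f i) - u) \<le> D * (2 ^ k) powr (- s)"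
          if k: "2 ^ k < n" and i: "i < n" for k i
        proof -
          obtain u where u: "u \<in> span (W k)" "norm (f i - u) \<le> D * (2 ^ k) powr (- s)"
            using W(3)[OF fK] by blast
          have "u \<in> span S"
            using u(1) k span_mono[of "W k" S] by (auto simp: S_def)
          then have "norm (T (f i - u)) \<le> norm (f i - u)"
            using fS[OF i] by (intro T(2) span_diff)
          moreover have "T u \<in> span (T ` W k)"
            using u(1) by (simp add: linear_span_image[OF T(1)])
          ultimately show ?thesis
            using u(2) by (intro bexI[of _ "T u"]) (auto simp: linear_diff[OF T(1)])
        qed
        show "\<sigma> / (A * real n powr \<mu>) \<le> norm (T (f i) - v)"
          if i: "i < n" and v: "v \<in> span ((\<lambda>i. T (f i)) ` {..<i})" for i v
        proof -
          have "(\<lambda>i. T (f i)) ` {..<i} = T ` (f ` {..<i})" by auto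
          then obtain u where u: "u \<in> span (f ` {..<i})" "v = T u"
            using v by (auto simp: linear_span_image[OF T(1)])
          show ?thesis
            using T(3)[OF i u(1)] An by (simp add: u(2) linear_diff[OF T(1)] pos_divide_le_eq mult.commute)
        qed
      qed (use n s D True An in auto)
      also have "\<dots> = (D * sqrt E * real n powr (- s))\<^sup>2"
      proof -
        have "(real n powr (- s))\<^sup>2 = real n powr (- (2 * s))"
          by (simp add: power2_eq_square flip: powr_add)
        then show ?thesis using E by (simp add: power_mult_distrib)
      qed
      finally have "\<sigma> / (A * real n powr \<mu>) \<le> D * sqrt E * real n powr (- s)"
        by (rule power2_le_imp_le) (use D E in simp)
      then have "\<sigma> \<le> D * sqrt E * real n powr (- s) * (A * real n powr \<mu>)"
        using An by (subst (asm) pos_divide_le_eq)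
      also have "\<dots> = A * D * sqrt E * real n powr (- s + \<mu>)"
        by (simp only: powr_add mult_ac)
      finally show ?thesis .
    qed
    also have "\<dots> = A * D * sqrt E * real n powr (- s + \<mu>) * 1" by simp
    also have "\<dots> \<le> A * D * sqrt E * real n powr (- s + \<mu>) * ln (real n + 2) powr min s (1 / 2)"
      using A D E rhs by (intro mult_left_mono) auto
    finally show "greedy_error f n \<le> A * D * sqrt E * real n powr (- s + \<mu>) * ln (real n + 2) powr min s (1 / 2)"
      by (simp add: \<sigma>_def)
  qed (use A D E in auto)
qed

section \<open>Banach-Mazur distance and the first claim of the theorem\<close>

lemma dim_span_finite:
  fixes S :: "'a::real_vector set"
  assumes "finite S"
  shows "dim (span S) \<le> card S" and "x \<in> span S \<Longrightarrow> x \<noteq> 0 \<Longrightarrow> dim (span S) \<ge> 1"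
proof -
  obtain B where B: "B \<subseteq> span S" "independent B" "span S \<subseteq> span B" "card B = dim (span S)"
    by (rule basis_exists)
  have f: "finite B" "card B \<le> card S"
    using independent_span_bound[OF assms B(2,1)] by auto
  then show "dim (span S) \<le> card S" using B by simp
  show "dim (span S) \<ge> 1" if "x \<in> span S" "x \<noteq> 0"
  proof (rule ccontr)
    assume "\<not> ?thesis"
    then have "card B = 0" using B(4) by linarith
    then have "B = {}" using f by simp
    then show False using B(3) that by auto
  qed
qed

text \<open>\<open>0 / 0 = 0\<close> makes the zero vector harmless in the supremum; the boundedness
  of \<open>T\<close> keeps the real-valued \<open>SUP\<close> meaningful.\<close>

lemma onorm_on_bound:
  assumes "bounded_linear_on V T" "x \<in> V"
  shows "norm (T x) \<le> onorm_on V T * norm x"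
proof (cases "x = 0")
  case True
  then have "T x = 0" using assms unfolding bounded_linear_on_def by (metis scaleR_zero_left)
  then show ?thesis using True by simp
next
  case False
  obtain B where B: "\<And>y. y \<in> V \<Longrightarrow> norm (T y) \<le> norm y * B"
    using assms(1) unfolding bounded_linear_on_def by blast
  have "bdd_above ((\<lambda>y. norm (T y) / norm y) ` V)"
  proof (rule bdd_aboveI2)
    fix y assume "y \<in> V"
    then have "norm (T y) / norm y \<le> \<bar>B\<bar>"
      using B[of y] by (cases "norm y = 0") (auto simp: field_simps intro: order_trans[OF _ mult_right_mono[of B "\<bar>B\<bar>"]])
    then show "norm (T y) / norm y \<le> \<bar>B\<bar>" .
  qed
  then have "norm (T x) / norm x \<le> onorm_on V T"
    unfolding onorm_on_def by (rule cSUP_upper[OF assms(2)])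
  then show ?thesis using False by (simp add: field_simps)
qed

text \<open>The added 1 compensates for an unattained infimum. Dividing an isomorphism by its norm
  \<open>a\<close> makes it a contraction and multiplies the norm \<open>b\<close> of its inverse by
  \<open>a\<close>; \<open>a > 0\<close> because \<open>V\<close> contains a nonzero vector.
  \<open>max c 0\<close> matches the truncation in \<open>ennreal c\<close>.\<close>

lemma exists_near_isometry_to_ell2:
  fixes V :: "'a::real_normed_vector set"
  assumes V: "subspace V" "dim V = d" "d \<ge> 1" and c: "euclidean_constant TYPE('a) d \<le> ennreal c"
  obtains T :: "'a \<Rightarrow> ell2" where "linear T" "\<And>x. x \<in> V \<Longrightarrow> norm (T x) \<le> norm x"
    "\<And>x. x \<in> V \<Longrightarrow> norm x \<le> (max c 0 + 1) * norm (T x)"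
proof -
  have "banach_mazur V (ell2n d) \<le> euclidean_constant TYPE('a) d"
    unfolding euclidean_constant_def using V by (intro SUP_upper) (auto simp: subspaces_of_dim_def)
  also have "\<dots> \<le> ennreal (max c 0)" using c ennreal_leI[of c "max c 0"] by (meson max.cobounded1 order_trans)
  also have "\<dots> < ennreal (max c 0 + 1)" by (rule ennreal_lessI) auto
  finally obtain T where T: "isomorphism_on V (ell2n d) T"
    "ennreal (onorm_on V T * onorm_on (ell2n d) (the_inv_into V T)) < ennreal (max c 0 + 1)"
    unfolding banach_mazur_def INF_less_iff by blast
  define a where "a = onorm_on V T"
  define b where "b = onorm_on (ell2n d) (the_inv_into V T)"
  have ab: "a * b < max c 0 + 1"
    using T(2) ennreal_leI[of "max c 0 + 1" "a * b"] unfolding a_def b_def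
    by (meson not_le)
  have bij: "bij_betw T V (ell2n d)" and T1: "bounded_linear_on V T"
    and T2: "bounded_linear_on (ell2n d) (the_inv_into V T)"
    using T(1) by (auto simp: isomorphism_on_def)
  have upper: "norm (T x) \<le> a * norm x" if "x \<in> V" for x
    unfolding a_def by (rule onorm_on_bound[OF T1 that])
  have lower: "norm x \<le> b * norm (T x)" if "x \<in> V" for x
  proof -
    have "the_inv_into V T (T x) = x" using bij that by (auto simp: bij_betw_def the_inv_into_f_f)
    moreover have "T x \<in> ell2n d" using bij that by (auto simp: bij_betw_def)
    ultimately show ?thesis
      unfolding b_def using onorm_on_bound[OF T2, of "T x"] by simp
  qed
  have "\<exists>x\<in>V. x \<noteq> 0"
  proof (rule ccontr)
    assume "\<not> ?thesis"
    then have "V \<subseteq> span {}" by auto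
    then have "dim V \<le> card ({} :: 'a set)"
      using V(1) by (metis dim_span_finite(1) finite.emptyI span_empty span_minimal subset_antisym
          empty_subsetI)
    then show False using V by simp
  qed
  then obtain x where x: "x \<in> V" "x \<noteq> 0" by blast
  have "T x \<noteq> 0" using lower[OF x(1)] x(2) by auto
  then have "0 < a * norm x" using upper[OF x(1)] by (meson less_le_trans zero_less_norm_iff)
  then have a: "a > 0" by (simp add: zero_less_mult_iff)
  obtain T' where T': "linear T'" "\<And>x. x \<in> V \<Longrightarrow> T' x = T x"
    by (rule linear_extension_from_subspace[OF V(1), of T])
      (use T1 in \<open>auto simp: bounded_linear_on_def\<close>)
  show thesis
  proof (rule that[of "\<lambda>x. (1 / a) *\<^sub>R T' x"])
    show "linear (\<lambda>x. (1 / a) *\<^sub>R T' x)" by (rule linear_compose_scale_right[OF T'(1)])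
    fix y assume y: "y \<in> V"
    show "norm ((1 / a) *\<^sub>R T' y) \<le> norm y"
      using upper[OF y] a T'(2)[OF y] by (simp add: field_simps)
    have "norm y \<le> b * norm (T y)" by (rule lower[OF y])
    also have "\<dots> = (a * b) * norm ((1 / a) *\<^sub>R T' y)" using a T'(2)[OF y] by simp
    also have "\<dots> \<le> (max c 0 + 1) * norm ((1 / a) *\<^sub>R T' y)"
      using ab by (intro mult_right_mono) auto
    finally show "norm y \<le> (max c 0 + 1) * norm ((1 / a) *\<^sub>R T' y)" .
  qed
qed

proposition greedy_rate_of_euclidean_constant:
  fixes K :: "'a::real_normed_vector set" and \<mu> s C\<^sub>1 C\<^sub>2 :: real
  assumes K: "K \<noteq> {}" "K \<subseteq> cball 0 1" and \<mu>: "\<mu> \<ge> 0" and s: "s > \<mu>" and C: "C\<^sub>1 > 0" "C\<^sub>2 > 0"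
    and const: "\<And>n. n \<ge> 1 \<Longrightarrow> euclidean_constant TYPE('a) n \<le> ennreal (C\<^sub>1 * real n powr \<mu>)"
    and width: "\<And>n. n \<ge> 1 \<Longrightarrow> kolmogorov_width K n \<le> C\<^sub>2 * real n powr (- s)"
  shows "\<exists>C>0. \<forall>f. greedy_sequence K f \<longrightarrow> (\<forall>n\<ge>1. greedy_error f n
      \<le> C * real n powr (- s + \<mu>) * ln (real n + 2) powr min s (1 / 2))"
proof (rule greedy_rate_of_euclidean_structure[OF K _ C(2) _ width])
  \<comment> \<open>The dimension is at most \<open>3 * n\<close>; the 1 from the near isometry is
    absorbed by \<open>n powr \<mu> >= 1\<close>.\<close>
  let ?A = "C\<^sub>1 * 3 powr \<mu> + 1"
  show "s \<ge> 0" "?A > 0" using s \<mu> C by (auto intro: add_nonneg_pos)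
  fix f n and S :: "'a set"
  assume f: "greedy_sequence K f" and n: "n \<ge> 1" and pos: "greedy_error f n > 0"
    and S: "finite S" "f ` {..<n} \<subseteq> S" "card S \<le> 3 * n"
  define d where "d = dim (span S)"
  \<comment> \<open>A nonzero vector gives \<open>d >= 1\<close>, the range in which
    \<open>dim\<close> and the bound on \<open>euclidean_constant\<close> can be used.\<close>
  have "f 0 \<noteq> 0"
    using greedy_error_le_norm[OF f n, of 0 0] pos by (auto simp: span_zero)
  moreover have "f 0 \<in> span S" using S(2) n by (intro span_base) auto
  ultimately have d: "d \<ge> 1" "d \<le> 3 * n"
    using dim_span_finite[OF S(1)] S(3) unfolding d_def by auto
  let ?c = "C\<^sub>1 * real d powr \<mu>"
  obtain T :: "'a \<Rightarrow> ell2" where T: "linear T" "\<And>x. x \<in> span S \<Longrightarrow> norm (T x) \<le> norm x"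
    "\<And>x. x \<in> span S \<Longrightarrow> norm x \<le> (max ?c 0 + 1) * norm (T x)"
    using exists_near_isometry_to_ell2[OF subspace_span d_def[symmetric] d(1) const[OF d(1)]] by blast
  have "max ?c 0 + 1 \<le> ?A * real n powr \<mu>"
  proof -
    have "real d powr \<mu> \<le> (3 * real n) powr \<mu>" using d \<mu> by (intro powr_mono2) auto
    then have "?c \<le> C\<^sub>1 * (3 powr \<mu> * real n powr \<mu>)"
      using C by (simp add: powr_mult)
    moreover have "1 \<le> real n powr \<mu>" using n \<mu> by (intro ge_one_powr_ge_zero) auto
    moreover have "?c \<ge> 0" using C by simp
    ultimately show ?thesis by (simp add: algebra_simps)
  qed
  note A = this
  show "\<exists>T :: 'a \<Rightarrow> ell2. linear T \<and> (\<forall>x\<in>span S. norm (T x) \<le> norm x) \<and>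
      (\<forall>i<n. \<forall>v\<in>span (f ` {..<i}). greedy_error f n \<le> ?A * real n powr \<mu> * norm (T (f i - v)))"
  proof (intro exI[of _ T] conjI ballI allI impI T)
    fix i v assume i: "i < n" and v: "v \<in> span (f ` {..<i})"
    have "f ` {..<i} \<subseteq> S" using S(2) i by auto
    then have m: "f i - v \<in> span S"
      using v S(2) i span_mono[of "f ` {..<i}" S] by (intro span_diff) (auto intro: span_base)
    have "greedy_error f n \<le> norm (f i - v)"
      using greedy_error_le_norm[OF f n _ v] i by simp
    also have "\<dots> \<le> (max ?c 0 + 1) * norm (T (f i - v))" by (rule T(3)[OF m])
    also have "\<dots> \<le> ?A * real n powr \<mu> * norm (T (f i - v))"
      by (rule mult_right_mono[OF A]) simp
    finally show "greedy_error f n \<le> ?A * real n powr \<mu> * norm (T (f i - v))" .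
  qed
qed

section \<open>Dominated functionals\<close>

definition sublinear_functional :: "('a::real_vector \<Rightarrow> real) \<Rightarrow> bool" where
  "sublinear_functional q \<longleftrightarrow>
    (\<forall>x y. q (x + y) \<le> q x + q y) \<and> (\<forall>c x. c \<ge> 0 \<longrightarrow> q (c *\<^sub>R x) = c * q x)"

lemma sublinear_functionalD:
  assumes "sublinear_functional q"
  shows "q (x + y) \<le> q x + q y" "c \<ge> 0 \<Longrightarrow> q (c *\<^sub>R x) = c * q x" "q 0 = 0" "- q (- x) \<le> q x"
proof -
  show 1: "q (x + y) \<le> q x + q y" for x y using assms by (simp add: sublinear_functional_def)
  show 2: "c \<ge> 0 \<Longrightarrow> q (c *\<^sub>R x) = c * q x" for c x using assms by (simp add: sublinear_functional_def)
  show 3: "q 0 = 0" using 2[of 0 0] by simp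
  show "- q (- x) \<le> q x" using 1[of x "- x"] 3 by simp
qed

text \<open>One step of a Hahn-Banach argument that shrinks \<open>q\<close> instead of extending a
  functional: \<open>q' x\<close> is the infimum over \<open>t >= 0\<close> of
  \<open>q (x + t *\<^sub>R a) - t * q a\<close>. It is bounded below by \<open>- q (- x)\<close>,
  and \<open>t = 1\<close> at \<open>- a\<close> gives linearity along \<open>a\<close>.\<close>

lemma sublinear_functional_linearize_at:
  fixes q :: "'a::real_vector \<Rightarrow> real"
  assumes q: "sublinear_functional q"
  obtains q' where "sublinear_functional q'" "\<And>x. q' x \<le> q x" "q' a = q a" "q' (- a) = - q a"
proof -
  note qD = sublinear_functionalD[OF q]
  define F where "F x t = q (x + t *\<^sub>R a) - t * q a" for x t
  define q' where "q' x = (INF t\<in>{0..}. F x t)" for x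
  have bdd: "bdd_below (F x ` {0..})" for x
  proof (rule bdd_belowI2)
    fix t :: real assume "t \<in> {0..}"
    then have "t * q a = q ((x + t *\<^sub>R a) + (- x))" using qD(2)[of t a] by simp
    also have "\<dots> \<le> q (x + t *\<^sub>R a) + q (- x)" by (rule qD(1))
    finally show "- q (- x) \<le> F x t" by (simp add: F_def)
  qed
  have lower: "q' x \<le> F x t" if "t \<ge> 0" for x t
    unfolding q'_def using that by (intro cINF_lower bdd) auto
  have greatest: "c \<le> q' x" if "\<And>t. t \<ge> 0 \<Longrightarrow> c \<le> F x t" for c x
    unfolding q'_def using that by (intro cINF_greatest) auto
  have le: "q' x \<le> q x" for x using lower[of 0 x] by (simp add: F_def)
  have zero: "q' 0 = 0"
    using greatest[of 0 0] lower[of 0 0] qD by (force simp: F_def)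
  have add: "q' (x + y) \<le> q' x + q' y" for x y
  proof -
    have *: "q' (x + y) \<le> F x t + F y r" if "t \<ge> 0" "r \<ge> 0" for t r
    proof -
      have "q' (x + y) \<le> F (x + y) (t + r)" using that by (intro lower) simp
      also have "F (x + y) (t + r) = q ((x + t *\<^sub>R a) + (y + r *\<^sub>R a)) - (t + r) * q a"
        by (simp add: F_def algebra_simps)
      also have "\<dots> \<le> F x t + F y r"
        using qD(1)[of "x + t *\<^sub>R a" "y + r *\<^sub>R a"] by (simp add: F_def algebra_simps)
      finally show ?thesis .
    qed
    have "q' (x + y) - F x t \<le> q' y" if "t \<ge> 0" for t
      by (rule greatest) (use *[OF that] in \<open>simp add: algebra_simps\<close>)
    then have "q' (x + y) - q' y \<le> q' x"
      by (intro greatest) (simp add: algebra_simps)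
    then show ?thesis by simp
  qed
  have scale_le: "q' (c *\<^sub>R x) \<le> c * q' x" if c: "c > 0" for c x
  proof -
    have "q' (c *\<^sub>R x) / c \<le> q' x"
    proof (rule greatest)
      fix t :: real assume t: "t \<ge> 0"
      have "q' (c *\<^sub>R x) \<le> F (c *\<^sub>R x) (c * t)" using c t by (intro lower) simp
      also have "\<dots> = c * F x t"
        using qD(2)[of c "x + t *\<^sub>R a"] c by (simp add: F_def algebra_simps)
      finally show "q' (c *\<^sub>R x) / c \<le> F x t" using c by (simp add: field_simps)
    qed
    then show ?thesis using c by (simp add: field_simps)
  qed
  have scale: "q' (c *\<^sub>R x) = c * q' x" if "c \<ge> 0" for c x
  proof (cases "c = 0")
    case False
    then have c: "c > 0" using that by simp
    have "q' ((1 / c) *\<^sub>R (c *\<^sub>R x)) \<le> (1 / c) * q' (c *\<^sub>R x)" using c by (intro scale_le) simp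
    then have "c * q' x \<le> q' (c *\<^sub>R x)" using c by (simp add: field_simps)
    then show ?thesis using scale_le[OF c, of x] by simp
  qed (simp add: zero)
  have "q' (- a) \<le> - q a" using lower[of 1 "- a"] qD(3) by (simp add: F_def)
  moreover have "q' a \<le> q a" by (rule le)
  moreover have "0 \<le> q' a + q' (- a)" using add[of a "- a"] zero by simp
  ultimately have "q' a = q a" "q' (- a) = - q a" by linarith+
  moreover have "sublinear_functional q'"
    using add scale by (simp add: sublinear_functional_def)
  ultimately show thesis using le by (intro that[of q'])
qed

text \<open>A sublinear \<open>q\<close> is linear on the set of all \<open>x\<close> with \<open>q (- x) = - q x\<close>, and this set
  only grows when \<open>q\<close> is replaced by a smaller sublinear functional.\<close>

lemma sublinear_functional_linear_on_span:
  assumes q: "sublinear_functional q" and S: "\<And>x. x \<in> S \<Longrightarrow> q (- x) = - q x"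
    and x: "x \<in> span S"
  shows "q (x + y) = q x + q y" and "q (c *\<^sub>R x) = c * q x" and "q (- x) = - q x"
proof -
  note qD = sublinear_functionalD[OF q]
  define L where "L = {x. q (- x) = - q x}"
  have add: "q (x + y) = q x + q y" if "x \<in> L" for x y
    using qD(1)[of x y] qD(1)[of "x + y" "- x"] that by (simp add: L_def)
  have scale: "q (c *\<^sub>R x) = c * q x" if "x \<in> L" for c x
  proof (cases "c \<ge> 0")
    case False
    then have "q (c *\<^sub>R x) = (- c) * q (- x)" using qD(2)[of "- c" "- x"] by simp
    then show ?thesis using that by (simp add: L_def)
  qed (rule qD(2))
  have "subspace L"
  proof (rule subspaceI)
    show "0 \<in> L" using qD(3) by (simp add: L_def)
    show "x + y \<in> L" if "x \<in> L" "y \<in> L" for x y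
    proof -
      have "- x \<in> L" using that by (simp add: L_def)
      then show ?thesis
        using add[OF that(1), of y] add[of "- x" "- y"] that by (simp add: L_def)
    qed
    show "c *\<^sub>R x \<in> L" if "x \<in> L" for c x
      using scale[OF that, of c] scale[OF that, of "- c"] by (simp add: L_def)
  qed
  moreover have "S \<subseteq> L" using S by (auto simp: L_def)
  ultimately have "x \<in> L" using x span_minimal by blast
  then show "q (x + y) = q x + q y" "q (c *\<^sub>R x) = c * q x" "q (- x) = - q x"
    using add scale by (auto simp: L_def)
qed

text \<open>\<open>q\<close> is linearized at \<open>a\<close> first, which fixes the value
  \<open>q a\<close>, and then at each vector of \<open>S\<close>. The resulting minorant is linear
  on the span.\<close>

lemma exists_dominated_functional:
  fixes q :: "'a::real_vector \<Rightarrow> real"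
  assumes q: "sublinear_functional q" and S: "finite S"
  obtains \<phi> where "linear \<phi>" "\<phi> a = q a" "\<And>x. x \<in> span (insert a S) \<Longrightarrow> \<phi> x \<le> q x"
proof -
  have "\<exists>q'. sublinear_functional q' \<and> (\<forall>x. q' x \<le> q x) \<and> q' a = q a \<and> (\<forall>x\<in>insert a S. q' (- x) = - q' x)"
    using S
  proof (induction S rule: finite_induct)
    case empty
    obtain q' where "sublinear_functional q'" "\<And>x. q' x \<le> q x" "q' a = q a" "q' (- a) = - q a"
      by (rule sublinear_functional_linearize_at[OF q, of a]) blast
    then show ?case by auto
  next
    case (insert s S)
    then obtain q1 where q1: "sublinear_functional q1" "\<And>x. q1 x \<le> q x" "q1 a = q a"
      "\<And>x. x \<in> insert a S \<Longrightarrow> q1 (- x) = - q1 x" by auto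
    obtain q2 where q2: "sublinear_functional q2" "\<And>x. q2 x \<le> q1 x" "q2 s = q1 s" "q2 (- s) = - q1 s"
      by (rule sublinear_functional_linearize_at[OF q1(1), of s]) blast
    \<comment> \<open>Where \<open>q1\<close> is already odd, the chain
      \<open>- q1 x = q1 (- x) >= q2 (- x) >= - q2 x >= - q1 x\<close> forces equality, so later
      steps preserve earlier values.\<close>
    have keep: "q2 x = q1 x \<and> q2 (- x) = - q2 x" if "x \<in> insert a S" for x
      using q1(4)[OF that] q2(2)[of x] q2(2)[of "- x"] sublinear_functionalD(4)[OF q2(1), of x] by simp
    have "q2 x \<le> q x" for x using q1(2)[of x] q2(2)[of x] by simp
    moreover have "q2 a = q a" using keep[of a] q1(3) by simp
    moreover have "\<forall>x\<in>insert a (insert s S). q2 (- x) = - q2 x"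
      using keep q2(3,4) by auto
    ultimately show ?case using q2(1) by blast
  qed
  then obtain q' where q': "sublinear_functional q'" "\<And>x. q' x \<le> q x" "q' a = q a"
    "\<And>x. x \<in> insert a S \<Longrightarrow> q' (- x) = - q' x" by blast
  note lin = sublinear_functional_linear_on_span[OF q'(1), where S = "insert a S", OF q'(4)]
  obtain \<phi> where \<phi>: "linear \<phi>" "\<And>x. x \<in> span (insert a S) \<Longrightarrow> \<phi> x = q' x"
    using linear_extension_from_subspace[OF subspace_span, of "insert a S" q'] lin
    by (metis real_scaleR_def)
  show thesis
  proof (rule that[OF \<phi>(1)])
    show "\<phi> a = q a" using \<phi>(2)[of a] q'(3) by (simp add: span_base)
  qed (use \<phi>(2) q'(2) in auto)
qed

section \<open>Quotient norms and a rate valid in every normed space\<close>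

lemma infdist_greatest:
  assumes "A \<noteq> {}" "\<And>u. u \<in> A \<Longrightarrow> c \<le> dist x u"
  shows "c \<le> infdist x A"
  using assms by (simp add: infdist_notempty cINF_greatest)

text \<open>This is the norm of the quotient by \<open>U\<close>. A linear functional dominated by
  it has norm at most 1 and vanishes on \<open>U\<close>.\<close>

lemma sublinear_functional_infdist:
  fixes U :: "'a::real_normed_vector set"
  assumes U: "subspace U"
  shows "sublinear_functional (\<lambda>x. infdist x U)"
proof -
  have ne: "U \<noteq> {}" using subspace_0[OF U] by blast
  have add: "infdist (x + y) U \<le> infdist x U + infdist y U" for x y
  proof -
    have *: "infdist (x + y) U \<le> dist x u + dist y v" if "u \<in> U" "v \<in> U" for u v
    proof -
      have "infdist (x + y) U \<le> dist (x + y) (u + v)"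
        using that U by (intro infdist_le subspace_add)
      also have "\<dots> \<le> dist x u + dist y v" by (rule dist_triangle_add)
      finally show ?thesis .
    qed
    have "infdist (x + y) U - dist x u \<le> infdist y U" if "u \<in> U" for u
      by (rule infdist_greatest[OF ne]) (use *[OF that] in \<open>simp add: algebra_simps\<close>)
    then have "infdist (x + y) U - infdist y U \<le> infdist x U"
      by (intro infdist_greatest[OF ne]) (simp add: algebra_simps)
    then show ?thesis by simp
  qed
  have scale_le: "infdist (c *\<^sub>R x) U \<le> c * infdist x U" if c: "c > 0" for c x
  proof -
    have "infdist (c *\<^sub>R x) U / c \<le> infdist x U"
    proof (rule infdist_greatest[OF ne])
      fix u assume u: "u \<in> U"
      have "infdist (c *\<^sub>R x) U \<le> dist (c *\<^sub>R x) (c *\<^sub>R u)"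
        using u U by (intro infdist_le subspace_scale)
      also have "\<dots> = c * dist x u"
        using c by (simp add: dist_norm flip: scaleR_diff_right)
      finally show "infdist (c *\<^sub>R x) U / c \<le> dist x u"
        using c by (simp add: pos_divide_le_eq mult.commute)
    qed
    then show ?thesis using c by (simp add: field_simps)
  qed
  have "infdist (c *\<^sub>R x) U = c * infdist x U" if "c \<ge> 0" for c x
  proof (cases "c = 0")
    case True
    then show ?thesis using subspace_0[OF U] by simp
  next
    case False
    then have c: "c > 0" using that by simp
    have "infdist ((1 / c) *\<^sub>R (c *\<^sub>R x)) U \<le> (1 / c) * infdist (c *\<^sub>R x) U"
      using c by (intro scale_le) simp
    then have "c * infdist x U \<le> infdist (c *\<^sub>R x) U" using c by (simp add: field_simps)
    then show ?thesis using scale_le[OF c, of x] by simp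
  qed
  then show ?thesis using add by (simp add: sublinear_functional_def)
qed

text \<open>The coordinates of \<open>T\<close> are functionals \<open>\<phi> i\<close> of norm \<open>1 / \<surd>n\<close> that vanish on
  \<open>f 0, \<dots>, f (i - 1)\<close> and norm the distance of \<open>f i\<close> to their span.\<close>

proposition greedy_rate_general:
  fixes K :: "'a::real_normed_vector set" and s C\<^sub>2 :: real
  assumes K: "K \<noteq> {}" "K \<subseteq> cball 0 1" and s: "s > 1 / 2" and C: "C\<^sub>2 > 0"
    and width: "\<And>n. n \<ge> 1 \<Longrightarrow> kolmogorov_width K n \<le> C\<^sub>2 * real n powr (- s)"
  shows "\<exists>C>0. \<forall>f. greedy_sequence K f \<longrightarrow> (\<forall>n\<ge>1. greedy_error f n
      \<le> C * real n powr (- s + 1 / 2) * ln (real n + 2) powr min s (1 / 2))"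
proof (rule greedy_rate_of_euclidean_structure[OF K _ C _ width])
  show "s \<ge> 0" "(1::real) > 0" using s by auto
  fix f n and S :: "'a set"
  assume f: "greedy_sequence K f" and n: "n \<ge> 1" and pos: "greedy_error f n > 0"
    and S: "finite S" "f ` {..<n} \<subseteq> S" "card S \<le> 3 * n"
  have "\<exists>\<phi>. linear \<phi> \<and> \<phi> (f i) = infdist (f i) (span (f ` {..<i})) \<and>
      (\<forall>x\<in>span (insert (f i) S). \<phi> x \<le> infdist x (span (f ` {..<i})))" for i
    by (rule exists_dominated_functional[OF sublinear_functional_infdist[OF subspace_span] S(1)]) blast
  then obtain \<phi> where \<phi>: "\<And>i. linear (\<phi> i)" "\<And>i. \<phi> i (f i) = infdist (f i) (span (f ` {..<i}))"
    "\<And>i x. x \<in> span (insert (f i) S) \<Longrightarrow> \<phi> i x \<le> infdist x (span (f ` {..<i}))"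
    by metis
  have fi: "insert (f i) S = S" if "i < n" for i using S(2) that by auto
  have abs: "\<bar>\<phi> i x\<bar> \<le> infdist x (span (f ` {..<i}))" if "i < n" "x \<in> span S" for i x
  proof -
    have "- x \<in> span S" using that span_neg by blast
    then have "\<phi> i (- x) \<le> infdist (- x) (span (f ` {..<i}))" using \<phi>(3)[of "- x" i] fi[OF that(1)] by simp
    moreover have "infdist (- x) (span (f ` {..<i})) = infdist x (span (f ` {..<i}))"
    proof (rule antisym)
      show "infdist (- x) (span (f ` {..<i})) \<le> infdist x (span (f ` {..<i}))" for x
      proof (rule infdist_greatest)
        fix u assume "u \<in> span (f ` {..<i})"
        then have "infdist (- x) (span (f ` {..<i})) \<le> dist (- x) (- u)"
          by (intro infdist_le span_neg)
        then show "infdist (- x) (span (f ` {..<i})) \<le> dist x u" by (simp add: dist_minus)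
      qed (use span_zero in blast)
      from this[of "- x"] show "infdist x (span (f ` {..<i})) \<le> infdist (- x) (span (f ` {..<i}))" by simp
    qed
    ultimately show ?thesis
      using \<phi>(3)[of x i] fi[OF that(1)] that(2) linear_neg[OF \<phi>(1)[of i], of x] by (simp add: abs_le_iff)
  qed
  define T where "T x = ell2_of n (\<lambda>i. (1 / sqrt (real n)) * \<phi> i x)" for x
  have lin: "linear T"
  proof (rule linearI)
    show "T (x + y) = T x + T y" for x y
      unfolding T_def ell2_of_add[symmetric] by (simp add: linear_add[OF \<phi>(1)] algebra_simps add_divide_distrib)
    show "T (c *\<^sub>R x) = c *\<^sub>R T x" for c x
      unfolding T_def ell2_of_scaleR[symmetric] by (simp add: linear_scale[OF \<phi>(1)])
  qed
  have normT: "(norm (T x))\<^sup>2 = (\<Sum>i<n. (\<phi> i x)\<^sup>2) / real n" for x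
    using n by (simp add: T_def norm_ell2_of power_divide sum_divide_distrib)
  show "\<exists>T :: 'a \<Rightarrow> ell2. linear T \<and> (\<forall>x\<in>span S. norm (T x) \<le> norm x) \<and>
      (\<forall>i<n. \<forall>v\<in>span (f ` {..<i}). greedy_error f n \<le> 1 * real n powr (1 / 2) * norm (T (f i - v)))"
  proof (intro exI[of _ T] conjI ballI allI impI lin)
    fix x assume x: "x \<in> span S"
    have "(\<Sum>i<n. (\<phi> i x)\<^sup>2) \<le> (\<Sum>i<n. (norm x)\<^sup>2)"
    proof (rule sum_mono)
      fix i assume "i \<in> {..<n}"
      then have "\<bar>\<phi> i x\<bar> \<le> infdist x (span (f ` {..<i}))" using abs x by simp
      also have "\<dots> \<le> dist x 0" by (intro infdist_le span_zero)
      finally show "(\<phi> i x)\<^sup>2 \<le> (norm x)\<^sup>2" by (simp add: dist_norm abs_le_square_iff[symmetric])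
    qed
    then have "(norm (T x))\<^sup>2 \<le> (norm x)\<^sup>2" using n by (simp add: normT field_simps)
    then show "norm (T x) \<le> norm x" by (rule power2_le_imp_le) simp
  next
    fix i v assume i: "i < n" and v: "v \<in> span (f ` {..<i})"
    have "f ` {..<i} \<subseteq> S" using S(2) i by auto
    then have vS: "v \<in> span S" using v span_mono by blast
    have "\<bar>\<phi> i v\<bar> \<le> infdist v (span (f ` {..<i}))" by (rule abs[OF i vS])
    then have \<phi>v: "\<phi> i v = 0" using v by simp
    have "greedy_error f n \<le> infdist (f i) (span (f ` {..<i}))"
    proof (rule infdist_greatest)
      show "greedy_error f n \<le> dist (f i) u" if "u \<in> span (f ` {..<i})" for u
        using greedy_error_le_norm[OF f n _ that] i by (simp add: dist_norm)
    qed (use span_zero in blast)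
    \<comment> \<open>Of the \<open>n\<close> coordinates only the \<open>i\<close>-th is known to
      see \<open>f i - v\<close>; hence the full factor \<open>sqrt n\<close> is lost.\<close>
    then have "(greedy_error f n)\<^sup>2 \<le> (\<phi> i (f i - v))\<^sup>2"
      using pos \<phi>v by (intro power_mono) (auto simp: linear_diff[OF \<phi>(1)] \<phi>(2))
    also have "\<dots> \<le> (\<Sum>j<n. (\<phi> j (f i - v))\<^sup>2)"
      using i by (intro member_le_sum) auto
    also have "\<dots> = real n * (norm (T (f i - v)))\<^sup>2" using n by (simp add: normT)
    also have "\<dots> = (real n powr (1 / 2) * norm (T (f i - v)))\<^sup>2"
      by (simp add: power_mult_distrib powr_half_sqrt)
    finally have "greedy_error f n \<le> real n powr (1 / 2) * norm (T (f i - v))"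
      by (rule power2_le_imp_le) simp
    then show "greedy_error f n \<le> 1 * real n powr (1 / 2) * norm (T (f i - v))" by simp
  qed
qed

section \<open>Weighted Euclidean structures on Lebesgue spaces\<close>

text \<open>Compact balls make \<open>span S\<close> closed, so a new vector \<open>a\<close> has
  positive distance \<open>d\<close> to it. This bounds the coefficient of \<open>a\<close> by
  \<open>r / d\<close>, and the remainder lies in a larger ball of \<open>span S\<close>, which is
  why the radius is arbitrary in the induction.\<close>

lemma compact_span_Int_cball:
  fixes S :: "'a::real_normed_vector set"
  assumes "finite S"
  shows "compact (span S \<inter> cball 0 r)"
  using assms
proof (induction S arbitrary: r rule: finite_induct)
  case empty
  have "span {} \<inter> cball (0::'a) r \<subseteq> {0}" by auto
  then show ?case by (meson finite.emptyI finite.insertI finite_imp_compact finite_subset)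
next
  case (insert a S)
  show ?case
  proof (cases "a \<in> span S")
    case True
    then have "span (insert a S) = span S" by (rule span_redundant)
    then show ?thesis using insert.IH by simp
  next
    case False
    have "closed (span S)"
      unfolding closed_sequential_limits
    proof (intro allI impI, elim conjE)
      fix y l assume y: "\<forall>n. y n \<in> span S" "y \<longlonglongrightarrow> l"
      obtain B where "\<And>n. norm (y n) \<le> B"
        using Bseq_eq_bounded[of y] convergent_imp_bounded[OF y(2)] y(2)
        by (metis bounded_iff rangeI)
      then have "\<forall>n. y n \<in> span S \<inter> cball 0 B" using y(1) by simp
      moreover have "closed (span S \<inter> cball 0 B)" using insert.IH by (rule compact_imp_closed)
      ultimately have "l \<in> span S \<inter> cball 0 B"
        using y(2) closed_sequentially by blast
      then show "l \<in> span S" by simp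
    qed
    then have d: "infdist a (span S) > 0"
      using False span_zero by (intro infdist_pos_not_in_closed) auto
    define d where "d = infdist a (span S)"
    define g where "g = (\<lambda>(k, y). k *\<^sub>R a + y)"
    define A where "A = {- (r / d)..r / d} \<times> (span S \<inter> cball 0 (r + r / d * norm a))"
    have "continuous_on A g"
      unfolding g_def case_prod_beta by (intro continuous_intros)
    moreover have "compact A"
      unfolding A_def by (intro compact_Times compact_Icc insert.IH)
    ultimately have "compact (g ` A \<inter> cball 0 r)"
      by (intro compact_Int_closed compact_continuous_image closed_cball)
    also have "g ` A \<inter> cball 0 r = span (insert a S) \<inter> cball 0 r"
    proof (intro equalityI subsetI)
      fix x assume "x \<in> g ` A \<inter> cball 0 r"
      then obtain k y where "x = k *\<^sub>R a + y" "y \<in> span S" "norm x \<le> r"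
        by (auto simp: g_def A_def)
      then show "x \<in> span (insert a S) \<inter> cball 0 r"
        by (auto simp: span_insert intro!: exI[of _ k])
    next
      fix x assume x: "x \<in> span (insert a S) \<inter> cball 0 r"
      then obtain k where k: "x - k *\<^sub>R a \<in> span S" by (auto simp: span_insert)
      have nx: "norm x \<le> r" using x by simp
      have "\<bar>k\<bar> * d \<le> norm x"
      proof (cases "k = 0")
        case False
        have "- ((1 / k) *\<^sub>R (x - k *\<^sub>R a)) \<in> span S" using k by (intro span_neg span_scale)
        then have "d \<le> dist a (- ((1 / k) *\<^sub>R (x - k *\<^sub>R a)))" unfolding d_def by (rule infdist_le)
        also have "\<dots> = norm ((1 / k) *\<^sub>R x)" using False by (simp add: dist_norm algebra_simps)
        finally show ?thesis using False by (simp add: field_simps)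
      qed simp
      then have kr: "\<bar>k\<bar> \<le> r / d" using d nx by (simp add: d_def pos_le_divide_eq)
      have "norm (x - k *\<^sub>R a) \<le> norm x + \<bar>k\<bar> * norm a"
        using norm_triangle_ineq4[of x "k *\<^sub>R a"] by simp
      also have "\<dots> \<le> r + r / d * norm a" using nx kr by (intro add_mono mult_right_mono) auto
      finally have "(k, x - k *\<^sub>R a) \<in> A" using kr k by (auto simp: A_def abs_le_iff)
      moreover have "x = g (k, x - k *\<^sub>R a)" by (simp add: g_def)
      ultimately show "x \<in> g ` A \<inter> cball 0 r" using nx by auto
    qed
    finally show ?thesis .
  qed
qed

text \<open>Points of norm above \<open>2 * norm x\<close> are no better than 0, so the minimum over
  a compact ball is global.\<close>

lemma exists_nearest_point_span:
  fixes S :: "'a::real_normed_vector set"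
  assumes "finite S"
  obtains v where "v \<in> span S" "\<And>u. u \<in> span S \<Longrightarrow> norm (x - v) \<le> norm (x - u)"
proof -
  have "continuous_on (span S \<inter> cball 0 (2 * norm x)) (\<lambda>u. norm (x - u))"
    by (intro continuous_intros)
  moreover have "span S \<inter> cball 0 (2 * norm x) \<noteq> {}" using span_zero by force
  ultimately obtain v where v: "v \<in> span S \<inter> cball 0 (2 * norm x)"
    "\<And>u. u \<in> span S \<inter> cball 0 (2 * norm x) \<Longrightarrow> norm (x - v) \<le> norm (x - u)"
    using continuous_attains_inf[OF compact_span_Int_cball[OF assms]] by blast
  show thesis
  proof (rule that)
    fix u assume u: "u \<in> span S"
    show "norm (x - v) \<le> norm (x - u)"
    proof (cases "norm u \<le> 2 * norm x")
      case True
      then show ?thesis using v(2)[of u] u by simp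
    next
      case False
      have "norm (x - v) \<le> norm x" using v(2)[of 0] by (simp add: span_zero)
      also have "\<dots> \<le> norm u - norm x" using False by simp
      also have "\<dots> \<le> norm (x - u)" by (metis norm_minus_commute norm_triangle_ineq2)
      finally show ?thesis .
    qed
  qed (use v in auto)
qed

text \<open>At \<open>u = 0\<close> or \<open>v = 0\<close> the left side is 0 for every exponent,
  since \<open>0 powr 0 = 0\<close>.\<close>

lemma Youngs_inequality_nonneg:
  fixes u v \<theta> :: real
  assumes "0 \<le> \<theta>" "\<theta> \<le> 1" "u \<ge> 0" "v \<ge> 0"
  shows "u powr \<theta> * v powr (1 - \<theta>) \<le> \<theta> * u + (1 - \<theta>) * v"
proof (cases "u = 0 \<or> v = 0")
  case True
  then show ?thesis using assms by auto
next
  case False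
  then show ?thesis using assms by (intro Youngs_inequality_0) auto
qed

text \<open>The finite exponents, with \<open>p\<close> a real number and the norm given through its
  \<open>p\<close>-th power. \<open>\<Phi>\<close> is linear only almost everywhere, with an
  exceptional set that depends on the vectors.\<close>

locale Lp_representation =
  fixes M :: "'b measure" and \<Phi> :: "'a::real_normed_vector \<Rightarrow> 'b \<Rightarrow> real" and p :: real
  assumes p_ge_1: "p \<ge> 1"
    and measurable_rep [measurable]: "\<And>x. \<Phi> x \<in> borel_measurable M"
    and integrable_powr: "\<And>x. integrable M (\<lambda>t. \<bar>\<Phi> x t\<bar> powr p)"
    and rep_add: "\<And>x y. AE t in M. \<Phi> (x + y) t = \<Phi> x t + \<Phi> y t"
    and rep_scaleR: "\<And>c x. AE t in M. \<Phi> (c *\<^sub>R x) t = c * \<Phi> x t"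
    and norm_powr: "\<And>x. norm x powr p = (\<integral>t. \<bar>\<Phi> x t\<bar> powr p \<partial>M)"

lemma is_Lp_space_imp_representation:
  assumes "is_Lp_space p M \<Phi>" "1 \<le> p" "p \<noteq> \<infinity>"
  shows "Lp_representation M \<Phi> (enn2real p)"
proof
  have p: "enn2real p \<ge> 1"
    using assms(2,3) enn2real_mono[of 1 p] by (simp add: top.not_eq_extremum)
  then show "1 \<le> enn2real p" .
  fix x
  show "\<Phi> x \<in> borel_measurable M" "integrable M (\<lambda>t. \<bar>\<Phi> x t\<bar> powr enn2real p)"
    using assms by (auto simp: is_Lp_space_def Lp_functions_def)
  have "norm x = (\<integral>t. \<bar>\<Phi> x t\<bar> powr enn2real p \<partial>M) powr (1 / enn2real p)"
    using assms by (simp add: is_Lp_space_def Lp_norm_def)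
  then show "norm x powr enn2real p = (\<integral>t. \<bar>\<Phi> x t\<bar> powr enn2real p \<partial>M)"
    using p by (simp add: powr_powr integral_nonneg_AE)
qed (use assms in \<open>auto simp: is_Lp_space_def\<close>)

context Lp_representation
begin

lemma rep_zero: "AE t in M. \<Phi> 0 t = 0"
  using rep_scaleR[of 0 0] by simp

lemma rep_sum:
  assumes "finite J"
  shows "AE t in M. \<Phi> (\<Sum>j\<in>J. c j *\<^sub>R x j) t = (\<Sum>j\<in>J. c j * \<Phi> (x j) t)"
  using assms
proof (induction J rule: finite_induct)
  case empty
  then show ?case using rep_zero by simp
next
  case (insert j J)
  show ?case
    using insert.IH rep_add[of "c j *\<^sub>R x j" "\<Sum>j\<in>J. c j *\<^sub>R x j"] rep_scaleR[of "c j" "x j"]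
  proof eventually_elim
    case (elim t)
    then show ?case using insert.hyps by simp
  qed
qed

text \<open>Hoelder's inequality as an integrated Young inequality with weights \<open>2 / p\<close>
  and \<open>1 - 2 / p\<close>. The scale \<open>r\<close> is free: \<open>r = 1\<close> gives
  integrability, \<open>r = norm x\<close> the norm bound. For \<open>p = 2\<close> the weight is
  the indicator of \<open>G t \<noteq> 0\<close>, since \<open>0 powr 0 = 0\<close>.\<close>

lemma integrable_weighted_square:
  assumes p: "p \<ge> 2" and G [measurable]: "G \<in> borel_measurable M" and "\<And>t. G t \<ge> 0"
    and int: "integrable M (\<lambda>t. G t powr p)"
  shows "integrable M (\<lambda>t. (\<Phi> x t)\<^sup>2 * G t powr (p - 2))"
    and "integral\<^sup>L M (\<lambda>t. G t powr p) \<le> 1 \<Longrightarrow> (\<integral>t. (\<Phi> x t)\<^sup>2 * G t powr (p - 2) \<partial>M) \<le> (norm x)\<^sup>2"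
proof -
  have *: "(\<Phi> x t)\<^sup>2 * G t powr (p - 2) \<le> r\<^sup>2 * (2 / p * (\<bar>\<Phi> x t\<bar> powr p / r powr p) + (1 - 2 / p) * G t powr p)"
    if r: "r > 0" for r t
  proof -
    have "(\<bar>\<Phi> x t\<bar> powr p / r powr p) powr (2 / p) * (G t powr p) powr (1 - 2 / p)
        \<le> 2 / p * (\<bar>\<Phi> x t\<bar> powr p / r powr p) + (1 - 2 / p) * G t powr p"
      by (rule Youngs_inequality_nonneg) (use p r in auto)
    moreover have "(\<bar>\<Phi> x t\<bar> powr p / r powr p) powr (2 / p) = (\<Phi> x t)\<^sup>2 / r\<^sup>2"
      using p r by (simp add: powr_divide powr_powr)
    moreover have "(G t powr p) powr (1 - 2 / p) = G t powr (p - 2)"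
      using p by (simp add: powr_powr right_diff_distrib)
    ultimately show ?thesis using r by (simp add: field_simps)
  qed
  have intr: "integrable M (\<lambda>t. r\<^sup>2 * (2 / p * (\<bar>\<Phi> x t\<bar> powr p / r powr p) + (1 - 2 / p) * G t powr p))" for r
    by (intro Bochner_Integration.integrable_mult_right Bochner_Integration.integrable_add Bochner_Integration.integrable_divide integrable_powr int)
  show 1: "integrable M (\<lambda>t. (\<Phi> x t)\<^sup>2 * G t powr (p - 2))"
    by (rule Bochner_Integration.integrable_bound[OF intr[of 1]]) (use *[of 1] p in \<open>auto intro!: AE_I2 simp: abs_mult\<close>)
  show "(\<integral>t. (\<Phi> x t)\<^sup>2 * G t powr (p - 2) \<partial>M) \<le> (norm x)\<^sup>2" if le1: "integral\<^sup>L M (\<lambda>t. G t powr p) \<le> 1"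
  proof (cases "x = 0")
    case True
    have "(\<integral>t. (\<Phi> x t)\<^sup>2 * G t powr (p - 2) \<partial>M) = (\<integral>t. 0 \<partial>M)"
      by (rule integral_cong_AE) (use rep_zero True in auto)
    then show ?thesis by simp
  next
    case False
    define r where "r = norm x"
    have r: "r > 0" using False by (simp add: r_def)
    have "(\<integral>t. (\<Phi> x t)\<^sup>2 * G t powr (p - 2) \<partial>M)
        \<le> (\<integral>t. r\<^sup>2 * (2 / p * (\<bar>\<Phi> x t\<bar> powr p / r powr p) + (1 - 2 / p) * G t powr p) \<partial>M)"
      by (rule integral_mono[OF 1 intr]) (rule *[OF r])
    also have "\<dots> = r\<^sup>2 * (2 / p * ((\<integral>t. \<bar>\<Phi> x t\<bar> powr p \<partial>M) / r powr p) + (1 - 2 / p) * (\<integral>t. G t powr p \<partial>M))"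
      using int integrable_powr by simp
    also have "\<dots> \<le> r\<^sup>2 * (2 / p * 1 + (1 - 2 / p) * 1)"
      using le1 p r norm_powr[of x, symmetric] unfolding r_def[symmetric]
      by (intro mult_left_mono add_mono) auto
    finally show ?thesis by (simp add: r_def)
  qed
qed

lemma weighted_form_bilinear:
  fixes V :: "'a set"
  assumes V: "subspace V" and w [measurable]: "w \<in> borel_measurable M" and w0: "\<And>t. w t \<ge> 0"
    and int: "\<And>x. x \<in> V \<Longrightarrow> integrable M (\<lambda>t. (\<Phi> x t)\<^sup>2 * w t)"
  defines "B \<equiv> \<lambda>x y. \<integral>t. \<Phi> x t * \<Phi> y t * w t \<partial>M"
  shows "B x y = B y x"
    and "x \<in> V \<Longrightarrow> y \<in> V \<Longrightarrow> z \<in> V \<Longrightarrow> B (x + y) z = B x z + B y z"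
    and "x \<in> V \<Longrightarrow> z \<in> V \<Longrightarrow> B (c *\<^sub>R x) z = c * B x z"
    and "B x x \<ge> 0"
proof -
  have int2: "integrable M (\<lambda>t. \<Phi> x t * \<Phi> y t * w t)" if "x \<in> V" "y \<in> V" for x y
  proof (rule Bochner_Integration.integrable_bound)
    show "integrable M (\<lambda>t. (\<Phi> x t)\<^sup>2 * w t + (\<Phi> y t)\<^sup>2 * w t)"
      using that by (intro Bochner_Integration.integrable_add int)
    show "AE t in M. norm (\<Phi> x t * \<Phi> y t * w t) \<le> norm ((\<Phi> x t)\<^sup>2 * w t + (\<Phi> y t)\<^sup>2 * w t)"
    proof (rule AE_I2)
      fix t
      have "\<bar>\<Phi> x t * \<Phi> y t\<bar> \<le> (\<Phi> x t)\<^sup>2 + (\<Phi> y t)\<^sup>2"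
        using sum_squares_bound[of "\<bar>\<Phi> x t\<bar>" "\<bar>\<Phi> y t\<bar>"]
          mult_nonneg_nonneg[OF abs_ge_zero[of "\<Phi> x t"] abs_ge_zero[of "\<Phi> y t"]]
        unfolding abs_mult power2_abs by linarith
      then have "\<bar>\<Phi> x t * \<Phi> y t\<bar> * w t \<le> ((\<Phi> x t)\<^sup>2 + (\<Phi> y t)\<^sup>2) * w t"
        using w0 by (rule mult_right_mono)
      then show "norm (\<Phi> x t * \<Phi> y t * w t) \<le> norm ((\<Phi> x t)\<^sup>2 * w t + (\<Phi> y t)\<^sup>2 * w t)"
        using w0[of t] by (simp add: abs_mult distrib_right)
    qed
  qed simp
  show "B x y = B y x" by (simp add: B_def mult_ac)
  show "B x x \<ge> 0" unfolding B_def using w0 by (intro integral_nonneg_AE) auto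
  show "B (x + y) z = B x z + B y z" if "x \<in> V" "y \<in> V" "z \<in> V"
  proof -
    have "B (x + y) z = (\<integral>t. \<Phi> x t * \<Phi> z t * w t + \<Phi> y t * \<Phi> z t * w t \<partial>M)"
      unfolding B_def
    proof (rule integral_cong_AE)
      show "AE t in M. \<Phi> (x + y) t * \<Phi> z t * w t = \<Phi> x t * \<Phi> z t * w t + \<Phi> y t * \<Phi> z t * w t"
        using rep_add[of x y] by eventually_elim (simp add: algebra_simps)
    qed simp_all
    then show ?thesis unfolding B_def using int2 that by simp
  qed
  show "B (c *\<^sub>R x) z = c * B x z" if "x \<in> V" "z \<in> V"
  proof -
    have "B (c *\<^sub>R x) z = (\<integral>t. c * (\<Phi> x t * \<Phi> z t * w t) \<partial>M)"
      unfolding B_def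
    proof (rule integral_cong_AE)
      show "AE t in M. \<Phi> (c *\<^sub>R x) t * \<Phi> z t * w t = c * (\<Phi> x t * \<Phi> z t * w t)"
        using rep_scaleR[of c x] by eventually_elim simp
    qed simp_all
    then show ?thesis unfolding B_def by simp
  qed
qed

section \<open>Best approximation and the rate for \<open>2 <= p < \<infinity>\<close>\<close>

text \<open>The gradient of \<open>\<parallel>\<cdot>\<parallel>\<^sup>p\<close> at \<open>x + \<epsilon> v\<close> is nonnegative in direction \<open>v\<close>, by Young's inequality;
  then \<open>\<epsilon> \<rightarrow> 0\<close>.\<close>

lemma norm_minimal_imp_gradient_nonneg:
  assumes p: "p \<ge> 2" and min: "\<And>\<epsilon>. norm x \<le> norm (x + \<epsilon> *\<^sub>R v)"
  shows "integrable M (\<lambda>t. \<bar>\<Phi> x t\<bar> powr (p - 2) * \<Phi> x t * \<Phi> v t)"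
    and "(\<integral>t. \<bar>\<Phi> x t\<bar> powr (p - 2) * \<Phi> x t * \<Phi> v t \<partial>M) \<ge> 0"
proof -
  \<comment> \<open>The derivative of \<open>|u|^p / p\<close>.\<close>
  define \<psi> where "\<psi> u = \<bar>u\<bar> powr (p - 2) * u" for u :: real
  have abs_\<psi>: "\<bar>\<psi> u\<bar> = \<bar>u\<bar> powr (p - 1)" for u
  proof (cases "u = 0")
    case False
    then show ?thesis
      using powr_add[of "\<bar>u\<bar>" "p - 2" 1] by (simp add: \<psi>_def abs_mult)
  qed (simp add: \<psi>_def)
  have \<psi>_self: "\<psi> u * u = \<bar>u\<bar> powr p" for u
  proof (cases "u = 0")
    case False
    then show ?thesis
      using powr_add[of "\<bar>u\<bar>" "p - 2" 2] by (simp add: \<psi>_def power2_eq_square mult.assoc)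
  qed (use p in \<open>simp add: \<psi>_def\<close>)
  have cont: "isCont \<psi> u" for u
  proof (cases "u = 0")
    case True
    have "((\<lambda>h. \<bar>h\<bar> powr (p - 1)) \<longlongrightarrow> \<bar>0\<bar> powr (p - 1)) (at 0)"
      using p by (intro tendsto_intros) auto
    then have "((\<lambda>h. \<bar>\<psi> h\<bar>) \<longlongrightarrow> 0) (at 0)" using p by (simp add: abs_\<psi>)
    then have "(\<psi> \<longlongrightarrow> 0) (at 0)" by (rule tendsto_rabs_zero_cancel)
    moreover have "\<psi> 0 = 0" by (simp add: \<psi>_def)
    ultimately show ?thesis using True by (simp add: isCont_def)
  next
    case False
    then show ?thesis unfolding \<psi>_def by (intro continuous_intros) auto
  qed
  \<comment> \<open>Convexity of \<open>|u|^p\<close>: the graph lies above its tangent at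
    \<open>u\<close>.\<close>
  have tangent: "p * (\<psi> u * (y - u)) \<le> \<bar>y\<bar> powr p - \<bar>u\<bar> powr p" for u y
  proof -
    have "\<psi> u * y \<le> \<bar>\<psi> u\<bar> * \<bar>y\<bar>" by (metis abs_ge_self abs_mult)
    also have "\<dots> = (\<bar>y\<bar> powr p) powr (1 / p) * (\<bar>u\<bar> powr p) powr (1 - 1 / p)"
      using p by (simp add: abs_\<psi> powr_powr right_diff_distrib mult.commute)
    also have "\<dots> \<le> 1 / p * \<bar>y\<bar> powr p + (1 - 1 / p) * \<bar>u\<bar> powr p"
      using p by (intro Youngs_inequality_nonneg) auto
    finally have "p * (\<psi> u * y) \<le> p * (1 / p * \<bar>y\<bar> powr p + (1 - 1 / p) * \<bar>u\<bar> powr p)"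
      using p by (intro mult_left_mono) auto
    also have "\<dots> = \<bar>y\<bar> powr p + (p - 1) * \<bar>u\<bar> powr p" using p by (simp add: field_simps)
    finally show ?thesis using \<psi>_self[of u] by (simp add: algebra_simps)
  qed
  \<comment> \<open>\<open>g\<close> combines two fixed representatives instead of using
    \<open>\<Phi> (x + \<epsilon> *\<^sub>R v)\<close>, so its convergence as
    \<open>\<epsilon>\<close> tends to 0 is pointwise everywhere.\<close>
  define g where "g \<epsilon> t = \<psi> (\<Phi> x t + \<epsilon> * \<Phi> v t) * \<Phi> v t" for \<epsilon> t
  \<comment> \<open>A majorant independent of \<open>\<epsilon>\<close>, from
    \<open>(a + b)^p <= (2 * max a b)^p\<close>.\<close>
  define D where "D t = 2 powr p * (\<bar>\<Phi> x t\<bar> powr p + \<bar>\<Phi> v t\<bar> powr p)" for t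
  have g_meas [measurable]: "g \<epsilon> \<in> borel_measurable M" for \<epsilon>
    unfolding g_def \<psi>_def by measurable
  have D_int: "integrable M D"
    unfolding D_def by (intro Bochner_Integration.integrable_mult_right Bochner_Integration.integrable_add integrable_powr)
  have g_bound: "\<bar>g \<epsilon> t\<bar> \<le> D t" if "0 \<le> \<epsilon>" "\<epsilon> \<le> 1" for \<epsilon> t
  proof -
    let ?a = "\<bar>\<Phi> x t\<bar>" and ?b = "\<bar>\<Phi> v t\<bar>"
    have "\<bar>\<Phi> x t + \<epsilon> * \<Phi> v t\<bar> \<le> ?a + \<epsilon> * ?b"
      using abs_triangle_ineq[of "\<Phi> x t" "\<epsilon> * \<Phi> v t"] that by (simp add: abs_mult)
    also have "\<dots> \<le> ?a + 1 * ?b" using that by (intro add_left_mono mult_right_mono) auto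
    finally have "\<bar>g \<epsilon> t\<bar> \<le> (?a + ?b) powr (p - 1) * (?a + ?b)"
      using p by (auto simp: g_def abs_mult abs_\<psi> intro!: mult_mono powr_mono2)
    also have "\<dots> = (?a + ?b) powr p"
      using p by (cases "?a + ?b = 0") (auto simp: powr_diff)
    also have "\<dots> \<le> (2 * max ?a ?b) powr p" using p by (intro powr_mono2) auto
    also have "\<dots> = 2 powr p * max ?a ?b powr p" by (simp add: powr_mult)
    also have "\<dots> \<le> D t" unfolding D_def by (intro mult_left_mono) (auto simp: max_def)
    finally show ?thesis .
  qed
  have g_int: "integrable M (g \<epsilon>)" if "0 \<le> \<epsilon>" "\<epsilon> \<le> 1" for \<epsilon>
    by (rule Bochner_Integration.integrable_bound[OF D_int g_meas])
      (use order_trans[OF g_bound[OF that] abs_ge_self] in \<open>auto intro!: AE_I2\<close>)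
  \<comment> \<open>The tangent is taken at \<open>x + \<epsilon> v\<close>, not at
    \<open>x\<close>: there convexity bounds the increment of the \<open>p\<close>-th power from
    above by the gradient.\<close>
  have nonneg: "integral\<^sup>L M (g \<epsilon>) \<ge> 0" if \<epsilon>: "0 < \<epsilon>" "\<epsilon> \<le> 1" for \<epsilon>
  proof -
    have "0 \<le> norm (x + \<epsilon> *\<^sub>R v) powr p - norm x powr p"
      using p min[of \<epsilon>] by (simp add: powr_mono2)
    also have "\<dots> = (\<integral>t. \<bar>\<Phi> (x + \<epsilon> *\<^sub>R v) t\<bar> powr p - \<bar>\<Phi> x t\<bar> powr p \<partial>M)"
      using integrable_powr by (simp add: norm_powr)
    also have "\<dots> \<le> (\<integral>t. p * \<epsilon> * g \<epsilon> t \<partial>M)"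
    proof (rule integral_mono_AE)
      show "AE t in M. \<bar>\<Phi> (x + \<epsilon> *\<^sub>R v) t\<bar> powr p - \<bar>\<Phi> x t\<bar> powr p \<le> p * \<epsilon> * g \<epsilon> t"
        using rep_add[of x "\<epsilon> *\<^sub>R v"] rep_scaleR[of \<epsilon> v]
      proof eventually_elim
        case (elim t)
        then have "\<Phi> (x + \<epsilon> *\<^sub>R v) t = \<Phi> x t + \<epsilon> * \<Phi> v t" by simp
        then show ?case
          using tangent[of "\<Phi> x t + \<epsilon> * \<Phi> v t" "\<Phi> x t"] by (simp add: g_def algebra_simps)
      qed
      show "integrable M (\<lambda>t. p * \<epsilon> * g \<epsilon> t)" using g_int[of \<epsilon>] \<epsilon> by simp
    qed (simp add: integrable_powr)
    finally have "0 \<le> p * \<epsilon> * integral\<^sup>L M (g \<epsilon>)" by simp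
    moreover have "p * \<epsilon> > 0" using p \<epsilon> by simp
    ultimately show ?thesis using mult_pos_neg[of "p * \<epsilon>" "integral\<^sup>L M (g \<epsilon>)"] by linarith
  qed
  have g0: "g 0 = (\<lambda>t. \<bar>\<Phi> x t\<bar> powr (p - 2) * \<Phi> x t * \<Phi> v t)"
    by (simp add: g_def \<psi>_def fun_eq_iff)
  show "integrable M (\<lambda>t. \<bar>\<Phi> x t\<bar> powr (p - 2) * \<Phi> x t * \<Phi> v t)"
    using g_int[of 0] g0 by simp
  have "(\<lambda>k. integral\<^sup>L M (g (1 / real (Suc k)))) \<longlonglongrightarrow> integral\<^sup>L M (g 0)"
  proof (rule integral_dominated_convergence[OF _ _ D_int])
    show "AE t in M. (\<lambda>k. g (1 / real (Suc k)) t) \<longlonglongrightarrow> g 0 t"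
    proof (rule AE_I2)
      fix t
      have "(\<lambda>k. \<Phi> x t + 1 / real (Suc k) * \<Phi> v t) \<longlonglongrightarrow> \<Phi> x t + 0 * \<Phi> v t"
        by (intro tendsto_intros LIMSEQ_Suc[OF lim_1_over_n])
      then have "(\<lambda>k. \<psi> (\<Phi> x t + 1 / real (Suc k) * \<Phi> v t)) \<longlonglongrightarrow> \<psi> (\<Phi> x t + 0 * \<Phi> v t)"
        by (rule isCont_tendsto_compose[OF cont])
      then show "(\<lambda>k. g (1 / real (Suc k)) t) \<longlonglongrightarrow> g 0 t"
        unfolding g_def by (rule tendsto_mult_right)
    qed
    show "AE t in M. norm (g (1 / real (Suc k)) t) \<le> D t" for k
      using g_bound[of "1 / real (Suc k)"] by (auto intro!: AE_I2)
  qed simp_all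
  then have "integral\<^sup>L M (g 0) \<ge> 0"
    by (rule LIMSEQ_le_const) (auto intro!: exI[of _ 0] nonneg)
  then show "(\<integral>t. \<bar>\<Phi> x t\<bar> powr (p - 2) * \<Phi> x t * \<Phi> v t \<partial>M) \<ge> 0"
    by (simp add: g0)
qed

text \<open>A best approximation in \<open>L\<^sub>p\<close> is also one in \<open>L\<^sub>2\<close> with weight \<open>\<bar>x\<bar>\<^sup>p\<^sup>-\<^sup>2\<close>.\<close>

lemma norm_minimal_imp_weighted_ge:
  assumes p: "p \<ge> 2" and min: "\<And>\<epsilon>. norm x \<le> norm (x + \<epsilon> *\<^sub>R v)"
  shows "norm x powr p \<le> (\<integral>t. (\<Phi> (x + v) t)\<^sup>2 * \<bar>\<Phi> x t\<bar> powr (p - 2) \<partial>M)"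
proof -
  note grad = norm_minimal_imp_gradient_nonneg[OF p min]
  \<comment> \<open>Expanding \<open>(x + v)^2\<close> under the weight gives \<open>|x|^p\<close>,
    twice the gradient term, and the nonnegative term with \<open>v^2\<close>, which is
    dropped.\<close>
  have "norm x powr p \<le> norm x powr p + 2 * (\<integral>t. \<bar>\<Phi> x t\<bar> powr (p - 2) * \<Phi> x t * \<Phi> v t \<partial>M)"
    using grad(2) by simp
  also have "\<dots> = (\<integral>t. \<bar>\<Phi> x t\<bar> powr p + 2 * (\<bar>\<Phi> x t\<bar> powr (p - 2) * \<Phi> x t * \<Phi> v t) \<partial>M)"
    using grad(1) integrable_powr by (simp add: norm_powr)
  also have "\<dots> \<le> (\<integral>t. (\<Phi> (x + v) t)\<^sup>2 * \<bar>\<Phi> x t\<bar> powr (p - 2) \<partial>M)"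
  proof (rule integral_mono_AE)
    show "integrable M (\<lambda>t. (\<Phi> (x + v) t)\<^sup>2 * \<bar>\<Phi> x t\<bar> powr (p - 2))"
      by (rule integrable_weighted_square(1)[OF p]) (auto simp: integrable_powr)
    show "integrable M (\<lambda>t. \<bar>\<Phi> x t\<bar> powr p + 2 * (\<bar>\<Phi> x t\<bar> powr (p - 2) * \<Phi> x t * \<Phi> v t))"
      using grad(1) integrable_powr by simp
    show "AE t in M. \<bar>\<Phi> x t\<bar> powr p + 2 * (\<bar>\<Phi> x t\<bar> powr (p - 2) * \<Phi> x t * \<Phi> v t)
        \<le> (\<Phi> (x + v) t)\<^sup>2 * \<bar>\<Phi> x t\<bar> powr (p - 2)"
      using rep_add[of x v]
    proof eventually_elim
      case (elim t)
      have "\<bar>\<Phi> x t\<bar> powr p = \<bar>\<Phi> x t\<bar> powr (p - 2) * (\<Phi> x t)\<^sup>2"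
        using p by (cases "\<Phi> x t = 0") (auto simp: powr_diff)
      then have "(\<Phi> (x + v) t)\<^sup>2 * \<bar>\<Phi> x t\<bar> powr (p - 2)
          = \<bar>\<Phi> x t\<bar> powr p + 2 * (\<bar>\<Phi> x t\<bar> powr (p - 2) * \<Phi> x t * \<Phi> v t) + (\<Phi> v t)\<^sup>2 * \<bar>\<Phi> x t\<bar> powr (p - 2)"
        unfolding elim by (simp add: power2_eq_square algebra_simps)
      then show ?case by simp
    qed
  qed
  finally show ?thesis .
qed

text \<open>The Euclidean structure is that of \<open>L\<^sub>2\<close> with weight \<open>G\<^sup>p\<^sup>-\<^sup>2\<close>, where \<open>G\<^sup>p\<close> is the average of the
  normalized \<open>\<bar>x i\<bar>\<^sup>p\<close> and \<open>x i\<close> is the residual of the best approximation of \<open>f i\<close>.\<close>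

proposition greedy_rate_Lp_ge_2:
  fixes K :: "'a set" and s C\<^sub>2 :: real
  assumes K: "K \<noteq> {}" "K \<subseteq> cball 0 1" and p: "p \<ge> 2" and s: "s > 1 / 2 - 1 / p" and C: "C\<^sub>2 > 0"
    and width: "\<And>n. n \<ge> 1 \<Longrightarrow> kolmogorov_width K n \<le> C\<^sub>2 * real n powr (- s)"
  shows "\<exists>C>0. \<forall>f. greedy_sequence K f \<longrightarrow> (\<forall>n\<ge>1. greedy_error f n
      \<le> C * real n powr (- s + (1 / 2 - 1 / p)) * ln (real n + 2) powr min s (1 / 2))"
proof (rule greedy_rate_of_euclidean_structure[OF K _ C _ width])
  have "1 / p \<le> 1 / 2" using p by (simp add: field_simps)
  then show "s \<ge> 0" "(1::real) > 0" using s by auto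
  fix f n and S :: "'a set"
  assume f: "greedy_sequence K f" and n: "n \<ge> 1" and pos: "greedy_error f n > 0"
    and S: "finite S" "f ` {..<n} \<subseteq> S" "card S \<le> 3 * n"
  have "\<exists>v. v \<in> span (f ` {..<i}) \<and> (\<forall>u\<in>span (f ` {..<i}). norm (f i - v) \<le> norm (f i - u))" for i
    by (rule exists_nearest_point_span[of "f ` {..<i}" "f i"]) auto
  then obtain v where v: "\<And>i. v i \<in> span (f ` {..<i})"
    "\<And>i u. u \<in> span (f ` {..<i}) \<Longrightarrow> norm (f i - v i) \<le> norm (f i - u)" by metis
  define x where "x i = f i - v i" for i
  define r where "r i = norm (x i)" for i
  have r: "r i \<ge> greedy_error f n" "r i > 0" if "i < n" for i
    using greedy_error_le_norm[OF f n _ v(1)[of i]] that pos by (auto simp: r_def x_def)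
  define H where "H t = (\<Sum>i<n. \<bar>\<Phi> (x i) t\<bar> powr p / r i powr p) / real n" for t
  define G where "G t = H t powr (1 / p)" for t
  have H0: "H t \<ge> 0" for t unfolding H_def by (intro divide_nonneg_nonneg sum_nonneg) auto
  have G0: "G t \<ge> 0" for t by (simp add: G_def)
  have Gp: "G t powr p = H t" for t using p H0 by (simp add: G_def powr_powr)
  have [measurable]: "G \<in> borel_measurable M" unfolding G_def H_def by measurable
  have Hint: "integrable M H"
    unfolding H_def by (intro Bochner_Integration.integrable_divide Bochner_Integration.integrable_sum integrable_powr)
  have "integral\<^sup>L M H = (\<Sum>i<n. (\<integral>t. \<bar>\<Phi> (x i) t\<bar> powr p \<partial>M) / r i powr p) / real n"
    unfolding H_def using integrable_powr by simp
  also have "\<dots> = (\<Sum>i<n. 1) / real n"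
    using r by (intro arg_cong2[of _ _ _ _ "(/)"] sum.cong) (auto simp: r_def norm_powr[symmetric])
  also have "\<dots> = 1" using n by simp
  finally have Hone: "integral\<^sup>L M H = 1" .
  have Gint: "integrable M (\<lambda>t. G t powr p)" "integral\<^sup>L M (\<lambda>t. G t powr p) \<le> 1"
    using Hint Hone by (simp_all add: Gp)
  note wsq = integrable_weighted_square[OF p _ G0 Gint(1)]
  define B where "B y z = (\<integral>t. \<Phi> y t * \<Phi> z t * G t powr (p - 2) \<partial>M)" for y z
  have Bsq: "B y y = (\<integral>t. (\<Phi> y t)\<^sup>2 * G t powr (p - 2) \<partial>M)" for y
    by (simp add: B_def power2_eq_square)
  have wi: "integrable M (\<lambda>t. (\<Phi> y t)\<^sup>2 * G t powr (p - 2))" for y by (rule wsq) simp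
  obtain T :: "'a \<Rightarrow> ell2" where T: "linear T" "\<And>y. y \<in> span S \<Longrightarrow> (norm (T y))\<^sup>2 = B y y"
  proof (rule exists_linear_map_of_form[OF S(1), of B])
    note bil = weighted_form_bilinear[OF subspace_UNIV _ _ wi, folded B_def]
    show "B x y = B y x" "B (x + y) z = B x z + B y z" "B (c *\<^sub>R x) z = c * B x z" "B x x \<ge> 0" for x y z c
      by (rule bil; simp)+
  qed (use that in blast)
  let ?\<mu> = "1 / 2 - 1 / p"
  show "\<exists>T :: 'a \<Rightarrow> ell2. linear T \<and> (\<forall>x\<in>span S. norm (T x) \<le> norm x) \<and>
      (\<forall>i<n. \<forall>v\<in>span (f ` {..<i}). greedy_error f n \<le> 1 * real n powr ?\<mu> * norm (T (f i - v)))"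
  proof (intro exI[of _ T] conjI ballI allI impI T(1))
    fix y assume y: "y \<in> span S"
    have "(norm (T y))\<^sup>2 \<le> (norm y)\<^sup>2" unfolding T(2)[OF y] Bsq by (rule wsq(2)) (use Gint in auto)
    then show "norm (T y) \<le> norm y" by (rule power2_le_imp_le) simp
  next
    fix i u assume i: "i < n" and u: "u \<in> span (f ` {..<i})"
    have sub: "f ` {..<i} \<subseteq> S" using S(2) i by auto
    have fS: "f i \<in> span S" using S(2) i by (intro span_base) auto
    have uS: "f i - u \<in> span S"
      using u fS span_mono[OF sub] by (intro span_diff) auto
    define y where "y = v i - u"
    have fu: "f i - u = x i + y" by (simp add: x_def y_def)
    have min: "norm (x i) \<le> norm (x i + \<epsilon> *\<^sub>R y)" for \<epsilon>
    proof -
      have "v i - \<epsilon> *\<^sub>R y \<in> span (f ` {..<i})"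
        unfolding y_def using u v(1) by (intro span_diff span_scale)
      from v(2)[OF this] show ?thesis by (simp add: x_def algebra_simps)
    qed
    have ri: "r i > 0" by (rule r(2)[OF i])
    \<comment> \<open>Keeping only the \<open>i\<close>-th summand of \<open>H\<close> gives
      \<open>G >= n^(-1/p) * |x i| / r i\<close>; \<open>c\<close> is the power \<open>p - 2\<close>
      of the constant in it.\<close>
    define c where "c = (real n powr (- 1 / p) / r i) powr (p - 2)"
    have c: "c * \<bar>\<Phi> (x i) t\<bar> powr (p - 2) \<le> G t powr (p - 2)" for t
    proof -
      have "\<bar>\<Phi> (x i) t\<bar> powr p / r i powr p \<le> (\<Sum>i<n. \<bar>\<Phi> (x i) t\<bar> powr p / r i powr p)"
        using i by (intro member_le_sum) auto
      then have "(\<bar>\<Phi> (x i) t\<bar> powr p / r i powr p) / real n \<le> H t"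
        unfolding H_def by (rule divide_right_mono) simp
      then have "((\<bar>\<Phi> (x i) t\<bar> powr p / r i powr p) / real n) powr (1 / p) \<le> G t"
        unfolding G_def using p by (intro powr_mono2) auto
      also have "((\<bar>\<Phi> (x i) t\<bar> powr p / r i powr p) / real n) powr (1 / p)
          = real n powr (- 1 / p) / r i * \<bar>\<Phi> (x i) t\<bar>"
        using p ri by (simp add: powr_divide powr_powr powr_minus powr_mult field_simps)
      finally have "(real n powr (- 1 / p) / r i * \<bar>\<Phi> (x i) t\<bar>) powr (p - 2) \<le> G t powr (p - 2)"
        using p ri by (intro powr_mono2) auto
      then show ?thesis by (simp only: c_def powr_mult)
    qed
    have xi: "integrable M (\<lambda>t. (\<Phi> (x i + y) t)\<^sup>2 * \<bar>\<Phi> (x i) t\<bar> powr (p - 2))"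
      by (rule integrable_weighted_square(1)[OF p]) (auto simp: integrable_powr)
    have "c * r i powr p \<le> c * (\<integral>t. (\<Phi> (x i + y) t)\<^sup>2 * \<bar>\<Phi> (x i) t\<bar> powr (p - 2) \<partial>M)"
      unfolding r_def by (intro mult_left_mono norm_minimal_imp_weighted_ge[OF p min]) (simp add: c_def)
    also have "\<dots> = (\<integral>t. c * ((\<Phi> (x i + y) t)\<^sup>2 * \<bar>\<Phi> (x i) t\<bar> powr (p - 2)) \<partial>M)" by simp
    also have "\<dots> \<le> (\<integral>t. (\<Phi> (x i + y) t)\<^sup>2 * G t powr (p - 2) \<partial>M)"
    proof (rule integral_mono)
      show "c * ((\<Phi> (x i + y) t)\<^sup>2 * \<bar>\<Phi> (x i) t\<bar> powr (p - 2)) \<le> (\<Phi> (x i + y) t)\<^sup>2 * G t powr (p - 2)" for t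
        using mult_left_mono[OF c[of t], of "(\<Phi> (x i + y) t)\<^sup>2"] by (simp add: mult_ac)
    qed (use xi wi in simp_all)
    also have "\<dots> = (norm (T (f i - u)))\<^sup>2" using T(2)[OF uS] by (simp add: Bsq fu)
    \<comment> \<open>The loss \<open>n^(-(p-2)/p)\<close> is the square of
      \<open>n^(-?\<mu>)\<close>, because \<open>(p - 2) / p = 2 * ?\<mu>\<close>.\<close>
    also have "c * r i powr p = (real n powr (- ?\<mu>) * r i)\<^sup>2"
    proof -
      have "c = real n powr ((- 1 / p) * (p - 2)) / r i powr (p - 2)"
        using ri by (simp add: c_def powr_divide powr_powr)
      also have "(- 1 / p) * (p - 2) = - ?\<mu> + - ?\<mu>" using p by (simp add: field_simps)
      also have "real n powr (- ?\<mu> + - ?\<mu>) = (real n powr (- ?\<mu>))\<^sup>2"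
        by (simp only: powr_add power2_eq_square)
      finally have "c * r i powr p = (real n powr (- ?\<mu>))\<^sup>2 * (r i powr p / r i powr (p - 2))" by simp
      also have "r i powr p / r i powr (p - 2) = (r i)\<^sup>2" using ri by (simp flip: powr_diff)
      finally show ?thesis by (simp add: power_mult_distrib)
    qed
    finally have "real n powr (- ?\<mu>) * r i \<le> norm (T (f i - u))"
      by (rule power2_le_imp_le) simp
    then have "real n powr ?\<mu> * (real n powr (- ?\<mu>) * r i) \<le> real n powr ?\<mu> * norm (T (f i - u))"
      by (rule mult_left_mono) simp
    also have "real n powr ?\<mu> * (real n powr (- ?\<mu>) * r i) = r i"
      using n by (simp only: mult.assoc[symmetric] powr_add[symmetric]) simp
    finally show "greedy_error f n \<le> 1 * real n powr ?\<mu> * norm (T (f i - u))"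
      using r(1)[OF i] by simp
  qed
qed

end

section \<open>Change of density\<close>

text \<open>A Parseval frame instead of an orthonormal basis: some \<open>e j\<close> may be 0, so
  \<open>N\<close> can be the number of spanning vectors even if these are dependent.\<close>

definition parseval_system :: "'a set \<Rightarrow> nat \<Rightarrow> ('a \<Rightarrow> 'a \<Rightarrow> real) \<Rightarrow> (nat \<Rightarrow> 'a) \<Rightarrow> bool" where
  "parseval_system V N B e \<longleftrightarrow>
    (\<forall>j<N. e j \<in> V) \<and> (\<forall>x\<in>V. \<forall>y\<in>V. B x y = (\<Sum>j<N. B x (e j) * B (e j) y))"

locale Lp_subspace = Lp_representation M \<Phi> p
  for M :: "'b measure" and \<Phi> :: "'a::real_normed_vector \<Rightarrow> 'b \<Rightarrow> real" and p :: real +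
  fixes b :: "nat \<Rightarrow> 'a" and N :: nat
  assumes p_less_2: "p < 2"
begin

definition V :: "'a set" where
  "V = span (b ` {..<N})"

text \<open>A reference density in \<open>L_p\<close> that dominates every function of
  \<open>V\<close> up to a constant.\<close>

definition G\<^sub>0 :: "'b \<Rightarrow> real" where
  "G\<^sub>0 t = (\<Sum>j<N. \<bar>\<Phi> (b j) t\<bar> powr p) powr (1 / p)"

text \<open>Comparability with \<open>G\<^sub>0\<close> makes the logarithmic sup distance of two
  weights finite. It also gives all weights the same zero set up to a null set, so the value 0 of
  \<open>G powr (p - 2)\<close> there is consistent.\<close>

definition weight :: "('b \<Rightarrow> real) \<Rightarrow> bool" where
  "weight G \<longleftrightarrow> G \<in> borel_measurable M \<and> (\<forall>t. G t \<ge> 0) \<and>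
    (\<exists>k>0. AE t in M. G\<^sub>0 t \<le> k * G t \<and> G t \<le> k * G\<^sub>0 t)"

definition form :: "('b \<Rightarrow> real) \<Rightarrow> 'a \<Rightarrow> 'a \<Rightarrow> real" where
  "form G x y = (\<integral>t. \<Phi> x t * \<Phi> y t * G t powr (p - 2) \<partial>M)"

text \<open>The square of \<open>G'\<close> is the diagonal of the reproducing kernel of
  \<open>form G\<close> on \<open>V\<close>. It is a relation because the pointwise values depend on
  the Parseval system and its representatives; \<open>christoffel_antimono\<close> with
  \<open>\<kappa> = 1\<close> shows that they agree almost everywhere.\<close>

definition christoffel :: "('b \<Rightarrow> real) \<Rightarrow> ('b \<Rightarrow> real) \<Rightarrow> bool" where
  "christoffel G G' \<longleftrightarrow> (\<exists>e. parseval_system V N (form G) e \<and> (\<forall>t. G' t = sqrt (\<Sum>j<N. (\<Phi> (e j) t)\<^sup>2)))"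

lemma subspace_V: "subspace V"
  by (simp add: V_def)

lemma G0_nonneg: "G\<^sub>0 t \<ge> 0"
  by (simp add: G\<^sub>0_def)

lemma G0_powr: "G\<^sub>0 t powr p = (\<Sum>j<N. \<bar>\<Phi> (b j) t\<bar> powr p)"
  using p_ge_1 by (simp add: G\<^sub>0_def powr_powr sum_nonneg)

lemma weight_G0: "weight G\<^sub>0"
proof -
  have "G\<^sub>0 \<in> borel_measurable M" unfolding G\<^sub>0_def by measurable
  then show ?thesis
    unfolding weight_def using G0_nonneg by (auto intro!: exI[of _ 1])
qed

lemma weightD:
  assumes "weight G"
  shows "G \<in> borel_measurable M" and "G t \<ge> 0"
  using assms by (auto simp: weight_def)

lemma rep_le_G0:
  assumes "x \<in> V"
  shows "\<exists>k\<ge>0. AE t in M. \<bar>\<Phi> x t\<bar> \<le> k * G\<^sub>0 t"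
  using assms unfolding V_def
proof (induction rule: span_induct_alt)
  case base
  show ?case using rep_zero by (intro exI[of _ 0]) auto
next
  case (step c y x)
  then obtain k j where k: "k \<ge> 0" "AE t in M. \<bar>\<Phi> x t\<bar> \<le> k * G\<^sub>0 t" and j: "j < N" "y = b j" by auto
  show ?case
  proof (intro exI[of _ "\<bar>c\<bar> + k"] conjI)
    show "AE t in M. \<bar>\<Phi> (c *\<^sub>R y + x) t\<bar> \<le> (\<bar>c\<bar> + k) * G\<^sub>0 t"
      using rep_add[of "c *\<^sub>R y" x] rep_scaleR[of c y] k(2)
    proof eventually_elim
      case (elim t)
      have "\<bar>\<Phi> y t\<bar> powr p \<le> (\<Sum>j<N. \<bar>\<Phi> (b j) t\<bar> powr p)"
        unfolding j(2) using j(1) by (intro member_le_sum) auto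
      then have "(\<bar>\<Phi> y t\<bar> powr p) powr (1 / p) \<le> G\<^sub>0 t"
        unfolding G\<^sub>0_def using p_ge_1 by (intro powr_mono2) auto
      then have "\<bar>\<Phi> y t\<bar> \<le> G\<^sub>0 t" using p_ge_1 by (simp add: powr_powr)
      then have "\<bar>c\<bar> * \<bar>\<Phi> y t\<bar> \<le> \<bar>c\<bar> * G\<^sub>0 t" by (rule mult_left_mono) simp
      then show ?case
        using elim abs_triangle_ineq[of "c * \<Phi> y t" "\<Phi> x t"] by (simp add: abs_mult distrib_right)
    qed
  qed (use k in simp)
qed

lemma rep_le_weight:
  assumes "weight G" "x \<in> V"
  shows "\<exists>k\<ge>0. AE t in M. \<bar>\<Phi> x t\<bar> \<le> k * G t"
proof -
  obtain k where k: "k \<ge> 0" "AE t in M. \<bar>\<Phi> x t\<bar> \<le> k * G\<^sub>0 t" using rep_le_G0[OF assms(2)] by blast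
  obtain l where l: "l > 0" "AE t in M. G\<^sub>0 t \<le> l * G t \<and> G t \<le> l * G\<^sub>0 t"
    using assms(1) by (auto simp: weight_def)
  show ?thesis
  proof (intro exI[of _ "k * l"] conjI)
    show "AE t in M. \<bar>\<Phi> x t\<bar> \<le> k * l * G t"
      using k(2) l(2)
    proof eventually_elim
      case (elim t)
      then have "k * G\<^sub>0 t \<le> k * (l * G t)" using k(1) by (intro mult_left_mono) auto
      then show ?case using elim by (simp add: mult.assoc)
    qed
  qed (use k l in simp)
qed

lemma integrable_weight_powr:
  assumes "weight G"
  shows "integrable M (\<lambda>t. G t powr p)"
proof -
  obtain k where k: "k > 0" "AE t in M. G\<^sub>0 t \<le> k * G t \<and> G t \<le> k * G\<^sub>0 t"
    using assms by (auto simp: weight_def)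
  note [measurable] = weightD(1)[OF assms]
  show ?thesis
  proof (rule Bochner_Integration.integrable_bound)
    show "integrable M (\<lambda>t. k powr p * G\<^sub>0 t powr p)"
      unfolding G0_powr
      by (intro Bochner_Integration.integrable_mult_right Bochner_Integration.integrable_sum integrable_powr)
    show "AE t in M. norm (G t powr p) \<le> norm (k powr p * G\<^sub>0 t powr p)"
      using k(2)
    proof eventually_elim
      case (elim t)
      then have "G t powr p \<le> (k * G\<^sub>0 t) powr p"
        using p_ge_1 weightD(2)[OF assms] by (intro powr_mono2) auto
      then show ?case by (simp add: powr_mult)
    qed
  qed simp
qed

lemma square_weight_powr:
  assumes "g \<ge> 0"
  shows "g\<^sup>2 * g powr (p - 2) = g powr p"
  using assms p_ge_1 by (cases "g = 0") (auto simp: powr_diff)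

lemma integrable_square_weight:
  assumes G: "weight G" and x: "x \<in> V"
  shows "integrable M (\<lambda>t. (\<Phi> x t)\<^sup>2 * G t powr (p - 2))"
proof -
  obtain k where k: "k \<ge> 0" "AE t in M. \<bar>\<Phi> x t\<bar> \<le> k * G t" using rep_le_weight[OF assms] by blast
  note [measurable] = weightD(1)[OF G]
  show ?thesis
  proof (rule Bochner_Integration.integrable_bound)
    show "integrable M (\<lambda>t. k\<^sup>2 * G t powr p)"
      by (intro Bochner_Integration.integrable_mult_right integrable_weight_powr G)
    show "AE t in M. norm ((\<Phi> x t)\<^sup>2 * G t powr (p - 2)) \<le> norm (k\<^sup>2 * G t powr p)"
      using k(2)
    proof eventually_elim
      case (elim t)
      then have "(\<Phi> x t)\<^sup>2 \<le> (k * G t)\<^sup>2" by (metis abs_ge_zero power2_abs power_mono)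
      then have "(\<Phi> x t)\<^sup>2 * G t powr (p - 2) \<le> (k * G t)\<^sup>2 * G t powr (p - 2)" by (rule mult_right_mono) simp
      also have "\<dots> = k\<^sup>2 * G t powr p"
        using square_weight_powr[OF weightD(2)[OF G, of t]] by (simp add: power_mult_distrib mult.assoc)
      finally show ?case by (simp add: abs_mult)
    qed
  qed simp
qed

lemma form_bilinear:
  assumes G: "weight G"
  shows "form G x y = form G y x"
    and "x \<in> V \<Longrightarrow> y \<in> V \<Longrightarrow> z \<in> V \<Longrightarrow> form G (x + y) z = form G x z + form G y z"
    and "x \<in> V \<Longrightarrow> z \<in> V \<Longrightarrow> form G (c *\<^sub>R x) z = c * form G x z"
    and "form G x x \<ge> 0"
proof -
  have w: "(\<lambda>t. G t powr (p - 2)) \<in> borel_measurable M"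
    using weightD(1)[OF G] by measurable
  note bil = weighted_form_bilinear[OF subspace_V w _ integrable_square_weight[OF G], folded form_def]
  show "form G x y = form G y x" by (rule bil(1)) simp_all
  show "x \<in> V \<Longrightarrow> y \<in> V \<Longrightarrow> z \<in> V \<Longrightarrow> form G (x + y) z = form G x z + form G y z" by (rule bil(2)) simp_all
  show "x \<in> V \<Longrightarrow> z \<in> V \<Longrightarrow> form G (c *\<^sub>R x) z = c * form G x z" by (rule bil(3)) simp_all
  show "form G x x \<ge> 0" by (rule bil(4)) simp_all
qed

lemma form_self: "form G x x = (\<integral>t. (\<Phi> x t)\<^sup>2 * G t powr (p - 2) \<partial>M)"
  by (simp add: form_def power2_eq_square)

lemma form_sum_left:
  assumes G: "weight G" and "finite J" "\<And>j. j \<in> J \<Longrightarrow> e j \<in> V" "z \<in> V"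
  shows "form G (\<Sum>j\<in>J. c j *\<^sub>R e j) z = (\<Sum>j\<in>J. c j * form G (e j) z)"
  using assms(2,3)
proof (induction J rule: finite_induct)
  case empty
  show ?case using form_bilinear(3)[OF G assms(4,4), of 0] by simp
next
  case (insert j J)
  have "(\<Sum>j\<in>J. c j *\<^sub>R e j) \<in> V" "c j *\<^sub>R e j \<in> V"
    using insert.prems subspace_V by (auto intro!: subspace_sum subspace_scale)
  then show ?case
    using insert assms(4) by (simp add: form_bilinear(2,3)[OF G])
qed

text \<open>Where \<open>G\<close> vanishes the weight in the form is 0, not infinite, but there
  \<open>|x| <= k * G\<close> makes \<open>x\<close> vanish as well.\<close>

lemma form_definite:
  assumes G: "weight G" and x: "x \<in> V" and "form G x x = 0"
  shows "x = 0"
proof -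
  obtain k where k: "k \<ge> 0" "AE t in M. \<bar>\<Phi> x t\<bar> \<le> k * G t" using rep_le_weight[OF G x] by blast
  have "AE t in M. (\<Phi> x t)\<^sup>2 * G t powr (p - 2) = 0"
    using assms(3) integral_nonneg_eq_0_iff_AE[OF integrable_square_weight[OF G x]] by (simp add: form_self)
  then have "AE t in M. \<bar>\<Phi> x t\<bar> powr p = 0"
    using k(2) by eventually_elim auto
  then have "(\<integral>t. \<bar>\<Phi> x t\<bar> powr p \<partial>M) = (\<integral>t. 0 \<partial>M)" by (intro integral_cong_AE) auto
  then show "x = 0" using norm_powr[of x] by simp
qed

lemma exists_christoffel:
  assumes G: "weight G"
  obtains G' where "christoffel G G'"
proof -
  have "\<exists>e. parseval_system V N (form G) e"
    unfolding parseval_system_def V_def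
  proof (rule exists_parseval_system[of b N "form G"])
    note bil = form_bilinear[OF G, unfolded V_def]
    show "form G x y = form G y x" "form G x x \<ge> 0" for x y by (rule bil)+
    show "form G (x + y) z = form G x z + form G y z"
      if "x \<in> span (b ` {..<N})" "y \<in> span (b ` {..<N})" "z \<in> span (b ` {..<N})" for x y z
      by (rule bil(2)[OF that])
    show "form G (c *\<^sub>R x) z = c * form G x z"
      if "x \<in> span (b ` {..<N})" "z \<in> span (b ` {..<N})" for x z c
      by (rule bil(3)[OF that])
  qed blast
  then obtain e where "parseval_system V N (form G) e" ..
  then show thesis
    using that[of "\<lambda>t. sqrt (\<Sum>j<N. (\<Phi> (e j) t)\<^sup>2)"] by (auto simp: christoffel_def)
qed

text \<open>The residual of the expansion has form 0 with every vector of \<open>V\<close>, so it is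
  0 by definiteness.\<close>

lemma parseval_expansion:
  assumes G: "weight G" and e: "parseval_system V N (form G) e" and x: "x \<in> V"
  shows "x = (\<Sum>j<N. form G x (e j) *\<^sub>R e j)"
    and "form G x x = (\<Sum>j<N. (form G x (e j))\<^sup>2)"
    and "AE t in M. \<Phi> x t = (\<Sum>j<N. form G x (e j) * \<Phi> (e j) t)"
proof -
  have eV: "e j \<in> V" if "j < N" for j using e that by (simp add: parseval_system_def)
  have parseval: "form G x y = (\<Sum>j<N. form G x (e j) * form G (e j) y)" if "x \<in> V" "y \<in> V" for x y
    using e that unfolding parseval_system_def by blast
  define s where "s = (\<Sum>j<N. form G x (e j) *\<^sub>R e j)"
  have s: "s \<in> V" unfolding s_def using eV subspace_V by (auto intro!: subspace_sum subspace_scale)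
  have d: "x - s \<in> V" using x s subspace_V by (intro subspace_diff)
  have "form G s y = form G x y" if "y \<in> V" for y
    unfolding s_def
    using form_sum_left[OF G finite_lessThan _ that, of N e "\<lambda>j. form G x (e j)"] eV parseval[OF x that] by simp
  moreover have "form G x y = form G (x - s) y + form G s y" if "y \<in> V" for y
    using form_bilinear(2)[OF G d s that] by simp
  ultimately have "form G (x - s) (x - s) = 0" using d by fastforce
  then show x_eq: "x = (\<Sum>j<N. form G x (e j) *\<^sub>R e j)"
    using form_definite[OF G d] by (simp add: s_def)
  show "form G x x = (\<Sum>j<N. (form G x (e j))\<^sup>2)"
    unfolding parseval[OF x x] power2_eq_square
    by (intro sum.cong refl arg_cong2[of _ _ _ _ times] form_bilinear(1)[OF G])
  show "AE t in M. \<Phi> x t = (\<Sum>j<N. form G x (e j) * \<Phi> (e j) t)"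
    using rep_sum[of "{..<N}" "\<lambda>j. form G x (e j)" e] x_eq by simp
qed

text \<open>Cauchy-Schwarz in the Parseval expansion.\<close>

lemma rep_le_christoffel:
  assumes G: "weight G" and G': "christoffel G G'" and x: "x \<in> V"
  shows "AE t in M. \<bar>\<Phi> x t\<bar> \<le> sqrt (form G x x) * G' t"
proof -
  obtain e where e: "parseval_system V N (form G) e" "\<And>t. G' t = sqrt (\<Sum>j<N. (\<Phi> (e j) t)\<^sup>2)"
    using G' by (auto simp: christoffel_def)
  note ex = parseval_expansion[OF G e(1) x]
  from ex(3) show ?thesis
  proof eventually_elim
    case (elim t)
    have "(\<Phi> x t)\<^sup>2 \<le> form G x x * (\<Sum>j<N. (\<Phi> (e j) t)\<^sup>2)"
      unfolding elim ex(2) by (rule Cauchy_Schwarz_ineq_sum)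
    then have "sqrt ((\<Phi> x t)\<^sup>2) \<le> sqrt (form G x x * (\<Sum>j<N. (\<Phi> (e j) t)\<^sup>2))"
      by (rule real_sqrt_le_mono)
    then show ?case by (simp add: real_sqrt_mult e(2))
  qed
qed

text \<open>Keeps the iteration inside the class of weights. Each \<open>e j\<close> is dominated by
  \<open>G\<^sub>0\<close>, and each \<open>b j\<close> by \<open>G'\<close> through
  \<open>rep_le_christoffel\<close>; summation gives the two sides.\<close>

lemma weight_christoffel:
  assumes G: "weight G" and G': "christoffel G G'"
  shows "weight G'"
proof -
  obtain e where e: "parseval_system V N (form G) e" "\<And>t. G' t = sqrt (\<Sum>j<N. (\<Phi> (e j) t)\<^sup>2)"
    using G' by (auto simp: christoffel_def)
  have eV: "e j \<in> V" if "j < N" for j using e that by (simp add: parseval_system_def)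
  have "\<exists>k. k \<ge> 0 \<and> (j < N \<longrightarrow> (AE t in M. \<bar>\<Phi> (e j) t\<bar> \<le> k * G\<^sub>0 t))" for j
    using rep_le_G0[OF eV[of j]] by (cases "j < N") auto
  then obtain k where k: "\<And>j. k j \<ge> 0" "\<And>j. j < N \<Longrightarrow> AE t in M. \<bar>\<Phi> (e j) t\<bar> \<le> k j * G\<^sub>0 t"
    by metis
  define l where "l j = sqrt (form G (b j) (b j))" for j
  have l: "l j \<ge> 0" for j using form_bilinear(4)[OF G] by (simp add: l_def)
  have bV: "b j \<in> V" if "j < N" for j using that by (auto simp: V_def intro: span_base)
  have lb: "AE t in M. \<bar>\<Phi> (b j) t\<bar> \<le> l j * G' t" if "j < N" for j
    unfolding l_def by (rule rep_le_christoffel[OF G G' bV[OF that]])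
  have G'0: "G' t \<ge> 0" for t by (simp add: e(2) sum_nonneg)
  define c where "c = (\<Sum>j<N. k j) + (\<Sum>j<N. l j powr p) powr (1 / p) + 1"
  have c: "c > 0" "(\<Sum>j<N. k j) \<le> c" "(\<Sum>j<N. l j powr p) powr (1 / p) \<le> c"
    unfolding c_def using k(1) by (auto simp: sum_nonneg intro!: add_nonneg_pos)
  have "AE t in M. \<forall>j\<in>{..<N}. \<bar>\<Phi> (e j) t\<bar> \<le> k j * G\<^sub>0 t \<and> \<bar>\<Phi> (b j) t\<bar> \<le> l j * G' t"
    using k(2) lb by (intro AE_finite_allI AE_conjI) auto
  then have "AE t in M. G\<^sub>0 t \<le> c * G' t \<and> G' t \<le> c * G\<^sub>0 t"
  proof eventually_elim
    case (elim t)
    have "G' t \<le> (\<Sum>j<N. \<bar>\<Phi> (e j) t\<bar>)"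
      unfolding e(2) by (rule L2_set_le_sum_abs[unfolded L2_set_def])
    also have "\<dots> \<le> (\<Sum>j<N. k j * G\<^sub>0 t)" using elim by (intro sum_mono) auto
    also have "\<dots> = (\<Sum>j<N. k j) * G\<^sub>0 t" by (simp add: sum_distrib_right)
    also have "\<dots> \<le> c * G\<^sub>0 t" by (rule mult_right_mono[OF c(2) G0_nonneg])
    finally have 1: "G' t \<le> c * G\<^sub>0 t" .
    have "(\<Sum>j<N. \<bar>\<Phi> (b j) t\<bar> powr p) \<le> (\<Sum>j<N. (l j * G' t) powr p)"
      using elim p_ge_1 by (intro sum_mono powr_mono2) auto
    also have "\<dots> = (\<Sum>j<N. l j powr p) * G' t powr p" by (simp add: powr_mult sum_distrib_right)
    finally have "G\<^sub>0 t \<le> ((\<Sum>j<N. l j powr p) * G' t powr p) powr (1 / p)"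
      unfolding G\<^sub>0_def using p_ge_1 by (intro powr_mono2) (auto intro: sum_nonneg)
    also have "\<dots> = (\<Sum>j<N. l j powr p) powr (1 / p) * G' t"
      using p_ge_1 G'0 by (simp add: powr_mult powr_powr sum_nonneg)
    also have "\<dots> \<le> c * G' t" by (rule mult_right_mono[OF c(3) G'0])
    finally show ?case using 1 by simp
  qed
  moreover have "G' \<in> borel_measurable M"
  proof -
    have "G' = (\<lambda>t. sqrt (\<Sum>j<N. (\<Phi> (e j) t)\<^sup>2))" using e(2) by (simp add: fun_eq_iff)
    then show ?thesis by simp
  qed
  ultimately show ?thesis
    unfolding weight_def using G'0 c(1) by blast
qed

text \<open>The kernel \<open>x\<close> of \<open>form G\<close> at \<open>t\<close> has
  \<open>form G x x <= (G' t)^2\<close> and represents the value \<open>(G' t)^2\<close> at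
  \<open>t\<close>; estimating this value through \<open>form H\<close> gives
  \<open>(G' t)^2 <= \<kappa> * G' t * H' t\<close>. Since \<open>x\<close> depends on
  \<open>t\<close>, an almost everywhere statement about \<open>x\<close> would be useless: only the
  expansions of the finitely many \<open>e j\<close> in the system of \<open>H\<close> are evaluated
  at \<open>t\<close>.\<close>

lemma christoffel_antimono:
  assumes G: "weight G" "christoffel G G'" and H: "weight H" "christoffel H H'"
    and \<kappa>: "\<kappa> \<ge> 0" and le: "\<And>x. x \<in> V \<Longrightarrow> form H x x \<le> \<kappa>\<^sup>2 * form G x x"
  shows "AE t in M. G' t \<le> \<kappa> * H' t"
proof -
  obtain e where e: "parseval_system V N (form G) e" "\<And>t. G' t = sqrt (\<Sum>j<N. (\<Phi> (e j) t)\<^sup>2)"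
    using G(2) by (auto simp: christoffel_def)
  obtain h where h: "parseval_system V N (form H) h" "\<And>t. H' t = sqrt (\<Sum>j<N. (\<Phi> (h j) t)\<^sup>2)"
    using H(2) by (auto simp: christoffel_def)
  have eV: "e j \<in> V" if "j < N" for j using e that by (simp add: parseval_system_def)
  have hV: "h j \<in> V" if "j < N" for j using h that by (simp add: parseval_system_def)
  have "AE t in M. \<forall>j\<in>{..<N}. \<Phi> (e j) t = (\<Sum>l<N. form H (e j) (h l) * \<Phi> (h l) t)"
    by (intro AE_finite_allI) (use parseval_expansion(3)[OF H(1) h(1)] eV in auto)
  then show ?thesis
  proof eventually_elim
    case (elim t)
    define x where "x = (\<Sum>j<N. \<Phi> (e j) t *\<^sub>R e j)"
    have x: "x \<in> V" unfolding x_def using eV subspace_V by (auto intro!: subspace_sum subspace_scale)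
    have G'2: "(G' t)\<^sup>2 = (\<Sum>j<N. (\<Phi> (e j) t)\<^sup>2)" by (simp add: e(2) sum_nonneg)
    have H'2: "(H' t)\<^sup>2 = (\<Sum>j<N. (\<Phi> (h j) t)\<^sup>2)" by (simp add: h(2) sum_nonneg)
    have pos: "G' t \<ge> 0" "H' t \<ge> 0" by (simp_all add: e(2) h(2) sum_nonneg)
    have "form G x x = (\<Sum>j<N. \<Phi> (e j) t * form G (e j) x)"
      using form_sum_left[OF G(1) _ eV x, of "{..<N}" id "\<lambda>j. \<Phi> (e j) t"]
      unfolding x_def[symmetric] id_def by simp
    also have "\<dots> = (\<Sum>j<N. \<Phi> (e j) t * form G x (e j))"
      by (intro sum.cong refl arg_cong2[of _ _ _ _ times] form_bilinear(1)[OF G(1)])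
    finally have "(form G x x)\<^sup>2 \<le> (\<Sum>j<N. (\<Phi> (e j) t)\<^sup>2) * (\<Sum>j<N. (form G x (e j))\<^sup>2)"
      by (metis Cauchy_Schwarz_ineq_sum)
    also have "\<dots> = (G' t)\<^sup>2 * form G x x"
      using parseval_expansion(2)[OF G(1) e(1) x] by (simp add: G'2)
    finally have Gx: "form G x x \<le> (G' t)\<^sup>2"
      using form_bilinear(4)[OF G(1), of x] by (cases "form G x x = 0") (auto simp: power2_eq_square)
    have "(G' t)\<^sup>2 = (\<Sum>j<N. \<Phi> (e j) t * \<Phi> (e j) t)"
      unfolding G'2 by (simp add: power2_eq_square)
    also have "\<dots> = (\<Sum>j<N. \<Phi> (e j) t * (\<Sum>l<N. form H (e j) (h l) * \<Phi> (h l) t))"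
      using elim by (intro sum.cong) auto
    also have "\<dots> = (\<Sum>l<N. (\<Sum>j<N. \<Phi> (e j) t * form H (e j) (h l)) * \<Phi> (h l) t)"
      unfolding sum_distrib_left sum_distrib_right by (subst sum.swap) (simp add: mult.assoc)
    also have "\<dots> = (\<Sum>l<N. form H x (h l) * \<Phi> (h l) t)"
    proof (rule sum.cong)
      fix l assume "l \<in> {..<N}"
      then have "h l \<in> V" using hV by simp
      from form_sum_left[OF H(1) finite_lessThan _ this, of N e "\<lambda>j. \<Phi> (e j) t"] eV
      show "(\<Sum>j<N. \<Phi> (e j) t * form H (e j) (h l)) * \<Phi> (h l) t = form H x (h l) * \<Phi> (h l) t"
        unfolding x_def by simp
    qed simp
    finally have "((G' t)\<^sup>2)\<^sup>2 \<le> (\<Sum>l<N. (form H x (h l))\<^sup>2) * (\<Sum>l<N. (\<Phi> (h l) t)\<^sup>2)"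
      by (metis Cauchy_Schwarz_ineq_sum)
    also have "\<dots> = form H x x * (H' t)\<^sup>2"
      using parseval_expansion(2)[OF H(1) h(1) x] by (simp add: H'2)
    also have "\<dots> \<le> \<kappa>\<^sup>2 * (G' t)\<^sup>2 * (H' t)\<^sup>2"
      using le[OF x] mult_left_mono[OF Gx, of "\<kappa>\<^sup>2"] by (intro mult_right_mono) auto
    finally have "(G' t)\<^sup>2 * (G' t)\<^sup>2 \<le> (G' t)\<^sup>2 * (\<kappa> * H' t)\<^sup>2"
      by (simp add: power_mult_distrib power2_eq_square mult_ac)
    then have "(G' t)\<^sup>2 \<le> (\<kappa> * H' t)\<^sup>2 \<or> G' t = 0"
      using mult_le_cancel_left_pos[of "(G' t)\<^sup>2" "(G' t)\<^sup>2" "(\<kappa> * H' t)\<^sup>2"]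
      by (cases "G' t = 0") simp_all
    then show ?case
      using pos \<kappa> by (auto intro: power2_le_imp_le)
  qed
qed

text \<open>The exponent \<open>p - 2\<close> is negative, so \<open>G <= k * H\<close> gives
  \<open>form H <= k powr (2 - p) * form G\<close>; taking \<open>\<kappa>\<close> as the square
  root of this factor leaves the exponent \<open>1 - p / 2 < 1\<close>.\<close>

lemma christoffel_contraction:
  assumes G: "weight G" "christoffel G G'" and H: "weight H" "christoffel H H'"
    and k: "k > 0" and le: "AE t in M. G t \<le> k * H t"
  shows "AE t in M. G' t \<le> k powr (1 - p / 2) * H' t"
proof (rule christoffel_antimono[OF G H])
  fix x assume x: "x \<in> V"
  obtain c where c: "c > 0" "AE t in M. G\<^sub>0 t \<le> c * G t \<and> G t \<le> c * G\<^sub>0 t"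
    using G(1) by (auto simp: weight_def)
  obtain d where d: "d > 0" "AE t in M. G\<^sub>0 t \<le> d * H t \<and> H t \<le> d * G\<^sub>0 t"
    using H(1) by (auto simp: weight_def)
  have k2: "(k powr (1 - p / 2))\<^sup>2 = k powr (2 - p)"
    by (simp add: power2_eq_square flip: powr_add)
  have "form H x x = (\<integral>t. (\<Phi> x t)\<^sup>2 * H t powr (p - 2) \<partial>M)" by (rule form_self)
  also have "\<dots> \<le> (\<integral>t. k powr (2 - p) * ((\<Phi> x t)\<^sup>2 * G t powr (p - 2)) \<partial>M)"
  proof (rule integral_mono_AE)
    show "AE t in M. (\<Phi> x t)\<^sup>2 * H t powr (p - 2) \<le> k powr (2 - p) * ((\<Phi> x t)\<^sup>2 * G t powr (p - 2))"
      using c(2) d(2) le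
    proof eventually_elim
      case (elim t)
      have "H t powr (p - 2) \<le> k powr (2 - p) * G t powr (p - 2)"
      \<comment> \<open>A zero of \<open>G\<close> is one of \<open>G\<^sub>0\<close> and hence of
        \<open>H\<close>, so both powers are 0 there.\<close>
      proof (cases "G t = 0")
        case True
        then have "G\<^sub>0 t = 0" using elim(1) G0_nonneg[of t] by simp
        then have "H t = 0" using elim(2) weightD(2)[OF H(1), of t] by simp
        then show ?thesis using True by simp
      next
        case False
        then have "G t > 0" using weightD(2)[OF G(1), of t] by simp
        then have "(k * H t) powr (p - 2) \<le> G t powr (p - 2)"
          using elim(3) p_less_2 by (intro powr_mono2') auto
        then have "k powr (2 - p) * (k powr (p - 2) * H t powr (p - 2)) \<le> k powr (2 - p) * G t powr (p - 2)"
          using weightD(2)[OF H(1), of t] k by (intro mult_left_mono) (auto simp: powr_mult)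
        moreover have "k powr (2 - p) * k powr (p - 2) = 1" using k by (simp flip: powr_add)
        ultimately show ?thesis by (simp flip: mult.assoc)
      qed
      then have "(\<Phi> x t)\<^sup>2 * H t powr (p - 2) \<le> (\<Phi> x t)\<^sup>2 * (k powr (2 - p) * G t powr (p - 2))"
        by (rule mult_left_mono) simp
      then show ?case by (simp only: mult.left_commute)
    qed
  qed (use integrable_square_weight[OF G(1) x] integrable_square_weight[OF H(1) x] in simp_all)
  also have "\<dots> = k powr (2 - p) * form G x x" by (simp add: form_self)
  finally show "form H x x \<le> (k powr (1 - p / 2))\<^sup>2 * form G x x" by (simp only: k2)
qed simp

text \<open>The factor between a weight and its image passes from
  \<open>k powr (\<theta> ^ i)\<close> to \<open>k powr (\<theta> ^ Suc i)\<close> in each step and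
  tends to \<open>k powr 0 = 1\<close>.\<close>

lemma exists_almost_fixed_christoffel:
  "\<exists>G G'. weight G \<and> christoffel G G' \<and> (AE t in M. G t \<le> 2 * G' t \<and> G' t \<le> 2 * G t)"
proof -
  define \<theta> where "\<theta> = 1 - p / 2"
  have \<theta>: "\<theta> > 0" "\<theta> < 1" using p_ge_1 p_less_2 by (auto simp: \<theta>_def)
  obtain H\<^sub>0 where H\<^sub>0: "christoffel G\<^sub>0 H\<^sub>0" using exists_christoffel[OF weight_G0] .
  obtain k where k: "k > 0" "AE t in M. G\<^sub>0 t \<le> k * H\<^sub>0 t \<and> H\<^sub>0 t \<le> k * G\<^sub>0 t"
    using weight_christoffel[OF weight_G0 H\<^sub>0] by (auto simp: weight_def)
  have iter: "\<exists>G G'. weight G \<and> christoffel G G' \<and>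
      (AE t in M. G t \<le> k powr (\<theta> ^ i) * G' t \<and> G' t \<le> k powr (\<theta> ^ i) * G t)" for i
  proof (induction i)
    case 0
    show ?case using weight_G0 H\<^sub>0 k by (intro exI[of _ G\<^sub>0] exI[of _ H\<^sub>0]) simp
  next
    case (Suc i)
    then obtain G G' where G: "weight G" "christoffel G G'"
      and 1: "AE t in M. G t \<le> k powr (\<theta> ^ i) * G' t"
      and 2: "AE t in M. G' t \<le> k powr (\<theta> ^ i) * G t" by auto
    have G': "weight G'" using weight_christoffel[OF G] .
    obtain G'' where G'': "christoffel G' G''" using exists_christoffel[OF G'] .
    have pw: "(k powr (\<theta> ^ i)) powr (1 - p / 2) = k powr (\<theta> ^ Suc i)"
      by (simp add: powr_powr \<theta>_def mult.commute)
    have k': "k powr (\<theta> ^ i) > 0" using k(1) by simp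
    show ?case
      using christoffel_contraction[OF G G' G'' k' 1] christoffel_contraction[OF G' G'' G k' 2] G' G''
      unfolding pw by (intro exI[of _ G'] exI[of _ G'']) auto
  qed
  have "(\<lambda>i. k powr (\<theta> ^ i)) \<longlonglongrightarrow> k powr 0"
    using k(1) \<theta> by (intro tendsto_powr tendsto_const LIMSEQ_realpow_zero) auto
  then have "eventually (\<lambda>i. k powr (\<theta> ^ i) < 2) sequentially"
    using k(1) by (intro order_tendstoD(2)) auto
  then obtain i where i: "k powr (\<theta> ^ i) \<le> 2"
    by (auto simp: eventually_sequentially intro: less_imp_le)
  obtain G G' where G: "weight G" "christoffel G G'"
    "AE t in M. G t \<le> k powr (\<theta> ^ i) * G' t \<and> G' t \<le> k powr (\<theta> ^ i) * G t"
    using iter[of i] by blast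
  have "AE t in M. G t \<le> 2 * G' t \<and> G' t \<le> 2 * G t"
    using G(3)
  proof eventually_elim
    case (elim t)
    have "k powr (\<theta> ^ i) * G' t \<le> 2 * G' t" "k powr (\<theta> ^ i) * G t \<le> 2 * G t"
      using i weightD(2)[OF G(1)] weightD(2)[OF weight_christoffel[OF G(1,2)]]
      by (auto intro: mult_right_mono)
    then show ?case using elim by linarith
  qed
  then show ?thesis using G by blast
qed

text \<open>The integral is the sum of the \<open>form G (e j) (e j)\<close>, and each of these is
  at most 1, because its square is one term of its own Parseval sum.\<close>

lemma form_christoffel_trace:
  assumes G: "weight G" "christoffel G G'"
  shows "integrable M (\<lambda>t. (G' t)\<^sup>2 * G t powr (p - 2))"
    and "(\<integral>t. (G' t)\<^sup>2 * G t powr (p - 2) \<partial>M) \<le> real N"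
proof -
  obtain e where e: "parseval_system V N (form G) e" "\<And>t. G' t = sqrt (\<Sum>j<N. (\<Phi> (e j) t)\<^sup>2)"
    using G(2) by (auto simp: christoffel_def)
  have eV: "e j \<in> V" if "j < N" for j using e that by (simp add: parseval_system_def)
  have eq: "(G' t)\<^sup>2 * G t powr (p - 2) = (\<Sum>j<N. (\<Phi> (e j) t)\<^sup>2 * G t powr (p - 2))" for t
    by (simp add: e(2) sum_nonneg sum_distrib_right)
  have int: "integrable M (\<lambda>t. (\<Phi> (e j) t)\<^sup>2 * G t powr (p - 2))" if "j < N" for j
    by (rule integrable_square_weight[OF G(1) eV[OF that]])
  show "integrable M (\<lambda>t. (G' t)\<^sup>2 * G t powr (p - 2))"
    unfolding eq using int by (intro Bochner_Integration.integrable_sum) auto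
  have le1: "form G (e j) (e j) \<le> 1" if j: "j < N" for j
  proof -
    have "(form G (e j) (e j))\<^sup>2 \<le> (\<Sum>l<N. (form G (e j) (e l))\<^sup>2)"
      using j by (intro member_le_sum) auto
    also have "\<dots> = form G (e j) (e j)" using parseval_expansion(2)[OF G(1) e(1) eV[OF j]] by simp
    finally show ?thesis
      using form_bilinear(4)[OF G(1), of "e j"]
      by (cases "form G (e j) (e j) = 0") (auto simp: power2_eq_square)
  qed
  have "(\<integral>t. (G' t)\<^sup>2 * G t powr (p - 2) \<partial>M) = (\<Sum>j<N. form G (e j) (e j))"
    unfolding eq form_self using int by (intro Bochner_Integration.integral_sum) auto
  also have "\<dots> \<le> (\<Sum>j<N. 1)" using le1 by (intro sum_mono) auto
  finally show "(\<integral>t. (G' t)\<^sup>2 * G t powr (p - 2) \<partial>M) \<le> real N" by simp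
qed

text \<open>An almost fixed point of \<open>G \<mapsto> G'\<close> is, up to constants, the Lewis change of density for \<open>V\<close>.\<close>

lemma exists_lewis_form:
  assumes N: "N \<ge> 1"
  obtains G where "weight G" "\<And>x. x \<in> V \<Longrightarrow> sqrt (form G x x) \<le> 2 * norm x"
    "\<And>x. x \<in> V \<Longrightarrow> norm x \<le> (4 * real N) powr (1 / p - 1 / 2) * sqrt (form G x x)"
proof -
  obtain G G' where G: "weight G" "christoffel G G'"
    and GG': "AE t in M. G t \<le> 2 * G' t \<and> G' t \<le> 2 * G t"
    using exists_almost_fixed_christoffel by blast
  note [measurable] = weightD(1)[OF G(1)]
  have G0: "G t \<ge> 0" for t by (rule weightD(2)[OF G(1)])
  \<comment> \<open>\<open>G <= 2 * G'\<close> turns the trace bound \<open>N\<close> into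
    \<open>4 * N\<close> for the integral of \<open>G^p\<close>.\<close>
  have total: "(\<integral>t. G t powr p \<partial>M) \<le> 4 * real N"
  proof -
    have "(\<integral>t. G t powr p \<partial>M) \<le> (\<integral>t. 4 * ((G' t)\<^sup>2 * G t powr (p - 2)) \<partial>M)"
    proof (rule integral_mono_AE)
      show "AE t in M. G t powr p \<le> 4 * ((G' t)\<^sup>2 * G t powr (p - 2))"
        using GG'
      proof eventually_elim
        case (elim t)
        then have "(G t)\<^sup>2 \<le> (2 * G' t)\<^sup>2" using G0 by (intro power_mono) auto
        then have "(G t)\<^sup>2 * G t powr (p - 2) \<le> (2 * G' t)\<^sup>2 * G t powr (p - 2)" by (rule mult_right_mono) simp
        then show ?case using square_weight_powr[OF G0[of t]] by (simp add: power_mult_distrib mult.assoc)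
      qed
    qed (use integrable_weight_powr[OF G(1)] form_christoffel_trace(1)[OF G] in simp_all)
    also have "\<dots> \<le> 4 * real N" using form_christoffel_trace(2)[OF G] by simp
    finally show ?thesis .
  qed
  have main: "sqrt (form G x x) \<le> 2 * norm x \<and>
      norm x \<le> (4 * real N) powr (1 / p - 1 / 2) * sqrt (form G x x)" if x: "x \<in> V" for x
  proof (cases "x = 0")
    case True
    have "form G 0 0 = 0" using form_bilinear(3)[OF G(1) x x, of 0] True by simp
    then show ?thesis using True by simp
  next
    case False
    define \<beta> where "\<beta> = sqrt (form G x x)"
    have form_pos: "form G x x > 0"
      using form_definite[OF G(1) x] form_bilinear(4)[OF G(1), of x] False by fastforce
    then have \<beta>: "\<beta> > 0" "\<beta>\<^sup>2 = form G x x" by (simp_all add: \<beta>_def)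
    have bound: "AE t in M. \<bar>\<Phi> x t\<bar> \<le> 2 * \<beta> * G t"
      using rep_le_christoffel[OF G x] GG'
    proof eventually_elim
      case (elim t)
      have "\<beta> * G' t \<le> \<beta> * (2 * G t)" using elim \<beta> by (intro mult_left_mono) auto
      then show ?case using elim by (simp add: \<beta>_def mult_ac)
    qed
    note intx = integrable_square_weight[OF G(1) x]
    \<comment> \<open>Splitting \<open>x^2 = |x|^p * |x|^(2-p)\<close> and inserting
      \<open>bound\<close> into the second factor; then \<open>\<beta>^(2-p)\<close> cancels, and
      \<open>2 - p <= p\<close> simplifies the constant.\<close>
    have "\<beta> powr 2 = (\<integral>t. (\<Phi> x t)\<^sup>2 * G t powr (p - 2) \<partial>M)"
      using \<beta> by (simp add: form_self)
    also have "\<dots> \<le> (\<integral>t. (2 * \<beta>) powr (2 - p) * \<bar>\<Phi> x t\<bar> powr p \<partial>M)"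
    proof (rule integral_mono_AE[OF intx])
      show "AE t in M. (\<Phi> x t)\<^sup>2 * G t powr (p - 2) \<le> (2 * \<beta>) powr (2 - p) * \<bar>\<Phi> x t\<bar> powr p"
        using bound
      proof eventually_elim
        case (elim t)
        show ?case
        proof (cases "\<Phi> x t = 0")
          case False
          then have "2 * \<beta> * G t > 0" using elim by (meson less_le_trans zero_less_abs_iff)
          then have Gpos: "G t > 0" using \<beta> by (simp add: zero_less_mult_iff)
          have "(\<Phi> x t)\<^sup>2 = \<bar>\<Phi> x t\<bar> powr p * \<bar>\<Phi> x t\<bar> powr (2 - p)"
            using False by (simp flip: powr_add)
          also have "\<dots> \<le> \<bar>\<Phi> x t\<bar> powr p * (2 * \<beta> * G t) powr (2 - p)"
            using elim p_less_2 by (intro mult_left_mono powr_mono2) auto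
          finally have "(\<Phi> x t)\<^sup>2 * G t powr (p - 2)
              \<le> \<bar>\<Phi> x t\<bar> powr p * (2 * \<beta> * G t) powr (2 - p) * G t powr (p - 2)"
            by (rule mult_right_mono) simp
          also have "\<dots> = \<bar>\<Phi> x t\<bar> powr p * (2 * \<beta>) powr (2 - p) * (G t powr (2 - p) * G t powr (p - 2))"
            by (simp only: powr_mult mult_ac)
          also have "G t powr (2 - p) * G t powr (p - 2) = 1" using Gpos by (simp flip: powr_add)
          finally show ?thesis by (simp add: mult_ac)
        qed simp
      qed
    qed (use integrable_powr in simp)
    also have "\<dots> = (2 * \<beta>) powr (2 - p) * norm x powr p" by (simp add: norm_powr)
    finally have "2 powr p * \<beta> powr 2 \<le> 2 powr p * ((2 * \<beta>) powr (2 - p) * norm x powr p)"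
      by simp
    then have "2 powr p * (\<beta> powr (2 - p) * \<beta> powr p) \<le> 2 powr p * (2 powr (2 - p) * \<beta> powr (2 - p) * norm x powr p)"
      by (simp only: powr_mult powr_add[symmetric]) simp
    then have "\<beta> powr p \<le> 2 powr (2 - p) * norm x powr p"
      using \<beta>(1) by (simp add: mult.left_commute mult.assoc)
    also have "\<dots> \<le> 2 powr p * norm x powr p"
      using p_ge_1 by (intro mult_right_mono powr_mono) auto
    also have "\<dots> = (2 * norm x) powr p" by (simp add: powr_mult)
    finally have le: "\<beta> powr p \<le> (2 * norm x) powr p" .
    have "(\<beta> powr p) powr (1 / p) \<le> ((2 * norm x) powr p) powr (1 / p)"
      by (rule powr_mono2[OF _ _ le]) (use p_ge_1 in simp_all)
    then have upper: "\<beta> \<le> 2 * norm x" using p_ge_1 \<beta>(1) by (simp add: powr_powr)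

    \<comment> \<open>The scale that turns Young's inequality with weights \<open>p / 2\<close> and
      \<open>1 - p / 2\<close> into Hoelder's: \<open>|x|^p / R\<close> is a product of powers of
      two densities, \<open>x^2 * G^(p-2) / \<beta>^2\<close> and \<open>G^p / (4 * N)\<close>, of
      integral at most 1.\<close>
    define R where "R = \<beta> powr p * (4 * real N) powr (1 - p / 2)"
    have R: "R > 0" using \<beta> N by (simp add: R_def)
    have "norm x powr p / R = (\<integral>t. \<bar>\<Phi> x t\<bar> powr p / R \<partial>M)" by (simp add: norm_powr)
    also have "\<dots> \<le> (\<integral>t. p / 2 * ((\<Phi> x t)\<^sup>2 * G t powr (p - 2) / \<beta>\<^sup>2) + (1 - p / 2) * (G t powr p / (4 * real N)) \<partial>M)"
    proof (rule integral_mono_AE)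
      show "AE t in M. \<bar>\<Phi> x t\<bar> powr p / R
          \<le> p / 2 * ((\<Phi> x t)\<^sup>2 * G t powr (p - 2) / \<beta>\<^sup>2) + (1 - p / 2) * (G t powr p / (4 * real N))"
        using bound
      proof eventually_elim
        case (elim t)
        show ?case
        proof (cases "\<Phi> x t = 0")
          case True
          then show ?thesis using p_less_2 by simp
        next
          case False
          then have "2 * \<beta> * G t > 0" using elim by (meson less_le_trans zero_less_abs_iff)
          then have Gpos: "G t > 0" using \<beta> by (simp add: zero_less_mult_iff)
          have "((\<Phi> x t)\<^sup>2 * G t powr (p - 2) / \<beta>\<^sup>2) powr (p / 2) * (G t powr p / (4 * real N)) powr (1 - p / 2)
            = (((\<Phi> x t)\<^sup>2) powr (p / 2) * (G t powr (p - 2)) powr (p / 2) / (\<beta>\<^sup>2) powr (p / 2))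
              * ((G t powr p) powr (1 - p / 2) / (4 * real N) powr (1 - p / 2))"
            by (simp add: powr_mult powr_divide)
          also have "((\<Phi> x t)\<^sup>2) powr (p / 2) = \<bar>\<Phi> x t\<bar> powr p"
            using False powr_powr[of "\<bar>\<Phi> x t\<bar>" 2 "p / 2"] by simp
          also have "(\<beta>\<^sup>2) powr (p / 2) = \<beta> powr p"
            using \<beta>(1) powr_powr[of \<beta> 2 "p / 2"] by simp
          also have "(\<bar>\<Phi> x t\<bar> powr p * (G t powr (p - 2)) powr (p / 2) / \<beta> powr p)
              * ((G t powr p) powr (1 - p / 2) / (4 * real N) powr (1 - p / 2))
            = (\<bar>\<Phi> x t\<bar> powr p / R) * ((G t powr (p - 2)) powr (p / 2) * (G t powr p) powr (1 - p / 2))"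
            by (simp add: R_def)
          also have "(G t powr (p - 2)) powr (p / 2) * (G t powr p) powr (1 - p / 2) = G t powr 0"
            unfolding powr_powr powr_add[symmetric] by (rule arg_cong[where f = "\<lambda>y. G t powr y"]) (simp add: field_simps)
          finally have "\<bar>\<Phi> x t\<bar> powr p / R
            = ((\<Phi> x t)\<^sup>2 * G t powr (p - 2) / \<beta>\<^sup>2) powr (p / 2) * (G t powr p / (4 * real N)) powr (1 - p / 2)"
            using Gpos by simp
          also have "\<dots> \<le> p / 2 * ((\<Phi> x t)\<^sup>2 * G t powr (p - 2) / \<beta>\<^sup>2) + (1 - p / 2) * (G t powr p / (4 * real N))"
            using p_ge_1 p_less_2 by (intro Youngs_inequality_nonneg) auto
          finally show ?thesis .
        qed
      qed
    qed (use intx integrable_weight_powr[OF G(1)] integrable_powr in simp_all)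
    also have "\<dots> = p / 2 * (form G x x / \<beta>\<^sup>2) + (1 - p / 2) * ((\<integral>t. G t powr p \<partial>M) / (4 * real N))"
      using intx integrable_weight_powr[OF G(1)] by (simp add: form_self)
    also have "\<dots> \<le> p / 2 * 1 + (1 - p / 2) * 1"
      using total p_ge_1 p_less_2 \<beta> N form_pos by (intro add_mono mult_left_mono) auto
    finally have "norm x powr p \<le> R" using R by (simp add: pos_divide_le_eq)
    then have "(norm x powr p) powr (1 / p) \<le> R powr (1 / p)"
      using p_ge_1 by (intro powr_mono2) auto
    also have "R powr (1 / p) = \<beta> * (4 * real N) powr ((1 - p / 2) * (1 / p))"
      using \<beta>(1) p_ge_1 by (simp add: R_def powr_mult powr_powr)
    also have "(1 - p / 2) * (1 / p) = 1 / p - 1 / 2" using p_ge_1 by (simp add: field_simps)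
    finally have "norm x \<le> \<beta> * (4 * real N) powr (1 / p - 1 / 2)" using p_ge_1 by (simp add: powr_powr)
    then show ?thesis using upper by (simp add: \<beta>_def mult.commute)
  qed
  show thesis by (rule that[OF G(1)]) (use main in auto)
qed

end

section \<open>The rate for \<open>1 <= p < 2\<close>\<close>

context Lp_representation
begin

proposition greedy_rate_Lp_less_2:
  fixes K :: "'a set" and s C\<^sub>2 :: real
  assumes K: "K \<noteq> {}" "K \<subseteq> cball 0 1" and p: "p < 2" and s: "s > 1 / p - 1 / 2" and C: "C\<^sub>2 > 0"
    and width: "\<And>n. n \<ge> 1 \<Longrightarrow> kolmogorov_width K n \<le> C\<^sub>2 * real n powr (- s)"
  shows "\<exists>C>0. \<forall>f. greedy_sequence K f \<longrightarrow> (\<forall>n\<ge>1. greedy_error f n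
      \<le> C * real n powr (- s + (1 / p - 1 / 2)) * ln (real n + 2) powr min s (1 / 2))"
proof (rule greedy_rate_of_euclidean_structure[OF K _ C _ width])
  let ?\<mu> = "1 / p - 1 / 2"
  \<comment> \<open>The 12 is the 4 of \<open>exists_lewis_form\<close> times the 3 of
    \<open>card S <= 3 * n\<close>; the 2 undoes the halving that makes \<open>T\<close> a
    contraction.\<close>
  let ?A = "2 * 12 powr ?\<mu>"
  have \<mu>: "?\<mu> \<ge> 0" using p p_ge_1 by (simp add: field_simps)
  then show "s \<ge> 0" "?A > 0" using s by auto
  fix f n and S :: "'a set"
  assume f: "greedy_sequence K f" and n: "n \<ge> 1" and pos: "greedy_error f n > 0"
    and S: "finite S" "f ` {..<n} \<subseteq> S" "card S \<le> 3 * n"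
  \<comment> \<open>\<open>S\<close> may be dependent, so \<open>N\<close> only bounds the
    dimension; Parseval systems permit this.\<close>
  define N where "N = card S"
  have "f 0 \<in> S" using S(2) n by auto
  then have N: "N \<ge> 1" "N \<le> 3 * n"
    using S(1,3) card_gt_0_iff[of S] unfolding N_def by auto
  obtain b where b: "bij_betw b {..<N} S"
    using ex_bij_betw_nat_finite[OF S(1)] unfolding N_def atLeast0LessThan by blast
  have sub: "Lp_subspace M \<Phi> p"
    using p Lp_representation_axioms by (simp add: Lp_subspace_def Lp_subspace_axioms_def)
  define form where "form = Lp_subspace.form M \<Phi> p"
  define V where "V = Lp_subspace.V b N"
  define weight where "weight = Lp_subspace.weight M \<Phi> p b N"
  have V: "V = span S" using b by (simp add: V_def Lp_subspace.V_def[OF sub] bij_betw_def)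
  obtain G where G: "weight G" "\<And>x. x \<in> V \<Longrightarrow> sqrt (form G x x) \<le> 2 * norm x"
    "\<And>x. x \<in> V \<Longrightarrow> norm x \<le> (4 * real N) powr ?\<mu> * sqrt (form G x x)"
    using Lp_subspace.exists_lewis_form[OF sub N(1), of b, folded V_def form_def weight_def] by blast
  obtain T :: "'a \<Rightarrow> ell2" where T: "linear T" "\<And>x. x \<in> span S \<Longrightarrow> (norm (T x))\<^sup>2 = form G x x"
  proof (rule exists_linear_map_of_form[OF S(1), of "form G"])
    note bil = Lp_subspace.form_bilinear[OF sub, of b N G, folded V_def form_def weight_def, OF G(1), unfolded V]
    show "form G x y = form G y x" "form G x x \<ge> 0" for x y by (rule bil)+
    show "form G (x + y) z = form G x z + form G y z"
      if "x \<in> span S" "y \<in> span S" "z \<in> span S" for x y z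
      by (rule bil(2)[OF that])
    show "form G (c *\<^sub>R x) z = c * form G x z" if "x \<in> span S" "z \<in> span S" for x z c
      by (rule bil(3)[OF that])
  qed (use that in blast)
  have normT: "norm (T x) = sqrt (form G x x)" if "x \<in> span S" for x
    using T(2)[OF that] by (metis norm_ge_zero real_sqrt_unique)
  have "(4 * real N) powr ?\<mu> \<le> (12 * real n) powr ?\<mu>"
    using N(2) \<mu> by (intro powr_mono2) auto
  then have A: "(4 * real N) powr ?\<mu> \<le> 12 powr ?\<mu> * real n powr ?\<mu>"
    by (simp add: powr_mult)
  show "\<exists>T :: 'a \<Rightarrow> ell2. linear T \<and> (\<forall>x\<in>span S. norm (T x) \<le> norm x) \<and>
      (\<forall>i<n. \<forall>v\<in>span (f ` {..<i}). greedy_error f n \<le> ?A * real n powr ?\<mu> * norm (T (f i - v)))"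
  proof (intro exI[of _ "\<lambda>x. (1 / 2) *\<^sub>R T x"] conjI ballI allI impI linear_compose_scale_right T(1))
    fix x assume x: "x \<in> span S"
    then show "norm ((1 / 2) *\<^sub>R T x) \<le> norm x"
      using G(2)[of x] normT[of x] V by simp
  next
    fix i v assume i: "i < n" and v: "v \<in> span (f ` {..<i})"
    have "f ` {..<i} \<subseteq> S" "f i \<in> S" using S(2) i by auto
    then have m: "f i - v \<in> span S"
      using v span_mono[of "f ` {..<i}" S] by (intro span_diff) (auto intro: span_base)
    have "greedy_error f n \<le> norm (f i - v)"
      using greedy_error_le_norm[OF f n _ v] i by simp
    also have "\<dots> \<le> (4 * real N) powr ?\<mu> * norm (T (f i - v))"
      using G(3)[of "f i - v"] normT[OF m] m V by simp
    also have "\<dots> \<le> 12 powr ?\<mu> * real n powr ?\<mu> * norm (T (f i - v))"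
      by (rule mult_right_mono[OF A]) simp
    also have "\<dots> = ?A * real n powr ?\<mu> * norm ((1 / 2) *\<^sub>R T (f i - v))" by simp
    finally show "greedy_error f n \<le> ?A * real n powr ?\<mu> * norm ((1 / 2) *\<^sub>R T (f i - v))" .
  qed
qed

end

text \<open>For \<open>p = \<infinity>\<close> the exponent is 1/2, which
  \<open>greedy_rate_general\<close> provides in every normed space; the finite exponents split at 2
  according to the sign of \<open>1 / 2 - 1 / p\<close>.\<close>

proposition greedy_rate_Lp:
  fixes K :: "'a::real_normed_vector set" and p :: ennreal and M :: "'b measure"
    and \<Phi> :: "'a \<Rightarrow> 'b \<Rightarrow> real" and s C\<^sub>2 :: real
  assumes K: "K \<noteq> {}" "K \<subseteq> cball 0 1" and p: "1 \<le> p" and Lp: "is_Lp_space p M \<Phi>"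
    and s: "s > \<bar>1 / 2 - enn2real (1 / p)\<bar>" and C: "C\<^sub>2 > 0"
    and width: "\<And>n. n \<ge> 1 \<Longrightarrow> kolmogorov_width K n \<le> C\<^sub>2 * real n powr (- s)"
  shows "\<exists>C>0. \<forall>f. greedy_sequence K f \<longrightarrow> (\<forall>n\<ge>1. greedy_error f n
      \<le> C * real n powr (- s + \<bar>1 / 2 - enn2real (1 / p)\<bar>) * ln (real n + 2) powr min s (1 / 2))"
proof (cases "p = \<infinity>")
  case True
  then have \<mu>: "\<bar>1 / 2 - enn2real (1 / p)\<bar> = 1 / 2" by simp
  have "s > 1 / 2" using s unfolding \<mu> .
  then show ?thesis
    unfolding \<mu> by (rule greedy_rate_general[OF K _ C width])
next
  case False
  have rep: "Lp_representation M \<Phi> (enn2real p)"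
    by (rule is_Lp_space_imp_representation[OF Lp p False])
  then have p_ge_1: "enn2real p \<ge> 1" by (rule Lp_representation.p_ge_1)
  have inv: "enn2real (1 / p) = 1 / enn2real p"
  proof -
    obtain r where r: "r \<ge> 0" "p = ennreal r" using False by (cases p) auto
    then show ?thesis using p_ge_1 divide_ennreal[of 1 r] by simp
  qed
  show ?thesis
  proof (cases "enn2real p \<ge> 2")
    case True
    then have \<mu>: "\<bar>1 / 2 - enn2real (1 / p)\<bar> = 1 / 2 - 1 / enn2real p"
      unfolding inv by (simp add: field_simps)
    have "s > 1 / 2 - 1 / enn2real p" using s unfolding \<mu> .
    then show ?thesis
      unfolding \<mu> by (rule Lp_representation.greedy_rate_Lp_ge_2[OF rep K True _ C width])
  next
    case False
    then have \<mu>: "\<bar>1 / 2 - enn2real (1 / p)\<bar> = 1 / enn2real p - 1 / 2"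
      unfolding inv using p_ge_1 by (simp add: field_simps)
    have "s > 1 / enn2real p - 1 / 2" using s unfolding \<mu> .
    then show ?thesis
      unfolding \<mu> using False by (intro Lp_representation.greedy_rate_Lp_less_2[OF rep K _ _ C width]) auto
  qed
qed

theorem corollary3p3:
  fixes K :: "'a::banach set"
  assumes "compact K" and "K \<noteq> {}" and "K \<subseteq> cball 0 1"
  shows
    "(\<forall>\<mu> s C\<^sub>1 C\<^sub>2 :: real.
        0 \<le> \<mu> \<longrightarrow> \<mu> \<le> 1 / 2 \<longrightarrow> s > \<mu> \<longrightarrow> C\<^sub>1 > 0 \<longrightarrow> C\<^sub>2 > 0 \<longrightarrow>
        (\<forall>n\<ge>1. euclidean_constant TYPE('a) n \<le> ennreal (C\<^sub>1 * real n powr \<mu>)) \<longrightarrow>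
        (\<forall>n\<ge>1. kolmogorov_width K n \<le> C\<^sub>2 * real n powr (- s)) \<longrightarrow>
        (\<exists>C>0. \<forall>f. greedy_sequence K f \<longrightarrow>
           (\<forall>n\<ge>1. greedy_error f n
              \<le> C * real n powr (- s + \<mu>) * ln (real n + 2) powr min s (1 / 2)))) \<and>
     (\<forall>(p :: ennreal) (M :: 'b measure) (\<Phi> :: 'a \<Rightarrow> 'b \<Rightarrow> real) (s :: real) (C\<^sub>2 :: real).
        1 \<le> p \<longrightarrow> is_Lp_space p M \<Phi> \<longrightarrow> s > \<bar>1 / 2 - enn2real (1 / p)\<bar> \<longrightarrow> C\<^sub>2 > 0 \<longrightarrow>
        (\<forall>n\<ge>1. kolmogorov_width K n \<le> C\<^sub>2 * real n powr (- s)) \<longrightarrow>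
        (\<exists>C>0. \<forall>f. greedy_sequence K f \<longrightarrow>
           (\<forall>n\<ge>1. greedy_error f n
              \<le> C * real n powr (- s + \<bar>1 / 2 - enn2real (1 / p)\<bar>)
                  * ln (real n + 2) powr min s (1 / 2))))"
proof (intro conjI allI impI, goal_cases)
  case (1 \<mu> s C\<^sub>1 C\<^sub>2)
  then show ?case
    by (intro greedy_rate_of_euclidean_constant[OF assms(2,3), of \<mu> s C\<^sub>1 C\<^sub>2]) auto
next
  case (2 p M \<Phi> s C\<^sub>2)
  then show ?case
    by (intro greedy_rate_Lp[OF assms(2,3), of p M \<Phi> s C\<^sub>2]) auto
qed

end
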